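(* Let $G$ be a locally compact second countable group. An essentially free nonsingular $G$-space is totally dissipative if and only if it is isomorphic to a translation $G$-space.
   Context: Fix a left Haar measure $\lambda$ on $G$. A Borel $G$-space is a standard Borel space $X$ with a Borel action map $G\times X\to X$, $(g,x)\mapsto g.x$. A standard measure space is a standard Borel space with a $\sigma$-finite Borel measure. A nonsingular $G$-space is a standard measure space $(X,\mu)$ with $X$ a Borel $G$-space and $\mu\circ g\sim\mu$ for all $g\in G$, where $(\mu\circ g)(A)=\mu(g.A)$. It is essentially free if for $\mu$-a.e. $x$ the stabilizer $\{g\in G:g.x=x\}$ is trivial. Two nonsingular $G$-spaces $(X,\mu)$, $(Y,\nu)$ are isomorphic if there are $G$-invariant conull sets $X_o\subseteq X$, $Y_o\subseteq Y$ and a Borel bijection $\varphi:X_o\to Y_o$ with $\varphi_*\mu\sim\nu$ and, for every $g\in G$, $\varphi(g.x)=g.\varphi(x)$ for $\mu$-a.e. $x\in X_o$. The Radon--Nikodym cocycle is a Borel map $\nabla:G\times X\to\mathbb{R}_{>0}$ satisfying $\nabla_e(x)=1$, $\nabla_{gh}(x)=\nabla_g(h.x)\nabla_h(x)$ for all $g,h,x$, and $\nabla_g=\frac{d\mu\circ g}{d\mu}$ $\mu$-a.e. for each $g$. $L^1_+(X,\mu)$ is the class of everywhere strictly positive functions in $L^1(X,\mu)$, and $S_f^G(x)=\int_G\nabla_g(x)f(g.x)\,d\lambda(g)$. The Hopf decomposition is the essentially unique decomposition $X=\mathcal{C}\sqcup\mathcal{D}$ into $G$-invariant Borel sets such that for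 every $f\in L^1_+(X,\mu)$, modulo $\mu$, $\mathcal{C}=\{S_f^G=+\infty\}$ and $\mathcal{D}=\{S_f^G<+\infty\}$. $(X,\mu)$ is totally dissipative if $\mu(\mathcal{C})=0$. A translation $G$-space is a measure preserving $G$-space of the form $(W_o\times G,\nu_o\otimes\lambda)$, for some standard measure space $(W_o,\nu_o)$, with the action $g.(w,h)=(w,gh)$. *)

theory Defs
  imports "HOL-Analysis.Analysis"
begin

(* The group G is a type of class topological_group_add. Addition is not assumed commutative
   in that class, so it covers all topological groups: g + h stands for the product gh and
   0 for the identity e. *)

text \<open>Haar measure. On a second countable locally compact Hausdorff group every Borel measure
  that is finite on compact sets is regular, so regularity is not listed separately.\<close>

definition left_haar_measure :: "'g::topological_group_add measure \<Rightarrow> bool" where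
  "left_haar_measure lam \<longleftrightarrow>
     sets lam = sets borel \<and>
     emeasure lam UNIV \<noteq> 0 \<and>
     (\<forall>K. compact K \<longrightarrow> emeasure lam K < \<infinity>) \<and>
     (\<forall>g. \<forall>A\<in>sets borel. emeasure lam ((\<lambda>h. g + h) ` A) = emeasure lam A)"


text \<open>Being standard Borel is a property of the \<open>\<sigma>\<close>-algebra only; the values of \<open>M\<close> play no role.\<close>

definition standard_borel :: "'a measure \<Rightarrow> bool" where
  "standard_borel M \<longleftrightarrow>
     (\<exists>T. completely_metrizable_space T \<and> second_countable T \<and> topspace T = space M \<and>
          sets M = sigma_sets (space M) {U. openin T U})"

definition standard_measure_space :: "'a measure \<Rightarrow> bool" where
  "standard_measure_space M \<longleftrightarrow> standard_borel M \<and> sigma_finite_measure M"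

definition equivalent_measures :: "'a measure \<Rightarrow> 'a measure \<Rightarrow> bool" where
  "equivalent_measures M N \<longleftrightarrow> absolutely_continuous M N \<and> absolutely_continuous N M"


definition borel_G_space :: "'x measure \<Rightarrow> ('g::topological_group_add \<Rightarrow> 'x \<Rightarrow> 'x) \<Rightarrow> bool" where
  "borel_G_space M a \<longleftrightarrow>
     standard_borel M \<and>
     (\<lambda>(g, x). a g x) \<in> measurable (borel \<Otimes>\<^sub>M M) M \<and>
     (\<forall>x\<in>space M. a 0 x = x) \<and>
     (\<forall>g h. \<forall>x\<in>space M. a (g + h) x = a g (a h x))"

text \<open>The measure \<open>\<mu> \<circ> g\<close>, where \<open>(\<mu> \<circ> g)(A) = \<mu>(g.A)\<close>.\<close>

definition translated_measure :: "'x measure \<Rightarrow> ('g \<Rightarrow> 'x \<Rightarrow> 'x) \<Rightarrow> 'g \<Rightarrow> 'x measure" where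
  "translated_measure M a g = measure_of (space M) (sets M) (\<lambda>A. emeasure M (a g ` A))"

definition nonsingular_G_space :: "'x measure \<Rightarrow> ('g::topological_group_add \<Rightarrow> 'x \<Rightarrow> 'x) \<Rightarrow> bool" where
  "nonsingular_G_space M a \<longleftrightarrow>
     standard_measure_space M \<and> borel_G_space M a \<and>
     (\<forall>g. equivalent_measures (translated_measure M a g) M)"

definition essentially_free :: "'x measure \<Rightarrow> ('g::topological_group_add \<Rightarrow> 'x \<Rightarrow> 'x) \<Rightarrow> bool" where
  "essentially_free M a \<longleftrightarrow> (AE x in M. {g. a g x = x} = {0})"

definition invariant_set :: "('g \<Rightarrow> 'x \<Rightarrow> 'x) \<Rightarrow> 'x set \<Rightarrow> bool" where
  "invariant_set a A \<longleftrightarrow> (\<forall>g. a g ` A = A)"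

definition isomorphic_G_spaces ::
    "'x measure \<Rightarrow> ('g::topological_group_add \<Rightarrow> 'x \<Rightarrow> 'x) \<Rightarrow> 'y measure \<Rightarrow> ('g \<Rightarrow> 'y \<Rightarrow> 'y) \<Rightarrow> bool" where
  "isomorphic_G_spaces M a N b \<longleftrightarrow>
     (\<exists>X0\<in>sets M. \<exists>Y0\<in>sets N. \<exists>\<phi>.
        invariant_set a X0 \<and> space M - X0 \<in> null_sets M \<and>
        invariant_set b Y0 \<and> space N - Y0 \<in> null_sets N \<and>
        bij_betw \<phi> X0 Y0 \<and>
        \<phi> \<in> measurable (restrict_space M X0) (restrict_space N Y0) \<and>
        equivalent_measures (distr (restrict_space M X0) N \<phi>) N \<and>
        (\<forall>g. AE x in restrict_space M X0. \<phi> (a g x) = b g (\<phi> x)))"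


definition radon_nikodym_cocycle ::
    "'x measure \<Rightarrow> ('g::topological_group_add \<Rightarrow> 'x \<Rightarrow> 'x) \<Rightarrow> ('g \<Rightarrow> 'x \<Rightarrow> real) \<Rightarrow> bool" where
  "radon_nikodym_cocycle M a \<Delta> \<longleftrightarrow>
     (\<lambda>(g, x). \<Delta> g x) \<in> borel_measurable (borel \<Otimes>\<^sub>M M) \<and>
     (\<forall>g. \<forall>x\<in>space M. \<Delta> g x > 0) \<and>
     (\<forall>x\<in>space M. \<Delta> 0 x = 1) \<and>
     (\<forall>g h. \<forall>x\<in>space M. \<Delta> (g + h) x = \<Delta> g (a h x) * \<Delta> h x) \<and>
     (\<forall>g. AE x in M. ennreal (\<Delta> g x) = RN_deriv M (translated_measure M a g) x)"

definition L1_plus :: "'x measure \<Rightarrow> ('x \<Rightarrow> real) set" where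
  "L1_plus M = {f. integrable M f \<and> (\<forall>x\<in>space M. f x > 0)}"

definition S_fun ::
    "'g measure \<Rightarrow> ('g \<Rightarrow> 'x \<Rightarrow> 'x) \<Rightarrow> ('g \<Rightarrow> 'x \<Rightarrow> real) \<Rightarrow> ('x \<Rightarrow> real) \<Rightarrow> 'x \<Rightarrow> ennreal" where
  "S_fun lam a \<Delta> f x = (\<integral>\<^sup>+ g. ennreal (\<Delta> g x * f (a g x)) \<partial>lam)"

definition hopf_decomposition ::
    "'g::topological_group_add measure \<Rightarrow> 'x measure \<Rightarrow> ('g \<Rightarrow> 'x \<Rightarrow> 'x) \<Rightarrow> ('g \<Rightarrow> 'x \<Rightarrow> real)
      \<Rightarrow> 'x set \<Rightarrow> 'x set \<Rightarrow> bool" where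
  "hopf_decomposition lam M a \<Delta> C D \<longleftrightarrow>
     C \<in> sets M \<and> D \<in> sets M \<and> C \<union> D = space M \<and> C \<inter> D = {} \<and>
     invariant_set a C \<and> invariant_set a D \<and>
     (\<forall>f\<in>L1_plus M.
        (AE x in M. x \<in> C \<longleftrightarrow> S_fun lam a \<Delta> f x = \<infinity>) \<and>
        (AE x in M. x \<in> D \<longleftrightarrow> S_fun lam a \<Delta> f x < \<infinity>))"

text \<open>The Radon--Nikodym cocycle always exists, and two of them agree almost everywhere for each
  group element; hence, by Fubini, the associated functions \<open>S_fun\<close> agree almost everywhere and
  the decomposition is unique modulo null sets. The property below thus does not depend on the
  choice of \<open>\<Delta>\<close>, \<open>C\<close>, \<open>D\<close>.\<close>

definition totally_dissipative ::
    "'g::topological_group_add measure \<Rightarrow> 'x measure \<Rightarrow> ('g \<Rightarrow> 'x \<Rightarrow> 'x) \<Rightarrow> bool" where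
  "totally_dissipative lam M a \<longleftrightarrow>
     (\<exists>\<Delta> C D. radon_nikodym_cocycle M a \<Delta> \<and> hopf_decomposition lam M a \<Delta> C D \<and> emeasure M C = 0)"


text \<open>The action is measure preserving because \<open>lam\<close> is left invariant.\<close>

definition translation_G_space ::
    "'g::topological_group_add measure \<Rightarrow> ('w \<times> 'g) measure \<Rightarrow> ('g \<Rightarrow> 'w \<times> 'g \<Rightarrow> 'w \<times> 'g) \<Rightarrow> bool" where
  "translation_G_space lam N b \<longleftrightarrow>
     (\<exists>W. standard_measure_space W \<and> N = W \<Otimes>\<^sub>M lam) \<and>
     b = (\<lambda>g (w, h). (w, g + h))"

end

theory Submission
  imports Defs
begin

text \<open>
  A translation space is dissipative by Fubini's theorem, and conversely a dissipative action
  is smooth because each orbit carries a canonical probability measure. Throughout, the theorems on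
  Borel images and Borel sections are replaced by versions modulo null sets, which follow from
  Lusin's theorem: if \<open>f\<close> is a Borel map from a Radon space into a second countable Hausdorff space, then every
  Borel set \<open>A\<close> is, up to a null set, a countable union of sets with compact images under \<open>f\<close>
  (lemma \<open>lusin_compact_images\<close>). For injective \<open>f\<close> this says that \<open>A\<close> agrees almost everywhere with
  the preimage of an \<open>F\<^sub>\<sigma>\<close> set; for general \<open>f\<close> it yields measurable sections
  (lemma \<open>measurable_section\<close>).

  Suppose that \<open>\<phi>\<close> is an isomorphism onto a translation space. Modulo null sets every Borel set of
  \<open>X\<close> is a preimage under \<open>\<phi>\<close>, so the invariant product measure pulls back to an invariant measure
  \<open>r \<mu>\<close> with \<open>r > 0\<close> (lemma \<open>invariant_density\<close>). Hence \<open>r(x) / r(g.x)\<close> is a Radon--Nikodym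
  cocycle, and for it \<open>S\<^sub>f(x)\<close> is \<open>r(x)\<close> times the integral of \<open>(f / r)(g.x)\<close> over \<open>g\<close>. Integrating
  the latter over the set of those \<open>x\<close> whose group coordinate lies in a compact set \<open>K\<close>, and moving
  \<open>g\<close> to the other factor by invariance, gives the Haar measure of the reflection of \<open>K\<close>
  times the integral of \<open>f\<close>, which is finite (lemma \<open>orbit_integral_finite\<close>).

  Suppose now that \<open>S\<^sub>f < \<infinity>\<close> almost everywhere. Pushing the measure with density \<open>\<nabla>\<^sub>g(x) f(g.x)\<close>
  from \<open>G\<close> to the orbit of \<open>x\<close> and normalizing it by \<open>S\<^sub>f(x)\<close> gives a probability measure that depends
  only on the orbit, because right translation multiplies Haar measure by a constant
  (lemmas \<open>right_scaling\<close>, \<open>orbit_weight_shift\<close>). Since it is concentrated on the orbit, it determines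
  the orbit, and a countable family of its values is coded by one real number \<open>q(x)\<close>
  (lemma \<open>orbit_invariant\<close>). A measurable section \<open>s\<close> of \<open>q\<close> selects one point in almost every orbit.
  By freeness every \<open>x\<close> is \<open>h(x).s(q(x))\<close> for a unique \<open>h(x)\<close>, and \<open>x \<mapsto> (q(x), h(x))\<close> is the required
  isomorphism, the base measure being the image under \<open>q\<close> of a finite measure equivalent to \<open>\<mu>\<close>.
  Two points need care: the null sets are compared by Fubini's theorem (lemma \<open>AE_param_iff\<close>),
  and \<open>h\<close> is first shown to be measurable on a conull set and then, by equivariance, on an
  invariant conull set (lemma \<open>coordinate_measurable_invariant\<close>).
\<close>

section \<open>Compact sets with compact images\<close>

text \<open>As \<open>N\<close> ranges over all finite measures on the \<open>\<sigma>\<close>-algebra of \<open>M\<close>, the property passes from a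
  \<open>\<sigma>\<close>-finite measure to an equivalent finite one. Inner regularity is required on open sets alone,
  since it propagates to all Borel sets.\<close>

definition radon_space :: "'a measure \<Rightarrow> bool" where
  "radon_space M \<longleftrightarrow>
     (\<exists>T. Hausdorff_space T \<and> topspace T = space M \<and> sets M = sigma_sets (space M) {U. openin T U} \<and>
        (\<forall>N U e. finite_measure N \<and> sets N = sets M \<and> openin T U \<and> 0 < e \<longrightarrow>
           (\<exists>K. compactin T K \<and> K \<subseteq> U \<and> measure N (U - K) < e)))"

text \<open>The sets that can be approximated from inside by compact sets, together with their complements,
  form a \<open>\<sigma>\<close>-algebra. Stating both approximations at once makes the complement step trivial; the
  complement of an open set \<open>U\<close> is approximated by \<open>C - U\<close> for a large compact set \<open>C\<close>.\<close>

lemma (in finite_measure) compact_pair_approximation: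
  assumes H: "Hausdorff_space T" and sp: "topspace T = space M"
    and gen: "sets M = sigma_sets (space M) {U. openin T U}"
    and reg: "\<And>U e. openin T U \<Longrightarrow> 0 < e \<Longrightarrow> \<exists>K. compactin T K \<and> K \<subseteq> U \<and> measure M (U - K) < e"
    and A: "A \<in> sets M" and e: "0 < e"
  shows "\<exists>K L. compactin T K \<and> compactin T L \<and> K \<subseteq> A \<and> L \<subseteq> space M - A \<and> measure M (space M - (K \<union> L)) < e"
proof -
  have opn: "U \<in> sets M" if "openin T U" for U
    using that gen by auto
  have cpt: "K \<in> sets M" if "compactin T K" for K
  proof -
    have "closedin T K" by (rule compactin_imp_closedin[OF H that])
    then have "openin T (space M - K)" "K \<subseteq> space M" using sp by (auto simp: closedin_def)
    from sets.compl_sets[OF opn[OF this(1)]] this(2) show ?thesis by (simp add: double_diff)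
  qed
  from A have "A \<in> sigma_sets (space M) {U. openin T U}" using gen by simp
  then show ?thesis using e
  proof (induction arbitrary: e rule: sigma_sets.induct)
    case (Basic U)
    then have U: "openin T U" by simp
    obtain K where K: "compactin T K" "K \<subseteq> U" "measure M (U - K) < e/2"
      using reg[OF U, of "e/2"] \<open>0 < e\<close> by auto
    have "openin T (space M)" by (metis openin_topspace sp)
    from reg[OF this, of "e/2"] \<open>0 < e\<close> obtain C where
      C: "compactin T C" "C \<subseteq> space M" "measure M (space M - C) < e/2" by auto
    have L: "compactin T (C - U)"
    proof -
      have "closedin T (space M - U)" using U sp by (metis closedin_topspace closedin_diff)
      moreover have "(space M - U) \<inter> C = C - U" using C(2) by auto
      ultimately show ?thesis using closed_Int_compactin[OF _ C(1)] by metis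
    qed
    have "measure M (space M - (K \<union> (C - U))) \<le> measure M ((U - K) \<union> (space M - C))"
      using opn[OF U] cpt[OF K(1)] cpt[OF C(1)] by (intro finite_measure_mono) auto
    also have "\<dots> \<le> measure M (U - K) + measure M (space M - C)"
      using opn[OF U] cpt[OF K(1)] cpt[OF C(1)] by (intro measure_Un_le) auto
    also have "\<dots> < e" using K(3) C(3) by simp
    finally show ?case using K L C(2) by (intro exI[of _ K] exI[of _ "C - U"]) auto
  next
    case Empty
    have "openin T (space M)" by (metis openin_topspace sp)
    from reg[OF this \<open>0 < e\<close>] obtain L where "compactin T L" "L \<subseteq> space M" "measure M (space M - L) < e"
      by blast
    then show ?case by (intro exI[of _ "{}"] exI[of _ L]) auto
  next
    case (Compl A)
    from Compl.IH[OF Compl.prems] obtain K L where "compactin T K" "compactin T L" "K \<subseteq> A"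
      "L \<subseteq> space M - A" "measure M (space M - (K \<union> L)) < e" by blast
    moreover have "A \<subseteq> space M" using Compl.hyps gen sets.sets_into_space by metis
    ultimately show ?case by (intro exI[of _ L] exI[of _ K]) (auto simp: Un_commute)
  next
    case (Union A)
    have "\<exists>K L. compactin T K \<and> compactin T L \<and> K \<subseteq> A i \<and> L \<subseteq> space M - A i \<and>
        measure M (space M - (K \<union> L)) < e/2 * (1/2)^Suc i" for i
      by (rule Union.IH) (use \<open>0 < e\<close> in simp)
    then obtain K L where KL: "\<And>i. compactin T (K i)" "\<And>i. compactin T (L i)" "\<And>i. K i \<subseteq> A i"
        "\<And>i. L i \<subseteq> space M - A i" "\<And>i. measure M (space M - (K i \<union> L i)) < e/2 * (1/2)^Suc i"
      by metis
    note [measurable] = cpt[OF KL(1)] cpt[OF KL(2)]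
    (* Only the union of the compact sets \<open>K i\<close> fails to be compact; a finite part of it suffices
       up to \<open>D n\<close>, whereas the intersection of the \<open>L i\<close> is compact as it stands. *)
    define D where "D n = (\<Union>i. K i) - (\<Union>i\<le>n. K i)" for n :: nat
    have D: "range D \<subseteq> sets M" unfolding D_def by auto
    have "(\<lambda>n. measure M (D n)) \<longlonglongrightarrow> measure M (\<Inter>n. D n)"
      by (intro finite_Lim_measure_decseq[OF D]) (force simp: D_def decseq_def)
    moreover have "(\<Inter>n. D n) = {}" unfolding D_def by auto
    ultimately have "(\<lambda>n. measure M (D n)) \<longlonglongrightarrow> 0" by simp
    then obtain n where n: "measure M (D n) < e/2"
      using \<open>0 < e\<close> by (metis LIMSEQ_D half_gt_zero diff_zero real_norm_def abs_of_nonneg measure_nonneg le_refl)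
    let ?K = "\<Union>i\<le>n. K i" and ?L = "\<Inter>i. L i" and ?E = "\<lambda>i. space M - (K i \<union> L i)"
    have K: "compactin T ?K" by (intro compactin_Union) (auto intro: KL(1))
    have L: "compactin T ?L"
    proof -
      have "closedin T (\<Inter>i. L i)"
        by (intro closedin_Inter) (auto intro: compactin_imp_closedin[OF H] KL(2))
      from closed_Int_compactin[OF this KL(2)[of 0]] show ?thesis
        by (simp add: inf.absorb1 INF_lower)
    qed
    have sm: "(\<lambda>i. e/2 * (1/2)^Suc i) sums (e/2 * 1)"
      by (intro sums_mult power_half_series)
    have sm': "summable (\<lambda>i. measure M (?E i))"
      by (rule summable_comparison_test'[OF sums_summable[OF sm], of 0]) (use KL(5) less_imp_le in auto)
    have "measure M (\<Union>i. ?E i) \<le> (\<Sum>i. measure M (?E i))"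
      by (rule finite_measure_subadditive_countably[OF _ sm']) auto
    also have "\<dots> \<le> (\<Sum>i. e/2 * (1/2)^Suc i)"
      by (rule suminf_le[OF _ sm' sums_summable[OF sm]]) (use KL(5) less_imp_le in auto)
    also have "\<dots> = e/2" using sums_unique[OF sm] by simp
    finally have E: "measure M (\<Union>i. ?E i) \<le> e/2" .
    have "measure M (space M - (?K \<union> ?L)) \<le> measure M ((\<Union>i. ?E i) \<union> D n)"
      by (intro finite_measure_mono) (auto simp: D_def)
    also have "\<dots> \<le> measure M (\<Union>i. ?E i) + measure M (D n)"
      by (intro measure_Un_le) (use D in auto)
    also have "\<dots> < e" using E n by simp
    finally show ?case
      using K L KL(3,4) by (intro exI[of _ ?K] exI[of _ ?L]) blast
  qed
qed

lemma (in finite_measure) incseq_inner_approximation: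
  assumes "range C \<subseteq> sets M" "incseq C" "(\<Union>n. C n) = U" "0 < e"
  shows "\<exists>n. measure M (U - C n) < e"
proof -
  have "(\<lambda>n. measure M (U - C n)) \<longlonglongrightarrow> measure M (\<Inter>n. U - C n)"
    using assms by (intro finite_Lim_measure_decseq) (force simp: incseq_def decseq_def)+
  moreover have "(\<Inter>n. U - C n) = {}" using assms(3) by auto
  ultimately have "(\<lambda>n. measure M (U - C n)) \<longlonglongrightarrow> 0" by (simp only: measure_empty)
  then show ?thesis
    using \<open>0 < e\<close> by (metis LIMSEQ_D diff_zero real_norm_def abs_of_nonneg measure_nonneg le_refl)
qed

text \<open>Ulam's theorem. For every \<open>k\<close>, finitely many closed balls of radius \<open>1 / (k + 1)\<close> cover the space
  up to a set of small measure; the intersection over \<open>k\<close> of these finite unions is closed and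
  totally bounded, hence compact by completeness.\<close>

lemma polish_tight:
  assumes "finite_measure M" and "completely_metrizable_space T" and "second_countable T"
    and sp: "topspace T = space M" and gen: "sets M = sigma_sets (space M) {U. openin T U}"
    and e: "0 < e"
  shows "\<exists>K. compactin T K \<and> measure M (space M - K) < e"
proof -
  interpret finite_measure M by fact
  obtain X d where X: "Metric_space X d" and mc: "Metric_space.mcomplete X d"
    and T: "T = Metric_space.mtopology X d"
    using assms(2) unfolding completely_metrizable_space_def by auto
  interpret X: Metric_space X d by fact
  have XM: "X = space M" using sp T by simp
  have opn: "U \<in> sets M" if "openin T U" for U using that gen by auto
  have cls: "C \<in> sets M" if "closedin T C" for C
  proof -
    have "openin T (space M - C)" "C \<subseteq> space M" using that sp by (auto simp: closedin_def)
    from sets.compl_sets[OF opn[OF this(1)]] this(2) show ?thesis by (simp add: double_diff)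
  qed
  have "Lindelof_space T" using assms(3) by (rule second_countable_imp_Lindelof_space)
  have step: "\<exists>F. finite F \<and> F \<subseteq> X \<and>
      measure M (space M - (\<Union>x\<in>F. X.mcball x (1 / real (Suc k)))) < e/2 * (1/2)^Suc k" for k
  proof -
    let ?r = "1 / real (Suc k)"
    have "\<exists>V. countable V \<and> V \<subseteq> (\<lambda>x. X.mball x ?r) ` X \<and> \<Union>V = topspace T"
    proof -
      have "\<forall>U\<in>(\<lambda>x. X.mball x ?r) ` X. openin T U" using T by auto
      moreover have "\<Union>((\<lambda>x. X.mball x ?r) ` X) = topspace T"
        using T by (auto simp: X.mspace_metric intro: X.centre_in_mball_iff[THEN iffD2] X.mball_subset_mspace[THEN subsetD])
      ultimately show ?thesis
        using \<open>Lindelof_space T\<close> unfolding Lindelof_space_def by (metis (no_types, lifting))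
    qed
    then obtain C where C: "countable C" "C \<subseteq> X" "(\<Union>x\<in>C. X.mball x ?r) = X"
      by (metis (no_types, lifting) T X.topspace_mtopology countable_subset_image)
    show ?thesis
    proof (cases "C = {}")
      case True
      then show ?thesis using C XM e by (intro exI[of _ "{}"]) auto
    next
      case False
      define c where "c = from_nat_into C"
      have c: "range c = C" unfolding c_def using False C(1) by (rule range_from_nat_into)
      let ?B = "\<lambda>n::nat. \<Union>i\<le>n. X.mcball (c i) ?r"
      have "\<exists>n. measure M (space M - ?B n) < e/2 * (1/2)^Suc k"
      proof (rule incseq_inner_approximation)
        have "X.mcball (c i) ?r \<in> sets M" for i using T by (intro cls) simp
        then show "range ?B \<subseteq> sets M" by (auto intro!: sets.finite_UN)
        show "incseq ?B" by (force simp: incseq_def)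
        show "(\<Union>n. ?B n) = space M"
        proof
          show "space M \<subseteq> (\<Union>n. ?B n)"
          proof
            fix x assume "x \<in> space M"
            then obtain y where "y \<in> C" "x \<in> X.mball y ?r" using C(3) XM by auto
            then obtain i where "x \<in> X.mball (c i) ?r" using c by (metis rangeE)
            then have "x \<in> ?B i" using X.mball_subset_mcball by blast
            then show "x \<in> (\<Union>n. ?B n)" by blast
          qed
          show "(\<Union>n. ?B n) \<subseteq> space M"
            using X.mcball_subset_mspace XM by blast
        qed
      qed (use e in simp)
      then obtain n where n: "measure M (space M - ?B n) < e/2 * (1/2)^Suc k" by blast
      have "(\<Union>x\<in>c ` {..n}. X.mcball x ?r) = ?B n" by blast
      then show ?thesis
        using n c C(2) by (intro exI[of _ "c ` {..n}"]) auto
    qed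
  qed
  then obtain F where F: "\<And>k. finite (F k)" "\<And>k. F k \<subseteq> X"
    "\<And>k. measure M (space M - (\<Union>x\<in>F k. X.mcball x (1 / real (Suc k)))) < e/2 * (1/2)^Suc k"
    by metis
  let ?B = "\<lambda>k. \<Union>x\<in>F k. X.mcball x (1 / real (Suc k))"
  let ?K = "\<Inter>k. ?B k"
  have B: "closedin T (?B k)" for k
    using F(1) T by (auto intro!: closedin_Union)
  have K: "closedin T ?K" using B by (intro closedin_Inter) auto
  have "X.mtotally_bounded ?K"
    unfolding X.mtotally_bounded_def
  proof (intro strip)
    fix \<epsilon> :: real assume "0 < \<epsilon>"
    obtain k where k: "1 / real (Suc k) < \<epsilon> / 2"
      using \<open>0 < \<epsilon>\<close> by (metis half_gt_zero nat_approx_posE)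
    (* Total boundedness asks for centres inside the set: each ball that meets it is replaced by
       a ball of twice the radius around a point of the intersection. *)
    define G where "G = {x \<in> F k. X.mcball x (1 / real (Suc k)) \<inter> ?K \<noteq> {}}"
    define y where "y x = (SOME z. z \<in> X.mcball x (1 / real (Suc k)) \<inter> ?K)" for x
    have y: "y x \<in> X.mcball x (1 / real (Suc k)) \<inter> ?K" if "x \<in> G" for x
    proof -
      have "\<exists>z. z \<in> X.mcball x (1 / real (Suc k)) \<inter> ?K" using that unfolding G_def by blast
      from someI_ex[OF this] show ?thesis unfolding y_def .
    qed
    have "?K \<subseteq> (\<Union>z\<in>y ` G. X.mball z \<epsilon>)"
    proof
      fix z assume z: "z \<in> ?K"
      then obtain x where x: "x \<in> F k" "z \<in> X.mcball x (1 / real (Suc k))" by blast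
      then have G: "x \<in> G" using z unfolding G_def by blast
      have yx: "y x \<in> X" "d x (y x) \<le> 1 / real (Suc k)" "z \<in> X" "x \<in> X" "d x z \<le> 1 / real (Suc k)"
        using y[OF G] x(2) by (auto simp: X.in_mcball)
      have "d (y x) z \<le> d (y x) x + d x z" using yx by (intro X.triangle) auto
      also have "\<dots> < \<epsilon>" using yx k by (simp add: X.commute)
      finally show "z \<in> (\<Union>z\<in>y ` G. X.mball z \<epsilon>)" using yx G by (auto simp: X.in_mball)
    qed
    moreover have "finite (y ` G)" using F(1)[of k] unfolding G_def by auto
    moreover have "y ` G \<subseteq> ?K" using y by blast
    ultimately show "\<exists>K. finite K \<and> K \<subseteq> ?K \<and> ?K \<subseteq> (\<Union>x\<in>K. X.mball x \<epsilon>)" by blast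
  qed
  then have "compactin T ?K"
    using X.mtotally_bounded_eq_compact_closure_of[OF mc, of ?K] K T by (simp add: closure_of_closedin)
  have sm: "(\<lambda>i. e/2 * (1/2)^Suc i) sums (e/2 * 1)"
    by (intro sums_mult power_half_series)
  have sm': "summable (\<lambda>i. measure M (space M - ?B i))"
    by (rule summable_comparison_test'[OF sums_summable[OF sm], of 0]) (use F(3) less_imp_le in auto)
  have "space M - ?K = (\<Union>i. space M - ?B i)" by auto
  then have "measure M (space M - ?K) \<le> (\<Sum>i. measure M (space M - ?B i))"
    using finite_measure_subadditive_countably[OF _ sm'] sets.compl_sets[OF cls[OF B]] by (simp only: image_subsetI)
  also have "\<dots> \<le> (\<Sum>i. e/2 * (1/2)^Suc i)"
    by (rule suminf_le[OF _ sm' sums_summable[OF sm]]) (use F(3) less_imp_le in auto)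
  also have "\<dots> = e/2" using sums_unique[OF sm] by simp
  finally show ?thesis using \<open>compactin T ?K\<close> e by (intro exI[of _ ?K]) auto
qed

lemma standard_borel_imp_radon_space:
  assumes "standard_borel M"
  shows "radon_space M"
proof -
  obtain T where T: "completely_metrizable_space T" "second_countable T" "topspace T = space M"
    "sets M = sigma_sets (space M) {U. openin T U}"
    using assms unfolding standard_borel_def by blast
  have mT: "metrizable_space T" using T(1) by (rule completely_metrizable_imp_metrizable_space)
  then have H: "Hausdorff_space T" by (rule metrizable_imp_Hausdorff_space)
  have "\<exists>K. compactin T K \<and> K \<subseteq> U \<and> measure N (U - K) < e"
    if N: "finite_measure N" "sets N = sets M" "openin T U" "0 < e" for N :: "'a measure" and U e
  proof -
    interpret finite_measure N by fact
    have sp: "space N = space M" using N(2) by (rule sets_eq_imp_space_eq)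
    have opn: "U \<in> sets N" if "openin T U" for U using that T(4) N(2) by auto
    have cls: "C \<in> sets N" if "closedin T C" for C
    proof -
      have "openin T (space N - C)" "C \<subseteq> space N" using that T(3) sp by (auto simp: closedin_def)
      from sets.compl_sets[OF opn[OF this(1)]] this(2) show ?thesis by (simp add: double_diff)
    qed
    obtain K where K: "compactin T K" "measure N (space N - K) < e/2"
      using polish_tight[OF N(1) T(1,2), of "e/2"] T(3,4) sp N(2,4) by auto
    obtain C where C: "\<And>n. closedin T (C n)" "\<And>n. C n \<subseteq> C (Suc n)" "(\<Union>n. C n) = U"
      using open_imp_fsigma_in[OF mT N(3)] unfolding fsigma_in_ascending by auto
    have "\<exists>n. measure N (U - C n) < e/2"
      by (rule incseq_inner_approximation) (use C cls N(4) in \<open>auto intro!: incseq_SucI\<close>)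
    then obtain n where n: "measure N (U - C n) < e/2" by blast
    have cK: "compactin T (C n \<inter> K)" by (rule closed_Int_compactin[OF C(1) K(1)])
    have [measurable]: "U \<in> sets N" "C n \<in> sets N" "K \<in> sets N"
      using opn[OF N(3)] cls[OF C(1)] cls[OF compactin_imp_closedin[OF H K(1)]] by auto
    have US: "U \<subseteq> space N" using openin_subset[OF N(3)] T(3) sp by simp
    have "measure N (U - C n \<inter> K) \<le> measure N ((U - C n) \<union> (space N - K))"
      by (intro finite_measure_mono) (use US in auto)
    also have "\<dots> \<le> measure N (U - C n) + measure N (space N - K)"
      by (intro measure_Un_le) auto
    also have "\<dots> < e" using n K(2) by simp
    finally show ?thesis using cK C(3) by (intro exI[of _ "C n \<inter> K"]) auto
  qed
  then show ?thesis unfolding radon_space_def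
    by (intro exI[of _ T] conjI allI impI H T(3,4)) auto
qed

text \<open>The members of a countable base that have a compact neighbourhood inside \<open>U\<close> already cover \<open>U\<close>.\<close>

lemma locally_compact_open_sigma_compact:
  fixes U :: "'a::second_countable_topology set"
  assumes "locally compact (UNIV :: 'a set)" and "open U"
  obtains K :: "nat \<Rightarrow> 'a set" where "\<And>n. compact (K n)" "incseq K" "(\<Union>n. K n) = U"
proof -
  obtain B :: "'a set set" where B: "countable B" "\<And>X. X \<in> B \<Longrightarrow> open X"
    "\<And>X x. open X \<Longrightarrow> x \<in> X \<Longrightarrow> \<exists>b\<in>B. x \<in> b \<and> b \<subseteq> X"
  proof -
    obtain B :: "'a set set" where "countable B" "topological_basis B" using ex_countable_basis by blast
    then show ?thesis using that topological_basis_open topological_basisE by meson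
  qed
  define B' where "B' = {b \<in> B. \<exists>v. compact v \<and> b \<subseteq> v \<and> v \<subseteq> U}"
  obtain v where v: "\<And>b. b \<in> B' \<Longrightarrow> compact (v b)" "\<And>b. b \<in> B' \<Longrightarrow> b \<subseteq> v b" "\<And>b. b \<in> B' \<Longrightarrow> v b \<subseteq> U"
  proof -
    have "\<forall>b\<in>B'. \<exists>v. compact v \<and> b \<subseteq> v \<and> v \<subseteq> U" unfolding B'_def by blast
    from bchoice[OF this] show ?thesis using that by blast
  qed
  have cov: "(\<Union>b\<in>B'. v b) = U"
  proof
    show "(\<Union>b\<in>B'. v b) \<subseteq> U" using v(3) by blast
    show "U \<subseteq> (\<Union>b\<in>B'. v b)"
    proof
      fix x assume "x \<in> U"
      then obtain u k where uk: "open u" "compact k" "x \<in> u" "u \<subseteq> k" "k \<subseteq> U"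
        using assms unfolding locally_def by simp metis
      then obtain b where "b \<in> B" "x \<in> b" "b \<subseteq> u" using B(3) by blast
      then have "b \<in> B'" unfolding B'_def using uk by blast
      with v(2) \<open>x \<in> b\<close> show "x \<in> (\<Union>b\<in>B'. v b)" by blast
    qed
  qed
  have cB': "countable B'" using B(1) unfolding B'_def by simp
  show ?thesis
  proof (cases "B' = {}")
    case True
    then show ?thesis using cov by (intro that[of "\<lambda>_. {}"]) auto
  next
    case False
    define f where "f = from_nat_into B'"
    have f: "range f = B'" unfolding f_def using False cB' by (rule range_from_nat_into)
    show ?thesis
    proof (rule that[of "\<lambda>n. \<Union>i\<le>n. v (f i)"])
      show "compact (\<Union>i\<le>n. v (f i))" for n using f v(1) by (intro compact_UN) auto
      show "incseq (\<lambda>n. \<Union>i\<le>n. v (f i))" by (force simp: incseq_def)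
      have "(\<Union>n. \<Union>i\<le>n. v (f i)) = (\<Union>i. v (f i))" by blast
      also have "\<dots> = (\<Union>b\<in>range f. v b)" by blast
      finally show "(\<Union>n. \<Union>i\<le>n. v (f i)) = U" using cov f by simp
    qed
  qed
qed

lemma locally_compact_imp_radon_space:
  fixes M :: "'a::{second_countable_topology,t2_space} measure"
  assumes "locally compact (UNIV :: 'a set)" and "sets M = sets borel"
  shows "radon_space M"
proof -
  have sp: "space M = UNIV" using sets_eq_imp_space_eq[OF assms(2)] by simp
  have "\<exists>K. compact K \<and> K \<subseteq> U \<and> measure N (U - K) < e"
    if N: "finite_measure N" "sets N = sets M" "open U" "0 < e" for N :: "'a measure" and U e
  proof -
    interpret finite_measure N by fact
    obtain K where K: "\<And>n. compact (K n)" "incseq K" "(\<Union>n. K n) = U"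
      using locally_compact_open_sigma_compact[OF assms(1) N(3)] by blast
    have "\<exists>n. measure N (U - K n) < e"
      by (rule incseq_inner_approximation)
         (use K N assms(2) in \<open>auto intro!: borel_closed compact_imp_closed\<close>)
    then show ?thesis using K by blast
  qed
  moreover have "sets M = sigma_sets (space M) {U. openin euclidean U}"
    using assms(2) sp by (simp add: sets_borel)
  moreover have "Hausdorff_space (euclidean :: 'a topology)"
    unfolding Hausdorff_space_def disjnt_def open_openin[symmetric] using hausdorff by blast
  ultimately show ?thesis unfolding radon_space_def
    by (intro exI[of _ euclidean]) (simp add: sp)
qed

lemma locally_compact_Times_UNIV:
  assumes "locally compact (UNIV :: 'a::topological_space set)" "locally compact (UNIV :: 'b::topological_space set)"
  shows "locally compact (UNIV :: ('a \<times> 'b) set)"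
  unfolding locally_def
proof (intro allI impI, elim conjE)
  fix w :: "('a \<times> 'b) set" and z
  assume w: "openin (top_of_set UNIV) w" and z: "z \<in> w"
  obtain A B where AB: "open A" "open B" "z \<in> A \<times> B" "A \<times> B \<subseteq> w"
    using w z by (auto elim: open_prod_elim)
  obtain U K where U: "open U" "compact K" "fst z \<in> U" "U \<subseteq> K" "K \<subseteq> A"
    using assms(1) AB unfolding locally_def by (auto simp: mem_Times_iff) metis
  obtain V L where V: "open V" "compact L" "snd z \<in> V" "V \<subseteq> L" "L \<subseteq> B"
    using assms(2) AB unfolding locally_def by (auto simp: mem_Times_iff) metis
  have "open (U \<times> V)" "compact (K \<times> L)" using U V by (auto intro: open_Times compact_Times)
  moreover have "z \<in> U \<times> V" "U \<times> V \<subseteq> K \<times> L" "K \<times> L \<subseteq> w"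
    using U V AB(4) by (auto simp: mem_Times_iff)
  ultimately show "\<exists>u v. openin (top_of_set UNIV) u \<and> compact v \<and> z \<in> u \<and> u \<subseteq> v \<and> v \<subseteq> w"
    by (intro exI[of _ "U \<times> V"] exI[of _ "K \<times> L"]) simp
qed

lemma sigma_finite_equivalent_finite_density:
  assumes "sigma_finite_measure M"
  obtains p :: "'a \<Rightarrow> real" where "p \<in> borel_measurable M" "\<And>x. 0 < p x"
    "integrable M p" "finite_measure (density M p)" "null_sets (density M p) = null_sets M"
proof -
  interpret sigma_finite_measure M by fact
  obtain p :: "'a \<Rightarrow> real" where p: "p \<in> borel_measurable M" "\<And>x. 0 < p x" "\<And>x. p x \<le> 1" "integrable M p"
    using obtain_positive_integrable_function by blast
  have "emeasure (density M p) (space (density M p)) = (\<integral>\<^sup>+x. p x \<partial>M)"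
    using p by (simp add: emeasure_density)
  moreover have "(\<integral>\<^sup>+x. p x \<partial>M) \<noteq> \<infinity>" using p integrableD(2)[OF p(4)] by (simp add: less_imp_le abs_of_pos)
  ultimately have "finite_measure (density M p)" by (intro finite_measureI) auto
  moreover have "A \<in> null_sets (density M p) \<longleftrightarrow> A \<in> null_sets M" for A
  proof -
    have "ennreal (p x) \<noteq> 0" for x using p(2)[of x] by simp
    then have "A \<in> null_sets (density M p) \<longleftrightarrow> A \<in> sets M \<and> (AE x in M. x \<notin> A)"
      using p(1) by (subst null_sets_density_iff) auto
    then show ?thesis using AE_iff_null_sets[of A M] by auto
  qed
  ultimately show ?thesis using that p by blast
qed

text \<open>Lusin's theorem in the form in which it is used below. It replaces the theorem that injective
  Borel images of Borel sets are Borel: compact sets are Borel in every Hausdorff space, so the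
  image of \<open>A\<close> contains the Borel set \<open>\<Union>n. f ` K n\<close>, and for injective \<open>f\<close> the preimage of the latter
  is \<open>\<Union>n. K n\<close>, which exhausts \<open>A\<close>.\<close>

lemma lusin_compact_images:
  fixes f :: "'a \<Rightarrow> 'b::{second_countable_topology,t2_space}"
  assumes "radon_space M" "sigma_finite_measure M" and f: "f \<in> borel_measurable M" and A: "A \<in> sets M"
  shows "\<exists>K :: nat \<Rightarrow> 'a set. (\<forall>n. K n \<in> sets M \<and> K n \<subseteq> A \<and> compact (f ` K n)) \<and>
    A - (\<Union>n. K n) \<in> null_sets M"
proof -
  obtain p :: "'a \<Rightarrow> real" where "finite_measure (density M p)" and N0: "null_sets (density M p) = null_sets M"
    by (rule sigma_finite_equivalent_finite_density[OF assms(2)])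
  define N where "N = density M p"
  have sN[simp]: "sets N = sets M" "space N = space M" unfolding N_def by auto
  interpret finite_measure N unfolding N_def by fact
  obtain T where H: "Hausdorff_space T" and sp: "topspace T = space N" and gen: "sets N = sigma_sets (space N) {U. openin T U}"
    and "\<And>N U e. finite_measure N \<Longrightarrow> sets N = sets M \<Longrightarrow> openin T U \<Longrightarrow> 0 < e \<Longrightarrow>
           \<exists>K. compactin T K \<and> K \<subseteq> U \<and> measure N (U - K) < e"
    using assms(1) unfolding radon_space_def by auto
  from this(4)[OF finite_measure_axioms sN(1)]
  have reg: "\<exists>K. compactin T K \<and> K \<subseteq> U \<and> measure N (U - K) < e" if "openin T U" "0 < e" for U e
    using that by blast
  note approx = compact_pair_approximation[OF H sp gen reg]
  have cpt: "K \<in> sets N" if "compactin T K" for K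
  proof -
    have "closedin T K" by (rule compactin_imp_closedin[OF H that])
    then have "openin T (space N - K)" "K \<subseteq> space N" using sp by (auto simp: closedin_def)
    then have "space N - K \<in> sets N" using gen by auto
    from sets.compl_sets[OF this] \<open>K \<subseteq> space N\<close> show ?thesis by (simp add: double_diff)
  qed
  obtain B :: "'b set set" where B: "countable B" "topological_basis B"
    using ex_countable_basis by blast
  have "\<exists>K. compactin T K \<and> K \<subseteq> A \<and> compact (f ` K) \<and> measure N (A - K) < e" if e: "0 < e" for e
  proof -
    have "B \<noteq> {}" using topological_basisE[OF B(2) open_UNIV UNIV_I] by blast
    define b where "b = from_nat_into B"
    have b: "range b = B" unfolding b_def using \<open>B \<noteq> {}\<close> B(1) by (rule range_from_nat_into)
    have bo: "open (b i)" for i using b B(2) by (metis rangeI topological_basis_open)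
    have fb: "f -` b i \<inter> space M \<in> sets N" for i 
      unfolding sN by (rule measurable_sets[OF f borel_open[OF bo]])
    have "\<exists>K L. compactin T K \<and> compactin T L \<and> K \<subseteq> f -` b i \<inter> space M \<and> L \<subseteq> space N - (f -` b i \<inter> space M) \<and>
        measure N (space N - (K \<union> L)) < e/2 * (1/2)^Suc i" for i
      by (rule approx[OF _ _ fb]) (use e in auto)
    then obtain K L where KL: "\<And>i. compactin T (K i)" "\<And>i. compactin T (L i)" "\<And>i. K i \<subseteq> f -` b i \<inter> space M"
        "\<And>i. L i \<subseteq> space N - (f -` b i \<inter> space M)" "\<And>i. measure N (space N - (K i \<union> L i)) < e/2 * (1/2)^Suc i"
      by metis
    have AN: "A \<in> sets N" using A by simp
    from approx[OF _ _ AN, of "e/2"] e obtain K0 L0 where K0: "compactin T K0" "compactin T L0" "K0 \<subseteq> A" "L0 \<subseteq> space N - A"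
        "measure N (space N - (K0 \<union> L0)) < e/2" by auto
    let ?E = "\<lambda>i. space N - (K i \<union> L i)"
    let ?K = "K0 \<inter> (\<Inter>i. K i \<union> L i)"
    have "closedin T (\<Inter>i. K i \<union> L i)"
      by (intro closedin_Inter) (auto intro!: compactin_imp_closedin[OF H] compactin_Un KL)
    from closed_Int_compactin[OF this K0(1)] have K: "compactin T ?K" by (simp add: Int_commute)
    note [measurable] = cpt[OF KL(1), simplified sN] cpt[OF KL(2), simplified sN] cpt[OF K0(1), simplified sN]
      cpt[OF K0(2), simplified sN] A
    have sm: "(\<lambda>i. e/2 * (1/2)^Suc i) sums (e/2 * 1)"
      by (intro sums_mult power_half_series)
    have sm': "summable (\<lambda>i. measure N (?E i))"
      by (rule summable_comparison_test'[OF sums_summable[OF sm], of 0]) (use KL(5) less_imp_le in auto)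
    have "measure N (\<Union>i. ?E i) \<le> (\<Sum>i. measure N (?E i))"
      by (rule finite_measure_subadditive_countably[OF _ sm']) auto
    also have "\<dots> \<le> (\<Sum>i. e/2 * (1/2)^Suc i)"
      by (rule suminf_le[OF _ sm' sums_summable[OF sm]]) (use KL(5) less_imp_le in auto)
    also have "\<dots> = e/2" using sums_unique[OF sm] by simp
    finally have E: "measure N (\<Union>i. ?E i) \<le> e/2" .
    have "measure N (A - ?K) \<le> measure N ((\<Union>i. ?E i) \<union> (space N - (K0 \<union> L0)))"
      by (intro finite_measure_mono) (use K0(4) sets.sets_into_space[OF A] in auto)
    also have "\<dots> \<le> measure N (\<Union>i. ?E i) + measure N (space N - (K0 \<union> L0))"
      by (intro measure_Un_le) auto
    also have "\<dots> < e" using E K0(5) by simp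
    finally have small: "measure N (A - ?K) < e" .
    have KS: "?K \<subseteq> space N" using cpt[OF K] sets.sets_into_space by blast
    (* On \<open>?K\<close> the preimage of \<open>b i\<close> is the complement of the compact set \<open>L i\<close>, hence relatively open. *)
    have "continuous_map (subtopology T ?K) euclidean f"
      unfolding continuous_map_def
    proof (intro conjI allI impI)
      fix U :: "'b set" assume "openin euclidean U"
      then have "open U" by simp
      then obtain B' where "B' \<subseteq> range b" "\<Union>B' = U"
        using B(2) b unfolding topological_basis_def by blast
      then obtain J where J: "U = (\<Union>i\<in>J. b i)"
        by (metis subset_imageE)
      have "{x \<in> topspace (subtopology T ?K). f x \<in> U} = (\<Union>i\<in>J. (topspace T - L i) \<inter> ?K)"
      proof -
        have "f x \<in> b i \<longleftrightarrow> x \<in> topspace T - L i" if "x \<in> ?K" for x i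
        proof -
          have "x \<in> K i \<union> L i" "x \<in> space M" using that KS by auto
          then show ?thesis using KL(3)[of i] KL(4)[of i] sp by auto
        qed
        moreover have "topspace (subtopology T ?K) = ?K" using KS sp by auto
        ultimately show ?thesis unfolding J by blast
      qed
      also have "openin (subtopology T ?K) \<dots>"
      proof (intro openin_Union, elim imageE, simp only:)
        fix i
        have "openin T (topspace T - L i)"
          by (rule openin_diff[OF openin_topspace compactin_imp_closedin[OF H KL(2)]])
        then show "openin (subtopology T ?K) ((topspace T - L i) \<inter> ?K)"
          by (rule openin_subtopology_Int)
      qed
      finally show "openin (subtopology T ?K) {x \<in> topspace (subtopology T ?K). f x \<in> U}" .
    qed simp
    moreover have "compactin (subtopology T ?K) ?K" using K by (simp add: compactin_subtopology)
    ultimately have "compactin euclidean (f ` ?K)" by (rule image_compactin[rotated])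
    then show ?thesis using K K0(3) small by (intro exI[of _ ?K]) auto
  qed
  then have "\<forall>n. \<exists>K. compactin T K \<and> K \<subseteq> A \<and> compact (f ` K) \<and> measure N (A - K) < 1 / real (Suc n)"
    by simp
  then obtain K where K: "\<And>n. compactin T (K n)" "\<And>n. K n \<subseteq> A" "\<And>n. compact (f ` K n)"
      "\<And>n. measure N (A - K n) < 1 / real (Suc n)" by metis
  have Km: "K n \<in> sets M" for n using cpt[OF K(1)] by simp
  have "measure N (A - (\<Union>n. K n)) = 0"
  proof (rule ccontr)
    assume "measure N (A - (\<Union>n. K n)) \<noteq> 0"
    then have "0 < measure N (A - (\<Union>n. K n))" by (simp add: zero_less_measure_iff)
    then obtain n where "1 / real (Suc n) < measure N (A - (\<Union>n. K n))"
      using nat_approx_posE by blast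
    also have "\<dots> \<le> measure N (A - K n)"
      using A Km by (intro finite_measure_mono) auto
    finally show False using K(4)[of n] by simp
  qed
  then have "A - (\<Union>n. K n) \<in> null_sets N"
    using A Km by (intro null_setsI) (auto simp: emeasure_eq_measure)
  then have "A - (\<Union>n. K n) \<in> null_sets M" using N0 by (simp add: N_def)
  then show ?thesis using Km K(2,3) by (intro exI[of _ K]) simp
qed

section \<open>Coding standard Borel spaces by real numbers\<close>

text \<open>Base \<open>3\<close> with digits \<open>0\<close> and \<open>1\<close>: the tail after position \<open>n\<close> is at most half of \<open>(1/3)^n\<close>, so the
  digits can be recovered by comparisons.\<close>

definition set_code :: "(nat \<Rightarrow> 'a set) \<Rightarrow> 'a \<Rightarrow> real" where
  "set_code B x = (\<Sum>n. indicator (B n) x * (1/3)^n)"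

lemma summable_set_code: "summable (\<lambda>n. indicator (B n) x * (1/3)^n :: real)"
  by (rule summable_comparison_test'[OF summable_geometric[of "1/3"], of 0]) (auto simp: indicator_def)

lemma measurable_set_code[measurable (raw)]:
  assumes "\<And>n. B n \<in> sets M"
  shows "set_code B \<in> borel_measurable M"
proof -
  have "set_code B = (\<lambda>x. suminf (\<lambda>n. indicator (B n) x * (1/3)^n :: real))"
    by (rule ext) (simp add: set_code_def)
  then show ?thesis using assms
    by (simp only:) (intro borel_measurable_suminf borel_measurable_times borel_measurable_indicator borel_measurable_const)
qed

lemma set_code_digit:
  "x \<in> B n \<longleftrightarrow> (1/3)^n \<le> set_code B x - (\<Sum>k<n. indicator (B k) x * (1/3)^k)"
proof -
  define c where "c k = (indicator (B k) x :: real)" for k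
  have c: "0 \<le> c k" "c k \<le> 1" for k unfolding c_def by (auto simp: indicator_def)
  have sm: "summable (\<lambda>k. c k * (1/3)^k)" unfolding c_def by (rule summable_set_code)
  have g: "(\<lambda>k. (1/3)^k * (1/3)^Suc n) sums (1 / (1 - 1/3) * (1/3)^Suc n :: real)"
    by (intro sums_mult2 geometric_sums) simp
  have sm': "summable (\<lambda>k. c (k + Suc n) * (1/3)^(k + Suc n))"
    using sm by (rule summable_ignore_initial_segment)
  define R where "R = (\<Sum>k. c (k + Suc n) * (1/3)^(k + Suc n))"
  define t :: real where "t = (1/3)^n"
  have "set_code B x = R + (\<Sum>k<Suc n. c k * (1/3)^k)"
    unfolding set_code_def c_def[symmetric] R_def by (rule suminf_split_initial_segment[OF sm])
  then have "set_code B x = R + (\<Sum>k<n. c k * (1/3)^k) + c n * t"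
    by (simp add: t_def)
  moreover have "R \<le> t * (1/2)"
  proof -
    have "R \<le> (\<Sum>k. (1/3)^k * (1/3)^Suc n)"
      unfolding R_def
    proof (rule suminf_le[OF _ sm' sums_summable[OF g]])
    show "c (k + Suc n) * (1/3)^(k + Suc n) \<le> (1/3)^k * (1/3)^Suc n" for k
      using mult_right_mono[OF c(2)[of "k + Suc n"], of "(1/3)^(k + Suc n)"] by (simp add: power_add)
    qed
    also have "(\<Sum>k. (1/3)^k * (1/3)^Suc n) = (1/3)^n * (1/2 :: real)"
      using sums_unique[OF g, symmetric] by simp
    finally show ?thesis unfolding t_def .
  qed
  moreover have "0 \<le> R" unfolding R_def by (rule suminf_nonneg[OF sm']) (use c in auto)
  moreover have "0 < t" by (simp add: t_def)
  moreover have "c n = (if x \<in> B n then 1 else 0)" unfolding c_def by (simp add: indicator_def)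
  ultimately show ?thesis
    unfolding c_def[symmetric] t_def[symmetric] by (cases "x \<in> B n") auto
qed

lemma set_code_eq_iff: "set_code B x = set_code C y \<longleftrightarrow> (\<forall>n. x \<in> B n \<longleftrightarrow> y \<in> C n)"
proof
  assume eq: "set_code B x = set_code C y"
  have "x \<in> B n \<longleftrightarrow> y \<in> C n" for n
  proof (induction n rule: less_induct)
    case (less n)
    then have "(\<Sum>k<n. indicator (B k) x * (1/3)^k :: real) = (\<Sum>k<n. indicator (C k) y * (1/3)^k)"
      by (intro sum.cong) (auto simp: indicator_def)
    with eq show ?case by (simp only: set_code_digit[of x B n] set_code_digit[of y C n])
  qed
  then show "\<forall>n. x \<in> B n \<longleftrightarrow> y \<in> C n" by blast
qed (simp add: set_code_def indicator_def)

text \<open>The code remembers the sets also as far as measurability is concerned: each digit is obtained by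
  a comparison from the code and the digits before it.\<close>

lemma set_code_measurable_imp_sets:
  assumes "set_code B \<in> borel_measurable N"
  shows "B n \<inter> space N \<in> sets N"
proof (induction n rule: less_induct)
  case (less n)
  have "(\<lambda>x. indicator (B k) x :: real) \<in> borel_measurable N" if "k < n" for k
    using less[OF that] by (simp add: borel_measurable_indicator_iff)
  then have "(\<lambda>x. \<Sum>k<n. indicator (B k) x * (1/3)^k :: real) \<in> borel_measurable N"
    by (intro borel_measurable_sum borel_measurable_times borel_measurable_const) auto
  with assms have "{x \<in> space N. (1/3)^n \<le> set_code B x - (\<Sum>k<n. indicator (B k) x * (1/3)^k)} \<in> sets N"
    by measurable
  also have "{x \<in> space N. (1/3)^n \<le> set_code B x - (\<Sum>k<n. indicator (B k) x * (1/3)^k)} = B n \<inter> space N"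
    using set_code_digit[of _ B n] by auto
  finally show ?case .
qed

text \<open>The code of a countable base, completed by the empty set so that it is never empty. Besides being
  injective it generates the \<open>\<sigma>\<close>-algebra, which is the last property: maps into \<open>M\<close> may be tested
  for measurability after composition with the code.\<close>

lemma standard_borel_code:
  assumes "standard_borel M"
  obtains f :: "'a \<Rightarrow> real" where "f \<in> borel_measurable M" "inj_on f (space M)"
    "\<And>N (s :: 'b \<Rightarrow> 'a). (\<lambda>x. f (s x)) \<in> borel_measurable N \<Longrightarrow> s \<in> space N \<rightarrow> space M \<Longrightarrow> s \<in> measurable N M"
proof -
  obtain T where T: "completely_metrizable_space T" "second_countable T" "topspace T = space M"
    "sets M = sigma_sets (space M) {U. openin T U}"
    using assms unfolding standard_borel_def by blast
  have H: "Hausdorff_space T"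
    using T(1) by (intro metrizable_imp_Hausdorff_space completely_metrizable_imp_metrizable_space)
  obtain B where "countable B \<and> (\<forall>V\<in>B. openin T V) \<and>
      (\<forall>U x. openin T U \<and> x \<in> U \<longrightarrow> (\<exists>V\<in>B. x \<in> V \<and> V \<subseteq> U))"
    using T(2) unfolding second_countable_def by (rule exE)
  then have B: "countable B" "\<And>V. V \<in> B \<Longrightarrow> openin T V"
    "\<And>U x. openin T U \<Longrightarrow> x \<in> U \<Longrightarrow> \<exists>V\<in>B. x \<in> V \<and> V \<subseteq> U"
    by simp_all
  define C where "C = from_nat_into (insert {} B)"
  have C: "range C = insert {} B" unfolding C_def using B(1) by (intro range_from_nat_into) auto
  have Co: "openin T (C n)" for n 
  proof -
    have "C n \<in> insert {} B" unfolding C[symmetric] by blast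
    then show ?thesis using B(2) by auto
  qed
  have Cm: "C n \<in> sets M" for n unfolding T(4) using Co by (intro sigma_sets.Basic) simp
  show ?thesis
  proof (rule that[of "set_code C"])
    show "set_code C \<in> borel_measurable M" using Cm by (rule measurable_set_code)
    show "inj_on (set_code C) (space M)"
    proof (rule inj_onI, rule ccontr)
      fix x y assume xy: "x \<in> space M" "y \<in> space M" "set_code C x = set_code C y" "x \<noteq> y"
      then obtain U V where UV: "openin T U" "openin T V" "x \<in> U" "y \<in> V" "disjnt U V"
        using H unfolding Hausdorff_space_def T(3) by blast
      then obtain W where "W \<in> B" "x \<in> W" "W \<subseteq> U" using B(3) by blast
      moreover from \<open>W \<in> B\<close> have "W \<in> range C" unfolding C by blast
      then obtain n where "W = C n" by blast
      ultimately have "x \<in> C n" "y \<notin> C n" using UV unfolding disjnt_def by blast+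
      with xy(3) show False unfolding set_code_eq_iff by blast
    qed
    fix N and s :: "'b \<Rightarrow> 'a" assume s: "(\<lambda>x. set_code C (s x)) \<in> borel_measurable N" "s \<in> space N \<rightarrow> space M"
    have "set_code (\<lambda>n. s -` C n) = (\<lambda>x. set_code C (s x))"
      by (rule ext) (simp add: set_code_def indicator_def)
    with s(1) have sC: "s -` C n \<inter> space N \<in> sets N" for n
      using set_code_measurable_imp_sets[of "\<lambda>n. s -` C n" N n] by simp
    show "s \<in> measurable N M"
    proof (rule measurable_sigma_sets[OF T(4)])
      show "{U. openin T U} \<subseteq> Pow (space M)" using openin_subset T(3) by auto
      show "s \<in> space N \<rightarrow> space M" by fact
      fix U assume "U \<in> {U. openin T U}"
      then have U: "openin T U" by simp
      have "U = (\<Union>n\<in>{n. C n \<subseteq> U}. C n)"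
      proof
        show "U \<subseteq> (\<Union>n\<in>{n. C n \<subseteq> U}. C n)"
        proof
          fix x assume "x \<in> U"
          then obtain W where "W \<in> B" "x \<in> W" "W \<subseteq> U" using B(3) U by blast
          moreover from \<open>W \<in> B\<close> have "W \<in> range C" unfolding C by blast
          then obtain n where "C n = W" by blast
          ultimately show "x \<in> (\<Union>n\<in>{n. C n \<subseteq> U}. C n)" by blast
        qed
      qed blast
      then have "s -` U \<inter> space N = (\<Union>n\<in>{n. C n \<subseteq> U}. s -` C n \<inter> space N)" by blast
      also have "\<dots> \<in> sets N" using sC by (intro sets.countable_UN') auto
      finally show "s -` U \<inter> space N \<in> sets N" .
    qed
  qed
qed

lemma second_countable_euclidean: "second_countable (euclidean :: 'a::second_countable_topology topology)"
proof -
  obtain B :: "'a set set" where B: "countable B" "topological_basis B" using ex_countable_basis by blast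
  show ?thesis
    unfolding second_countable_def
  proof (intro exI[of _ B] conjI ballI allI impI)
    show "countable B" by (rule B)
    show "openin euclidean V" if "V \<in> B" for V using topological_basis_open[OF B(2) that] by simp
    fix U :: "'a set" and x assume U: "openin euclidean U \<and> x \<in> U"
    then have "open U" "x \<in> U" by simp_all
    then obtain V where "V \<in> B" "x \<in> V" "V \<subseteq> U" by (rule topological_basisE[OF B(2)])
    then show "\<exists>V\<in>B. x \<in> V \<and> V \<subseteq> U" by (intro bexI[of _ V] conjI)
  qed
qed

lemma standard_borel_real:
  assumes "sets W = sets (borel :: real measure)" shows "standard_borel W"
proof -
  have "space W = UNIV" using sets_eq_imp_space_eq[OF assms] by simp
  then show ?thesis
    unfolding standard_borel_def using assms
    by (intro exI[of _ euclidean])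
       (simp add: completely_metrizable_space_euclidean sets_borel second_countable_euclidean)
qed

section \<open>Measurable sections modulo null sets\<close>

text \<open>On a compact set on which a real code \<open>\<iota>\<close> and \<open>q\<close> are jointly continuous, the section that selects
  in each fibre of \<open>q\<close> the point with the least code has a semicontinuous code. By the lemma
  \<open>lusin_compact_images\<close> such compact sets exhaust \<open>A\<close>. Outside of \<open>Y\<close> the section takes an arbitrary
  constant value in \<open>A\<close>, which makes it total.\<close>

lemma measurable_section:
  fixes q :: "'a \<Rightarrow> real"
  assumes M: "standard_borel M" "sigma_finite_measure M" and q: "q \<in> borel_measurable M"
    and A: "A \<in> sets M" "A \<noteq> {}"
  shows "\<exists>Y s. Y \<in> sets borel \<and> s \<in> measurable borel M \<and> (\<forall>y. s y \<in> A) \<and> (\<forall>y\<in>Y. q (s y) = y) \<and>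
    (AE x in M. x \<in> A \<longrightarrow> q x \<in> Y)"
proof -
  obtain \<iota> :: "'a \<Rightarrow> real" where \<iota>[measurable]: "\<iota> \<in> borel_measurable M"
    and code: "\<And>N (s :: real \<Rightarrow> 'a). (\<lambda>x. \<iota> (s x)) \<in> borel_measurable N \<Longrightarrow> s \<in> space N \<rightarrow> space M \<Longrightarrow> s \<in> measurable N M"
    using standard_borel_code[OF M(1)] by metis
  define f where "f x = (\<iota> x, q x)" for x
  have f: "f \<in> borel_measurable M" unfolding f_def using q by measurable
  obtain K :: "nat \<Rightarrow> 'a set" where "(\<forall>n. K n \<in> sets M \<and> K n \<subseteq> A \<and> compact (f ` K n)) \<and> A - (\<Union>n. K n) \<in> null_sets M"
    using lusin_compact_images[OF standard_borel_imp_radon_space[OF M(1)] M(2) f A(1)] ..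
  then have K: "\<And>n. K n \<in> sets M" "\<And>n. K n \<subseteq> A" "\<And>n. compact (f ` K n)" "A - (\<Union>n. K n) \<in> null_sets M"
    by simp_all
  define Y where "Y n = q ` K n" for n
  have Y_snd: "Y n = snd ` (f ` K n)" for n by (force simp: Y_def f_def)
  have cY: "compact (Y n)" for n
    unfolding Y_snd by (rule compact_continuous_image[OF continuous_on_snd[OF continuous_on_id] K(3)])
  have Ym: "Y n \<in> sets borel" for n using cY by (simp add: borel_closed compact_imp_closed)
  have sel: "\<exists>x\<in>K n. q x = y \<and> (\<forall>z\<in>K n. q z = y \<longrightarrow> \<iota> x \<le> \<iota> z)" if "y \<in> Y n" for n y
  proof -
    (* The codes of the points of the fibre form a compact set, which has a least element. *)
    define T where "T = fst ` (f ` K n \<inter> (UNIV \<times> {y}))"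
    have T: "\<iota> x \<in> T" if "x \<in> K n" "q x = y" for x using that by (force simp: T_def f_def)
    have "compact T"
    proof -
      have "closed (UNIV \<times> {y} :: (real \<times> real) set)" by (rule closed_Times[OF closed_UNIV closed_singleton])
      then have "compact (f ` K n \<inter> (UNIV \<times> {y}))" by (rule compact_Int_closed[OF K(3)])
      then show ?thesis
        unfolding T_def by (rule compact_continuous_image[OF continuous_on_fst[OF continuous_on_id]])
    qed
    moreover have "T \<noteq> {}" using that T by (auto simp: Y_def)
    ultimately obtain t where t: "t \<in> T" "\<forall>u\<in>T. t \<le> u" using compact_attains_inf[of T] by blast
    then obtain x where x: "x \<in> K n" "q x = y" "t = \<iota> x" by (auto simp: T_def f_def)
    have "\<iota> x \<le> \<iota> z" if "z \<in> K n" "q z = y" for z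
      using t(2) T[OF that] x(3) by simp
    with x show ?thesis by blast
  qed
  define U where "U = (\<Union>n. Y n)"
  define k where "k y = (LEAST n. y \<in> Y n)" for y
  have k: "y \<in> Y (k y)" if "y \<in> U" for y using that unfolding U_def k_def by (auto intro: LeastI)
  obtain x0 where x0: "x0 \<in> A" using A(2) by blast
  define s where "s y = (if y \<in> U then SOME x. x \<in> K (k y) \<and> q x = y \<and> (\<forall>z\<in>K (k y). q z = y \<longrightarrow> \<iota> x \<le> \<iota> z) else x0)" for y
  have s: "s y \<in> K (k y)" "q (s y) = y" "\<And>z. z \<in> K (k y) \<Longrightarrow> q z = y \<Longrightarrow> \<iota> (s y) \<le> \<iota> z" if "y \<in> U" for y
  proof -
    have "\<exists>x. x \<in> K (k y) \<and> q x = y \<and> (\<forall>z\<in>K (k y). q z = y \<longrightarrow> \<iota> x \<le> \<iota> z)"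
      using sel[OF k[OF that]] by blast
    from someI_ex[OF this] that show "s y \<in> K (k y)" "q (s y) = y"
      "\<And>z. z \<in> K (k y) \<Longrightarrow> q z = y \<Longrightarrow> \<iota> (s y) \<le> \<iota> z" unfolding s_def by auto
  qed
  have sA: "s y \<in> A" for y
    using s(1)[of y] K(2) x0 by (cases "y \<in> U") (auto simp: s_def)
  have AM: "A \<subseteq> space M" using A(1) by (rule sets.sets_into_space)
  have "(\<lambda>y. \<iota> (s y)) \<in> borel_measurable borel"
  proof (subst borel_measurable_iff_le, intro allI)
    fix c :: real
    (* The fibres whose least code is at most \<open>c\<close> form the projection of a compact set. Among
       several \<open>n\<close> with \<open>y \<in> Y n\<close> the section uses the first one. *)
    define Z where "Z n = snd ` (f ` K n \<inter> ({..c} \<times> UNIV))" for n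
    have ZY: "Z n \<subseteq> Y n" for n unfolding Z_def Y_snd by (intro image_mono Int_lower1)
    have Z: "y \<in> Z n \<longleftrightarrow> (\<exists>x\<in>K n. q x = y \<and> \<iota> x \<le> c)" for y n by (force simp: Z_def f_def)
    have "compact (Z n)" for n
    proof -
      have "closed ({..c} \<times> UNIV :: (real \<times> real) set)" by (rule closed_Times[OF closed_atMost closed_UNIV])
      then have "compact (f ` K n \<inter> ({..c} \<times> UNIV))" by (rule compact_Int_closed[OF K(3)])
      then show ?thesis unfolding Z_def by (rule compact_continuous_image[OF continuous_on_snd[OF continuous_on_id]])
    qed
    then have Zm: "Z n \<in> sets borel" for n by (simp add: borel_closed compact_imp_closed)
    have "{y \<in> space borel. \<iota> (s y) \<le> c} =
        (\<Union>n. Z n - (\<Union>i<n. Y i)) \<union> (if \<iota> x0 \<le> c then - U else {})" (is "?l = ?r")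
    proof (intro set_eqI)
      fix y
      show "y \<in> ?l \<longleftrightarrow> y \<in> ?r"
      proof (cases "y \<in> U")
        case True
        have kn: "y \<in> Y n \<Longrightarrow> k y \<le> n" for n unfolding k_def by (rule Least_le)
        have "y \<in> ?r \<longleftrightarrow> (\<exists>n. y \<in> Z n \<and> (\<forall>i<n. y \<notin> Y i))" using True by auto
        also have "\<dots> \<longleftrightarrow> y \<in> Z (k y)"
        proof
          assume "\<exists>n. y \<in> Z n \<and> (\<forall>i<n. y \<notin> Y i)"
          then obtain n where n: "y \<in> Z n" "\<forall>i<n. y \<notin> Y i" by blast
          have "y \<in> Y n" using n(1) ZY by blast
          then have "k y \<le> n" by (rule kn)
          moreover have "\<not> k y < n" using n(2) k[OF True] by blast
          ultimately have "n = k y" by simp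
          then show "y \<in> Z (k y)" using n(1) by simp
        next
          assume "y \<in> Z (k y)"
          moreover have "\<forall>i<k y. y \<notin> Y i" using kn by (meson leD)
          ultimately show "\<exists>n. y \<in> Z n \<and> (\<forall>i<n. y \<notin> Y i)" by (intro exI[of _ "k y"] conjI)
        qed
        also have "\<dots> \<longleftrightarrow> \<iota> (s y) \<le> c"
        proof
          assume "y \<in> Z (k y)"
          then obtain x where "x \<in> K (k y)" "q x = y" "\<iota> x \<le> c" unfolding Z by blast
          then show "\<iota> (s y) \<le> c" using s(3)[OF True, of x] by simp
        next
          assume "\<iota> (s y) \<le> c"
          then show "y \<in> Z (k y)" using s(1,2)[OF True] unfolding Z by blast
        qed
        finally show ?thesis by simp
      next
        case False
        then have "y \<notin> Y n" for n unfolding U_def by blast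
        then have "y \<notin> Z n" for n using ZY by blast
        then show ?thesis using False by (auto simp: s_def)
      qed
    qed
    also have "\<dots> \<in> sets borel"
      using Zm Ym unfolding U_def by (intro sets.Un sets.countable_UN sets.Diff sets.finite_UN) auto
    finally show "{y \<in> space borel. \<iota> (s y) \<le> c} \<in> sets borel" .
  qed
  then have "s \<in> measurable borel M" by (rule code) (use sA AM in auto)
  moreover have "U \<in> sets borel" unfolding U_def using Ym by auto
  moreover have "AE x in M. x \<in> A \<longrightarrow> q x \<in> U"
    using AE_not_in[OF K(4)] by eventually_elim (auto simp: U_def Y_def)
  ultimately show ?thesis using sA s(2) by (intro exI[of _ U] exI[of _ s]) blast
qed

section \<open>Haar measure\<close>

lemma measurable_group_uminus[measurable (raw)]:
  fixes f :: "'a \<Rightarrow> 'g::topological_group_add"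
  assumes "f \<in> borel_measurable M"
  shows "(\<lambda>x. - f x) \<in> borel_measurable M"
  by (rule borel_measurable_continuous_on[OF _ assms]) (rule continuous_on_minus[OF continuous_on_id])

lemma vimage_left_translation: "(\<lambda>h. g + h) -` A = (\<lambda>h. - g + h) ` A" for g :: "'g::group_add"
proof (intro set_eqI iffI)
  fix h assume "h \<in> (\<lambda>h. g + h) -` A"
  then have "- g + (g + h) \<in> (\<lambda>h. - g + h) ` A" by (intro imageI) simp
  then show "h \<in> (\<lambda>h. - g + h) ` A" by simp
next
  fix h assume "h \<in> (\<lambda>h. - g + h) ` A"
  then obtain k where "k \<in> A" "h = - g + k" by blast
  then show "h \<in> (\<lambda>h. g + h) -` A" by simp
qed

lemma left_haar_measureD:
  assumes "left_haar_measure lam"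
  shows "sets lam = sets borel" "emeasure lam UNIV \<noteq> 0" "compact K \<Longrightarrow> emeasure lam K < \<infinity>"
    "A \<in> sets borel \<Longrightarrow> emeasure lam ((\<lambda>h. g + h) ` A) = emeasure lam A"
  using assms by (simp_all add: left_haar_measure_def)

locale haar_group =
  fixes lam :: "'g::{topological_group_add, t2_space, second_countable_topology} measure"
  assumes locally_compact: "locally compact (UNIV :: 'g set)"
    and haar: "left_haar_measure lam"
begin

lemma sets_lam[simp, measurable_cong]: "sets lam = sets borel"
  by (rule left_haar_measureD(1)[OF haar])

lemma space_lam[simp]: "space lam = UNIV"
  using sets_eq_imp_space_eq[OF sets_lam] by simp

lemma compact_exhaustion:
  obtains K :: "nat \<Rightarrow> 'g set" where "\<And>n. compact (K n)" "incseq K" "(\<Union>n. K n) = UNIV"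
  using locally_compact_open_sigma_compact[OF locally_compact open_UNIV] by blast

lemma sigma_finite_lam: "sigma_finite_measure lam"
proof -
  obtain K :: "nat \<Rightarrow> 'g set" where K: "\<And>n. compact (K n)" "incseq K" "(\<Union>n. K n) = UNIV"
    using compact_exhaustion by blast
  have "emeasure lam (K n) \<noteq> \<infinity>" for n
    using left_haar_measureD(3)[OF haar K(1)[of n]] by simp
  then show ?thesis
    using K by (intro sigma_finite_measure.intro exI[of _ "range K"]) (auto intro!: borel_closed compact_imp_closed)
qed

sublocale sigma_finite_measure lam by (rule sigma_finite_lam)

sublocale square: pair_sigma_finite lam lam by unfold_locales

lemma left_invariant: "distr lam lam (\<lambda>h. g + h) = lam"
proof (rule measure_eqI)
  fix A assume "A \<in> sets (distr lam lam (\<lambda>h. g + h))"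
  then have A: "A \<in> sets borel" by simp
  have "emeasure (distr lam lam (\<lambda>h. g + h)) A = emeasure lam ((\<lambda>h. g + h) -` A)"
    using A by (subst emeasure_distr) auto
  also have "\<dots> = emeasure lam A"
    unfolding vimage_left_translation by (rule left_haar_measureD(4)[OF haar A])
  finally show "emeasure (distr lam lam (\<lambda>h. g + h)) A = emeasure lam A" .
qed simp

lemma nn_integral_left:
  assumes "f \<in> borel_measurable borel"
  shows "(\<integral>\<^sup>+h. f (g + h) \<partial>lam) = (\<integral>\<^sup>+h. f h \<partial>lam)"
  using assms by (subst (2) left_invariant[of g, symmetric]) (simp add: nn_integral_distr)

lemma AE_left_imp:
  assumes "AE h in lam. P h" shows "AE h in lam. P (g + h)"
proof -
  have "(\<lambda>h. g + h) \<in> measurable lam lam" by simp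
  moreover have "AE h in distr lam lam (\<lambda>h. g + h). P h" using assms by (simp only: left_invariant)
  ultimately show ?thesis by (rule AE_distrD)
qed

lemma AE_left: "(AE h in lam. P (g + h)) \<longleftrightarrow> (AE h in lam. P h)"
  using AE_left_imp[of P g] AE_left_imp[of "\<lambda>h. P (g + h)" "- g", simplified] by blast

lemma AE_lam_ex: "AE h in lam. P h \<Longrightarrow> \<exists>h. P h"
proof -
  assume P: "AE h in lam. P h"
  have "ae_filter lam \<noteq> bot"
    using left_haar_measureD(2)[OF haar] by (simp add: ae_filter_eq_bot_iff)
  then show ?thesis using P eventually_happens by blast
qed

text \<open>For a fixed \<open>k\<close> the set of all \<open>g\<close> with \<open>- k + g\<close> in a null set \<open>N\<close> is null; exchanging the
  order of the variables yields one \<open>g\<close> for which \<open>{k. - k + g \<in> N}\<close>, which is the left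
  translate by \<open>g\<close> of the reflection of \<open>N\<close>, is null.\<close>

lemma AE_reflect_imp:
  assumes "AE h in lam. P h" shows "AE h in lam. P (- h)"
proof -
  obtain N where N: "N \<in> null_sets lam" "{h. \<not> P h} \<subseteq> N"
    using assms unfolding eventually_ae_filter by auto
  then have Nm[measurable]: "N \<in> sets borel" by auto
  have "AE k in lam. AE g in lam. - k + g \<notin> N"
    using N(1) by (intro AE_I2 AE_left_imp AE_not_in)
  then have "AE g in lam. AE k in lam. - k + g \<notin> N"
    by (subst (asm) square.AE_commute) measurable
  then obtain g where "AE k in lam. - k + g \<notin> N" using AE_lam_ex by blast
  then have "AE k in lam. - (g + k) + g \<notin> N" by (rule AE_left_imp)
  then have "AE k in lam. - k \<notin> N" by (simp add: minus_add add.assoc)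
  then show ?thesis using N(2) by auto
qed

lemma AE_reflect: "(AE h in lam. P (- h)) \<longleftrightarrow> (AE h in lam. P h)"
  using AE_reflect_imp[of P] AE_reflect_imp[of "\<lambda>h. P (- h)", simplified] by blast

text \<open>A right translation is a left translation conjugated by reflection.\<close>

lemma AE_right: "(AE h in lam. P (h + g)) \<longleftrightarrow> (AE h in lam. P h)"
proof -
  have "(AE h in lam. P (h + g)) \<longleftrightarrow> (AE h in lam. P (- h + g))"
    by (rule AE_reflect[symmetric])
  also have "\<dots> \<longleftrightarrow> (AE h in lam. P (- (- g + h)))" by (simp add: minus_add)
  also have "\<dots> \<longleftrightarrow> (AE h in lam. P h)" by (simp add: AE_left[of "\<lambda>h. P (- h)"] AE_reflect)
  finally show ?thesis .
qed

lemma right_translate_left_haar: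
  "left_haar_measure (distr lam borel (\<lambda>h. h + g))"
  unfolding left_haar_measure_def
proof (intro conjI allI impI ballI)
  have [measurable]: "(\<lambda>h. h + g) \<in> measurable lam borel" by measurable
  show "emeasure (distr lam borel (\<lambda>h. h + g)) UNIV \<noteq> 0"
    using left_haar_measureD(2)[OF haar] by (simp add: emeasure_distr)
  fix K :: "'g set" assume K: "compact K"
  then have "K \<in> sets borel" by (simp add: borel_closed compact_imp_closed)
  moreover have "(\<lambda>h. h + g) -` K = (\<lambda>h. h - g) ` K"
  proof (intro set_eqI iffI)
    fix h assume "h \<in> (\<lambda>h. h + g) -` K"
    then have "(h + g) - g \<in> (\<lambda>h. h - g) ` K" by (intro imageI) simp
    then show "h \<in> (\<lambda>h. h - g) ` K" by simp
  qed auto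
  moreover have "compact ((\<lambda>h. h - g) ` K)"
    using K by (intro compact_continuous_image continuous_intros)
  ultimately show "emeasure (distr lam borel (\<lambda>h. h + g)) K < \<infinity>"
    using left_haar_measureD(3)[OF haar] by (simp add: emeasure_distr)
next
  fix k and A :: "'g set" assume A[measurable]: "A \<in> sets borel"
  have eq: "(\<lambda>h. k + h) ` A = (\<lambda>h. - k + h) -` A" for A :: "'g set"
    using vimage_left_translation[of "- k" A] by simp
  have [measurable]: "(\<lambda>h. k + h) ` A \<in> sets borel"
    unfolding eq using measurable_sets[of "\<lambda>h. - k + h" borel borel A] by simp
  define C where "C = (\<lambda>h. h + g) -` A"
  have C: "C \<in> sets borel" using measurable_sets[of "\<lambda>h. h + g" borel borel A] by (simp add: C_def)
  have "(\<lambda>h. h + g) -` ((\<lambda>h. k + h) ` A) = (\<lambda>h. k + h) ` C"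
    unfolding C_def eq by (auto simp: add.assoc)
  then show "emeasure (distr lam borel (\<lambda>h. h + g)) ((\<lambda>h. k + h) ` A) = emeasure (distr lam borel (\<lambda>h. h + g)) A"
    using left_haar_measureD(4)[OF haar C] by (simp add: emeasure_distr C_def)
qed simp

text \<open>The constant is the value at \<open>g\<close> of the modular function. The right translate of \<open>lam\<close> is a left
  Haar measure that is absolutely continuous with respect to \<open>lam\<close>; its Radon--Nikodym derivative is
  left invariant, and hence constant.\<close>

lemma right_scaling:
  obtains c :: ennreal where "c \<noteq> 0" "c \<noteq> \<infinity>"
    "\<And>f :: 'g \<Rightarrow> ennreal. f \<in> borel_measurable borel \<Longrightarrow> (\<integral>\<^sup>+h. f (h + g) \<partial>lam) = c * (\<integral>\<^sup>+h. f h \<partial>lam)"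
proof -
  define lam' where "lam' = distr lam borel (\<lambda>h. h + g)"
  have sl'[simp, measurable_cong]: "sets lam' = sets borel" by (simp add: lam'_def)
  interpret L': haar_group lam'
    using right_translate_left_haar locally_compact unfolding lam'_def by unfold_locales
  have "absolutely_continuous lam lam'"
    unfolding absolutely_continuous_def
  proof
    fix N assume N: "N \<in> null_sets lam"
    then have "AE h in lam. h + g \<notin> N" using AE_right[of "\<lambda>h. h \<notin> N"] AE_not_in by blast
    then have "AE h in lam'. h \<notin> N"
      using N unfolding lam'_def by (subst AE_distr_iff) auto
    then show "N \<in> null_sets lam'" using N by (subst AE_iff_null_sets) auto
  qed
  then obtain p where p[measurable]: "p \<in> borel_measurable lam" "density lam p = lam'"
    using Radon_Nikodym[of lam'] by auto
  have inv: "AE k in lam. p (a + k) = p k" for a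
  proof -
    have "density lam (\<lambda>k. p (a + k)) = density lam p"
    proof (rule measure_eqI)
      fix A assume "A \<in> sets (density lam (\<lambda>k. p (a + k)))"
      then have A[measurable]: "A \<in> sets borel" by simp
      have "emeasure (density lam (\<lambda>k. p (a + k))) A = (\<integral>\<^sup>+k. p (a + k) * indicator A (- a + (a + k)) \<partial>lam)"
        by (simp add: emeasure_density add.assoc[symmetric])
      also have "\<dots> = (\<integral>\<^sup>+k. p k * indicator A (- a + k) \<partial>lam)"
        by (rule nn_integral_left[of "\<lambda>k. p k * indicator A (- a + k)"]) measurable
      also have "\<dots> = (\<integral>\<^sup>+k. indicator A (- a + k) \<partial>lam')"
        unfolding p(2)[symmetric] by (subst nn_integral_density) auto
      also have "\<dots> = (\<integral>\<^sup>+k. indicator A k \<partial>lam')"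
        by (rule L'.nn_integral_left) measurable
      also have "\<dots> = emeasure (density lam p) A" unfolding p(2) by simp
      finally show "emeasure (density lam (\<lambda>k. p (a + k))) A = emeasure (density lam p) A" .
    qed simp
    then show ?thesis by (subst (asm) density_unique_iff) auto
  qed
  then have "AE a in lam. AE k in lam. p (a + k) = p k" by simp
  then have "AE k in lam. AE a in lam. p (a + k) = p k"
    by (subst (asm) square.AE_commute) measurable
  then obtain k where "AE a in lam. p (a + k) = p k" using AE_lam_ex by blast
  (* A single base point \<open>k\<close> suffices, since right translations preserve Haar null sets. *)
  then have const: "AE a in lam. p a = p k" using AE_right[of "\<lambda>a. p a = p k"] by blast
  have lam'_eq: "lam' = density lam (\<lambda>_. p k)"
    unfolding p(2)[symmetric] by (rule density_cong) (use const in auto)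
  then have int: "(\<integral>\<^sup>+h. f (h + g) \<partial>lam) = p k * (\<integral>\<^sup>+h. f h \<partial>lam)" if [measurable]: "f \<in> borel_measurable borel" for f
  proof -
    have "(\<integral>\<^sup>+h. f (h + g) \<partial>lam) = (\<integral>\<^sup>+h. f h \<partial>lam')"
      unfolding lam'_def by (subst nn_integral_distr) auto
    also have "\<dots> = (\<integral>\<^sup>+h. p k * f h \<partial>lam)"
      unfolding lam'_eq by (subst nn_integral_density) auto
    finally show ?thesis by (simp add: nn_integral_cmult)
  qed
  have "p k \<noteq> 0"
  proof
    assume "p k = 0"
    then have "emeasure lam' UNIV = 0" using int[of "\<lambda>_. 1"] lam'_eq by (simp add: emeasure_density)
    then show False using left_haar_measureD(2)[OF L'.haar] by simp
  qed
  moreover have "p k \<noteq> \<infinity>"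
  proof
    assume inf: "p k = \<infinity>"
    obtain K :: "nat \<Rightarrow> 'g set" where K: "\<And>n. compact (K n)" "incseq K" "(\<Union>n. K n) = UNIV"
      using compact_exhaustion by blast
    have Km: "K n \<in> sets borel" for n using K(1) by (simp add: borel_closed compact_imp_closed)
    have "emeasure lam (K n) = 0" for n
    proof (rule ccontr)
      assume "emeasure lam (K n) \<noteq> 0"
      then have "emeasure lam' (K n) = \<infinity>"
        using Km[of n] inf unfolding lam'_eq by (simp add: emeasure_density_const ennreal_top_mult)
      then show False using left_haar_measureD(3)[OF L'.haar K(1)[of n]] by simp
    qed
    then have "emeasure lam (\<Union>n. K n) = 0" using Km by (intro emeasure_UN_eq_0) auto
    then show False using left_haar_measureD(2)[OF haar] K(3) by simp
  qed
  ultimately show ?thesis using that int by blast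
qed

text \<open>The set is the left translate by \<open>h\<close> of the reflection of \<open>K\<close>, so that its measure does not
  depend on \<open>h\<close>.\<close>

lemma compact_reflect_finite:
  assumes "compact K"
  shows "emeasure lam {g. - g + h \<in> K} = emeasure lam (uminus ` K)" "emeasure lam (uminus ` K) < \<infinity>"
proof -
  have c: "compact (uminus ` K)" using assms by (rule compact_continuous_image[OF continuous_on_minus[OF continuous_on_id]])
  then have "uminus ` K \<in> sets borel" by (simp add: borel_closed compact_imp_closed)
  moreover have "{g. - g + h \<in> K} = (\<lambda>m. h + m) ` (uminus ` K)"
  proof (intro set_eqI iffI)
    fix g assume "g \<in> {g. - g + h \<in> K}"
    then have "- (- g + h) \<in> uminus ` K" by blast
    moreover have "g = h + - (- g + h)" by (simp add: minus_add add.assoc[symmetric])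
    ultimately show "g \<in> (\<lambda>m. h + m) ` (uminus ` K)" by blast
  qed (auto simp: minus_add add.assoc)
  ultimately show "emeasure lam {g. - g + h \<in> K} = emeasure lam (uminus ` K)"
    using left_haar_measureD(4)[OF haar] by simp
  show "emeasure lam (uminus ` K) < \<infinity>" by (rule left_haar_measureD(3)[OF haar c])
qed

end

section \<open>Nonsingular actions\<close>

lemma (in sigma_finite_measure) sets_Collect_AE:
  assumes P: "{z \<in> space (N \<Otimes>\<^sub>M M). P (fst z) (snd z)} \<in> sets (N \<Otimes>\<^sub>M M)"
  shows "{x \<in> space N. AE y in M. P x y} \<in> sets N"
proof -
  define C where "C = space (N \<Otimes>\<^sub>M M) - {z \<in> space (N \<Otimes>\<^sub>M M). P (fst z) (snd z)}"
  have C[measurable]: "C \<in> sets (N \<Otimes>\<^sub>M M)" unfolding C_def using P by (rule sets.compl_sets)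
  have "(\<lambda>x. \<integral>\<^sup>+y. indicator C (x, y) \<partial>M) \<in> borel_measurable N" by measurable
  then have "{x \<in> space N. (\<integral>\<^sup>+y. indicator C (x, y) \<partial>M) = 0} \<in> sets N" by measurable
  also have "{x \<in> space N. (\<integral>\<^sup>+y. indicator C (x, y) \<partial>M) = 0} = {x \<in> space N. AE y in M. P x y}"
  proof (rule Collect_cong, rule conj_cong[OF refl])
    fix x assume x: "x \<in> space N"
    then have "(\<lambda>y. indicator C (x, y) :: ennreal) \<in> borel_measurable M" by measurable
    then have "(\<integral>\<^sup>+y. indicator C (x, y) \<partial>M) = 0 \<longleftrightarrow> (AE y in M. indicator C (x, y) = (0::ennreal))"
      by (rule nn_integral_0_iff_AE)
    also have "\<dots> \<longleftrightarrow> (AE y in M. P x y)"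
      by (rule AE_cong) (use x in \<open>auto simp: C_def space_pair_measure indicator_def\<close>)
    finally show "(\<integral>\<^sup>+y. indicator C (x, y) \<partial>M) = 0 \<longleftrightarrow> (AE y in M. P x y)" .
  qed
  finally show ?thesis .
qed

locale nonsingular_action = haar_group lam
  for lam :: "'g::{topological_group_add, t2_space, second_countable_topology} measure" +
  fixes M :: "'x measure" and a :: "'g \<Rightarrow> 'x \<Rightarrow> 'x"
  assumes nonsingular: "nonsingular_G_space M a"
begin

lemma standard_borel: "standard_borel M" and sigma_finite_M: "sigma_finite_measure M"
  using nonsingular by (simp_all add: nonsingular_G_space_def standard_measure_space_def)

lemma action_joint_measurable: "(\<lambda>(g, x). a g x) \<in> measurable (borel \<Otimes>\<^sub>M M) M"
  using nonsingular by (simp add: nonsingular_G_space_def borel_G_space_def)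

lemma measurable_action[measurable (raw)]:
  assumes "f \<in> borel_measurable N" "s \<in> measurable N M"
  shows "(\<lambda>x. a (f x) (s x)) \<in> measurable N M"
  using measurable_compose[OF measurable_Pair[OF assms] action_joint_measurable] by simp

lemma action_closed[simp]: "x \<in> space M \<Longrightarrow> a g x \<in> space M"
  using measurable_space[OF action_joint_measurable, of "(g, x)"] by (simp add: space_pair_measure)

lemma action_zero[simp]: "x \<in> space M \<Longrightarrow> a 0 x = x"
  using nonsingular by (simp add: nonsingular_G_space_def borel_G_space_def)

lemma action_add: "x \<in> space M \<Longrightarrow> a (g + h) x = a g (a h x)"
  using nonsingular by (simp add: nonsingular_G_space_def borel_G_space_def)

lemma action_cancel[simp]:
  "x \<in> space M \<Longrightarrow> a g (a (- g) x) = x" "x \<in> space M \<Longrightarrow> a (- g) (a g x) = x"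
  by (simp_all add: action_add[symmetric])

lemma action_image: "A \<subseteq> space M \<Longrightarrow> a g ` A = a (- g) -` A \<inter> space M"
  by (force simp: image_iff subset_iff)

lemma invariant_setI:
  assumes "A \<subseteq> space M" "\<And>g x. x \<in> A \<Longrightarrow> a g x \<in> A"
  shows "invariant_set a A"
  unfolding invariant_set_def action_image[OF assms(1)]
proof (intro allI set_eqI iffI)
  fix g x assume "x \<in> a (- g) -` A \<inter> space M"
  then show "x \<in> A" using assms(2)[of "a (- g) x" g] by simp
qed (use assms in auto)

lemma invariant_setD: "invariant_set a A \<Longrightarrow> x \<in> A \<Longrightarrow> a g x \<in> A"
  unfolding invariant_set_def by blast

lemma translated_measure_eq: "translated_measure M a g = distr M M (a (- g))"
  unfolding translated_measure_def distr_def
proof (rule measure_of_eq)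
  show "sets M \<subseteq> Pow (space M)" by (rule sets.space_closed)
  fix A assume "A \<in> sigma_sets (space M) (sets M)"
  then have "A \<subseteq> space M" using sets.sigma_sets_eq sets.sets_into_space by metis
  then show "emeasure M (a g ` A) = emeasure M (a (- g) -` A \<inter> space M)"
    by (simp add: action_image)
qed

lemma null_translate_iff:
  assumes A: "A \<in> sets M"
  shows "a g -` A \<inter> space M \<in> null_sets M \<longleftrightarrow> A \<in> null_sets M"
proof -
  have [measurable]: "a g \<in> measurable M M" by measurable
  have "equivalent_measures (translated_measure M a (- g)) M"
    using nonsingular by (simp add: nonsingular_G_space_def)
  then have "equivalent_measures (distr M M (a g)) M"
    unfolding translated_measure_eq by simp
  then have "null_sets (distr M M (a g)) = null_sets M"
    unfolding equivalent_measures_def absolutely_continuous_def by blast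
  then show ?thesis using A null_sets_distr_iff[of "a g" M M A] by auto
qed

lemma AE_action_imp:
  assumes "AE x in M. P x" shows "AE x in M. P (a g x)"
proof -
  obtain N where N: "N \<in> null_sets M" "{x \<in> space M. \<not> P x} \<subseteq> N"
    using assms by (auto simp: eventually_ae_filter)
  then have "a g -` N \<inter> space M \<in> null_sets M" using null_translate_iff[of N g] by auto
  moreover have "{x \<in> space M. \<not> P (a g x)} \<subseteq> a g -` N \<inter> space M"
    using N(2) action_closed by blast
  ultimately show ?thesis unfolding eventually_ae_filter by blast
qed

sublocale M: sigma_finite_measure M by (rule sigma_finite_M)

sublocale GM: pair_sigma_finite lam M by unfold_locales

lemma sets_GM[measurable_cong]: "sets (lam \<Otimes>\<^sub>M M) = sets (borel \<Otimes>\<^sub>M M)"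
  by (rule sets_pair_measure_cong) simp_all

text \<open>Each \<open>g\<close> preserves null sets, and Fubini's theorem exchanges \<open>g\<close> and \<open>x\<close>. This is the device by which
  null sets are made invariant.\<close>

lemma AE_orbit:
  assumes "AE x in M. P x" shows "AE x in M. AE g in lam. P (a g x)"
proof -
  obtain N where N: "N \<in> null_sets M" "{x \<in> space M. \<not> P x} \<subseteq> N"
    using assms by (auto simp: eventually_ae_filter)
  have [measurable]: "N \<in> sets M" using N by auto
  have "AE g in lam. AE x in M. a g x \<notin> N"
    using AE_action_imp[OF AE_not_in[OF N(1)]] by simp
  then have "AE x in M. AE g in lam. a g x \<notin> N"
    by (subst (asm) GM.AE_commute) measurable
  moreover have "AE x in M. (AE g in lam. a g x \<notin> N) \<longrightarrow> (AE g in lam. P (a g x))"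
  proof (rule AE_I2, rule impI)
    fix x assume "x \<in> space M" and ae: "AE g in lam. a g x \<notin> N"
    then have "P (a g x)" if "a g x \<notin> N" for g using that N(2) action_closed by blast
    with ae show "AE g in lam. P (a g x)" by auto
  qed
  ultimately show ?thesis by (rule AE_mp)
qed

text \<open>A density \<open>r\<close> for which \<open>r \<mu>\<close> is invariant exhibits the Radon--Nikodym cocycle as a coboundary,
  so that the cocycle identity holds everywhere and not just almost everywhere.\<close>

lemma cocycle_of_invariant_density:
  assumes r[measurable]: "r \<in> borel_measurable M" and pos: "\<And>x. 0 < r x"
    and inv: "\<And>g (u :: 'x \<Rightarrow> ennreal). u \<in> borel_measurable M \<Longrightarrow>
      (\<integral>\<^sup>+x. u (a g x) * ennreal (r x) \<partial>M) = (\<integral>\<^sup>+x. u x * ennreal (r x) \<partial>M)"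
  shows "radon_nikodym_cocycle M a (\<lambda>g x. r x / r (a g x))"
proof -
  have "AE x in M. ennreal (r x / r (a g x)) = RN_deriv M (translated_measure M a g) x" for g
  proof (rule M.RN_deriv_unique)
    show "density M (\<lambda>x. ennreal (r x / r (a g x))) = translated_measure M a g"
      unfolding translated_measure_eq
    proof (rule measure_eqI)
      fix A assume "A \<in> sets (density M (\<lambda>x. ennreal (r x / r (a g x))))"
      then have A[measurable]: "A \<in> sets M" by simp
      have "emeasure (density M (\<lambda>x. ennreal (r x / r (a g x)))) A
          = (\<integral>\<^sup>+x. ennreal (r x / r (a g x)) * indicator A x \<partial>M)"
        by (simp add: emeasure_density)
      also have "\<dots> = (\<integral>\<^sup>+x. (ennreal (1 / r (a g x)) * indicator A (a (- g) (a g x))) * ennreal (r x) \<partial>M)"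
      proof (intro nn_integral_cong)
        fix x assume "x \<in> space M"
        have "ennreal (r x / r (a g x)) = ennreal (1 / r (a g x)) * ennreal (r x)"
          by (subst ennreal_mult[symmetric]) (auto simp: pos less_imp_le)
        then show "ennreal (r x / r (a g x)) * indicator A x
            = (ennreal (1 / r (a g x)) * indicator A (a (- g) (a g x))) * ennreal (r x)"
          using \<open>x \<in> space M\<close> by (simp add: ac_simps)
      qed
      also have "\<dots> = (\<integral>\<^sup>+x. (ennreal (1 / r x) * indicator A (a (- g) x)) * ennreal (r x) \<partial>M)"
        by (rule inv[of "\<lambda>x. ennreal (1 / r x) * indicator A (a (- g) x)"]) measurable
      also have "\<dots> = (\<integral>\<^sup>+x. indicator A (a (- g) x) \<partial>M)"
      proof (intro nn_integral_cong)
        fix x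
        have "ennreal (1 / r x) * ennreal (r x) = 1"
          using pos[of x] by (simp add: ennreal_mult[symmetric])
        then show "(ennreal (1 / r x) * indicator A (a (- g) x)) * ennreal (r x) = indicator A (a (- g) x)"
          by (metis mult.commute mult.left_commute mult_1)
      qed
      also have "\<dots> = emeasure (distr M M (a (- g))) A"
        by (subst nn_integral_distr[symmetric, of "a (- g)" M M "indicator A"]) auto
      finally show "emeasure (density M (\<lambda>x. ennreal (r x / r (a g x)))) A = emeasure (distr M M (a (- g))) A" .
    qed simp
  qed measurable
  then show ?thesis
    unfolding radon_nikodym_cocycle_def
    by (auto simp: pos action_add less_imp_neq[OF pos] less_imp_neq[OF pos, symmetric])
qed

text \<open>Passing from \<open>X\<close> to this set makes a conull Borel set invariant: the condition does not change
  along an orbit, because Haar null sets are preserved by right translations.\<close>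

definition orbit_core :: "'x set \<Rightarrow> 'x set" where
  "orbit_core X = {x \<in> space M. AE g in lam. a g x \<in> X}"

lemma sets_orbit_core[measurable]:
  assumes [measurable]: "X \<in> sets M" shows "orbit_core X \<in> sets M"
  unfolding orbit_core_def by (rule sets_Collect_AE) measurable

lemma AE_orbit_core: "AE x in M. x \<in> X \<Longrightarrow> AE x in M. x \<in> orbit_core X"
  using AE_orbit[of "\<lambda>x. x \<in> X"] AE_space[of M] unfolding orbit_core_def by simp

lemma orbit_core_invariant: "x \<in> orbit_core X \<Longrightarrow> a h x \<in> orbit_core X"
  unfolding orbit_core_def using AE_right[of "\<lambda>g. a g x \<in> X" h] by (simp add: action_add)

lemma orbit_coreD: "x \<in> orbit_core X \<Longrightarrow> \<exists>g. a g x \<in> X"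
  unfolding orbit_core_def using AE_lam_ex by blast

end

section \<open>Translation spaces are dissipative\<close>

locale translation_isomorphism = nonsingular_action lam M a
  for lam :: "'g::{topological_group_add, t2_space, second_countable_topology} measure"
    and M :: "'x measure" and a :: "'g \<Rightarrow> 'x \<Rightarrow> 'x" +
  fixes W :: "'w measure" and X0 Y0 and \<phi> :: "'x \<Rightarrow> 'w \<times> 'g"
  assumes W: "standard_measure_space W"
    and X0[measurable]: "X0 \<in> sets M"
    and X0_invariant: "invariant_set a X0" and X0_conull: "space M - X0 \<in> null_sets M"
    and bij: "bij_betw \<phi> X0 Y0"
    and \<phi>_measurable: "\<phi> \<in> measurable (restrict_space M X0) (restrict_space (W \<Otimes>\<^sub>M lam) Y0)"
    and \<phi>_equivalent: "equivalent_measures (distr (restrict_space M X0) (W \<Otimes>\<^sub>M lam) \<phi>) (W \<Otimes>\<^sub>M lam)"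
    and \<phi>_equivariant: "\<And>g. AE x in restrict_space M X0. \<phi> (a g x) = (\<lambda>(w, h). (w, g + h)) (\<phi> x)"
begin

abbreviation "N \<equiv> W \<Otimes>\<^sub>M lam"
abbreviation "M0 \<equiv> restrict_space M X0"

lemma sigma_finite_W: "sigma_finite_measure W"
  using W by (simp add: standard_measure_space_def)

sublocale W: sigma_finite_measure W by (rule sigma_finite_W)

sublocale WG: pair_sigma_finite W lam by unfold_locales

lemma X0_subset: "X0 \<subseteq> space M"
  by (rule sets.sets_into_space[OF X0])

lemma space_M0[simp]: "space M0 = X0"
  using X0_subset by (auto simp: space_restrict_space)

lemma M0_to_N[measurable]: "\<phi> \<in> measurable M0 N"
  using \<phi>_measurable by (simp add: measurable_restrict_space2_iff)

lemma AE_M0_iff: "(AE x in M0. P x) \<longleftrightarrow> (AE x in M. x \<in> X0 \<longrightarrow> P x)"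
  by (rule AE_restrict_space_iff) simp

lemma AE_in_X0: "AE x in M. x \<in> X0"
  using X0_conull by (rule AE_I'[where N = "space M - X0"]) auto

lemma AE_N_iff:
  assumes "{y \<in> space N. P y} \<in> sets N"
  shows "(AE y in N. P y) \<longleftrightarrow> (AE x in M. x \<in> X0 \<longrightarrow> P (\<phi> x))"
proof -
  have "(AE y in N. P y) \<longleftrightarrow> (AE y in distr M0 N \<phi>. P y)"
  proof -
    have "null_sets (distr M0 N \<phi>) = null_sets N"
      using \<phi>_equivalent unfolding equivalent_measures_def absolutely_continuous_def by blast
    then show ?thesis unfolding eventually_ae_filter by simp
  qed
  also have "\<dots> \<longleftrightarrow> (AE x in M0. P (\<phi> x))" using assms by (intro AE_distr_iff) auto
  finally show ?thesis by (simp only: AE_M0_iff)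
qed

lemma code_of_N:
  obtains \<iota> :: "'w \<Rightarrow> real" where "(\<lambda>y. (\<iota> (fst y), snd y)) \<in> borel_measurable N"
    "inj_on (\<lambda>y. (\<iota> (fst y), snd y)) (space N)"
proof -
  obtain \<iota> :: "'w \<Rightarrow> real" where \<iota>: "\<iota> \<in> borel_measurable W" "inj_on \<iota> (space W)"
    using standard_borel_code[of W] W unfolding standard_measure_space_def by metis
  show ?thesis
  proof
    note [measurable] = \<iota>(1)
    have "(\<lambda>y. (\<iota> (fst y), snd y)) \<in> measurable N (borel \<Otimes>\<^sub>M borel)" by measurable
    then show "(\<lambda>y. (\<iota> (fst y), snd y)) \<in> borel_measurable N" by (simp add: borel_prod)
    show "inj_on (\<lambda>y. (\<iota> (fst y), snd y)) (space N)"
      using \<iota>(2) by (auto simp: inj_on_def space_pair_measure)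
  qed
qed

lemma \<phi>_in_N: "x \<in> X0 \<Longrightarrow> \<phi> x \<in> space N"
  using measurable_space[OF M0_to_N, of x] by simp

text \<open>The witness consists of the points of \<open>N\<close> whose code is the code of \<open>\<phi> x\<close> for some \<open>x\<close> in one of
  the sets \<open>K n\<close> that exhaust \<open>A \<inter> X0\<close> and have compact images under the coded \<open>\<phi>\<close>; as \<open>\<phi>\<close> is injective, its
  preimage is exactly their union.\<close>

lemma preimage_exhausts:
  assumes A: "A \<in> sets M"
  obtains B where "B \<in> sets N" "AE x in M. x \<in> X0 \<longrightarrow> (\<phi> x \<in> B \<longleftrightarrow> x \<in> A)"
proof -
  obtain \<iota> :: "'w \<Rightarrow> real" where \<iota>[measurable]: "(\<lambda>y. (\<iota> (fst y), snd y)) \<in> borel_measurable N"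
    and inj: "inj_on (\<lambda>y. (\<iota> (fst y), snd y)) (space N)"
    by (rule code_of_N)
  define e :: "'w \<times> 'g \<Rightarrow> real \<times> 'g" where "e = (\<lambda>y. (\<iota> (fst y), snd y))"
  define f where "f x = (if x \<in> X0 then e (\<phi> x) else (0, 0))" for x
  have "(\<lambda>x. e (\<phi> x)) \<in> borel_measurable M0" unfolding e_def by measurable
  then have f: "f \<in> borel_measurable M"
    unfolding f_def using X0_subset
    by (subst measurable_restrict_space_iff[symmetric]) (auto simp: Int_absorb2)
  have AX: "A \<inter> X0 \<in> sets M" using A by simp
  obtain K :: "nat \<Rightarrow> 'x set" where "(\<forall>n. K n \<in> sets M \<and> K n \<subseteq> A \<inter> X0 \<and> compact (f ` K n)) \<and>
      A \<inter> X0 - (\<Union>n. K n) \<in> null_sets M"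
    using lusin_compact_images[OF standard_borel_imp_radon_space[OF standard_borel] sigma_finite_M f AX] ..
  then have K: "\<And>n. K n \<in> sets M" "\<And>n. K n \<subseteq> A \<inter> X0" "\<And>n. compact (f ` K n)"
      "A \<inter> X0 - (\<Union>n. K n) \<in> null_sets M" by simp_all
  define B where "B = e -` (\<Union>n. f ` K n) \<inter> space N"
  have "(\<Union>n. f ` K n) \<in> sets borel"
    using K(3) by (intro sets.countable_UN) (auto simp: borel_closed compact_imp_closed)
  then have "B \<in> sets N" unfolding B_def e_def by (rule measurable_sets[OF \<iota>])
  moreover have "\<phi> x \<in> B \<longleftrightarrow> x \<in> (\<Union>n. K n)" if x: "x \<in> X0" for x
  proof
    assume "\<phi> x \<in> B"
    then obtain n z where z: "z \<in> K n" "e (\<phi> x) = f z" unfolding B_def by auto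
    then have "z \<in> X0" using K(2) by blast
    then have "e (\<phi> x) = e (\<phi> z)" using z(2) by (simp add: f_def)
    then have "\<phi> x = \<phi> z" using inj \<phi>_in_N x \<open>z \<in> X0\<close> unfolding inj_on_def e_def by blast
    then have "x = z" using bij x \<open>z \<in> X0\<close> unfolding bij_betw_def inj_on_def by blast
    then show "x \<in> (\<Union>n. K n)" using z by blast
  next
    assume "x \<in> (\<Union>n. K n)"
    then have "f x \<in> (\<Union>n. f ` K n)" by blast
    then show "\<phi> x \<in> B" unfolding B_def using x \<phi>_in_N by (simp add: f_def)
  qed
  moreover have "AE x in M. x \<in> X0 \<longrightarrow> (x \<in> (\<Union>n. K n) \<longleftrightarrow> x \<in> A)"
    using AE_not_in[OF K(4)] K(2) by (elim eventually_mono) blast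
  ultimately show ?thesis by (intro that[of B]) auto
qed

lemma nn_integral_translate_N:
  assumes [measurable]: "u \<in> borel_measurable N"
  shows "(\<integral>\<^sup>+y. u ((\<lambda>(w, h). (w, g + h)) y) \<partial>N) = (\<integral>\<^sup>+y. u y \<partial>N)"
proof -
  have "(\<integral>\<^sup>+y. u ((\<lambda>(w, h). (w, g + h)) y) \<partial>N) = (\<integral>\<^sup>+w. \<integral>\<^sup>+h. u (w, g + h) \<partial>lam \<partial>W)"
    by (subst nn_integral_fst[symmetric]) auto
  also have "\<dots> = (\<integral>\<^sup>+w. \<integral>\<^sup>+h. u (w, h) \<partial>lam \<partial>W)"
  proof (rule nn_integral_cong)
    fix w assume "w \<in> space W"
    then have "(\<lambda>h. u (w, h)) \<in> borel_measurable lam" by measurable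
    then show "(\<integral>\<^sup>+h. u (w, g + h) \<partial>lam) = (\<integral>\<^sup>+h. u (w, h) \<partial>lam)"
      by (intro nn_integral_left[of "\<lambda>h. u (w, h)"]) simp
  qed
  also have "\<dots> = (\<integral>\<^sup>+y. u y \<partial>N)" by (rule nn_integral_fst) measurable
  finally show ?thesis .
qed

text \<open>If \<open>P\<close> is the image under \<open>\<phi>\<close> of the finite measure \<open>p \<mu>\<close> and \<open>h\<close> its density with respect to \<open>N\<close>,
  then \<open>p / (h \<circ> \<phi>)\<close> is the density of a measure with image \<open>N\<close>. Passing to the finite measure
  \<open>p \<mu>\<close> ensures that \<open>h\<close> is finite almost everywhere.\<close>

lemma pullback_density:
  obtains r :: "'x \<Rightarrow> real" where "r \<in> borel_measurable M" "\<And>x. 0 < r x"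
    "\<And>u :: 'w \<times> 'g \<Rightarrow> ennreal. u \<in> borel_measurable N \<Longrightarrow> (\<integral>\<^sup>+x. u (\<phi> x) * ennreal (r x) \<partial>M0) = (\<integral>\<^sup>+y. u y \<partial>N)"
proof -
  obtain p :: "'x \<Rightarrow> real" where p[measurable]: "p \<in> borel_measurable M" and pos: "\<And>x. 0 < p x"
    and pint: "integrable M p"
    by (rule sigma_finite_equivalent_finite_density[OF sigma_finite_M]) blast
  have [measurable]: "p \<in> borel_measurable M0" by (intro measurable_restrict_space1 p)
  define P where "P = distr (density M0 p) N \<phi>"
  have [measurable]: "\<phi> \<in> measurable (density M0 p) N" by simp
  have P_int: "(\<integral>\<^sup>+y. u y \<partial>P) = (\<integral>\<^sup>+x. ennreal (p x) * u (\<phi> x) \<partial>M0)" if [measurable]: "u \<in> borel_measurable N" for u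
    unfolding P_def by (subst nn_integral_distr) (auto simp: nn_integral_density)
  have AE_P: "(AE y in N. Q y) \<longleftrightarrow> (AE y in P. Q y)" if "{y \<in> space N. Q y} \<in> sets N" for Q
  proof -
    have "(AE y in P. Q y) \<longleftrightarrow> (AE x in density M0 p. Q (\<phi> x))"
      unfolding P_def using that by (intro AE_distr_iff) auto
    also have "\<dots> \<longleftrightarrow> (AE x in M0. Q (\<phi> x))" using pos by (subst AE_density) auto
    finally show ?thesis using AE_N_iff[OF that] by (simp add: AE_M0_iff)
  qed
  have [simp]: "sets P = sets N" "space P = space N" by (simp_all add: P_def)
  have "absolutely_continuous N P"
    unfolding absolutely_continuous_def
  proof
    fix B assume "B \<in> null_sets N"
    moreover have "{y \<in> space N. y \<notin> B} \<in> sets N"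
      using sets.compl_sets[OF null_setsD2[OF \<open>B \<in> null_sets N\<close>]] by (simp only: set_diff_eq)
    ultimately show "B \<in> null_sets P" using AE_P[of "\<lambda>y. y \<notin> B"] AE_iff_null_sets[of B N] AE_iff_null_sets[of B P] by auto
  qed
  then obtain h where h[measurable]: "h \<in> borel_measurable N" and dens: "density N h = P"
    using WG.Radon_Nikodym[of P] by auto
  have "AE y in N. h y \<noteq> \<infinity>"
  proof (rule nn_integral_noteq_infinite)
    have "(\<integral>\<^sup>+y. h y \<partial>N) = (\<integral>\<^sup>+y. 1 \<partial>P)"
      unfolding dens[symmetric] by (subst nn_integral_density) auto
    also have "\<dots> = (\<integral>\<^sup>+x. ennreal (p x) \<partial>M0)" by (subst P_int) auto
    also have "\<dots> \<le> (\<integral>\<^sup>+x. ennreal (p x) \<partial>M)"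
      by (subst nn_integral_restrict_space) (auto intro!: nn_integral_mono simp: indicator_def)
    finally have "(\<integral>\<^sup>+y. h y \<partial>N) \<le> (\<integral>\<^sup>+x. ennreal (p x) \<partial>M)" .
    moreover have "(\<integral>\<^sup>+x. ennreal (p x) \<partial>M) \<noteq> \<infinity>"
      using integrableD(2)[OF pint] pos by (simp add: less_imp_le)
    ultimately show "(\<integral>\<^sup>+y. h y \<partial>N) \<noteq> \<infinity>" by (simp add: neq_top_trans)
  qed measurable
  moreover have "AE y in N. h y \<noteq> 0"
  proof -
    have "AE y in P. h y \<noteq> 0"
      unfolding dens[symmetric] by (subst AE_density) auto
    moreover have "{y \<in> space N. h y \<noteq> 0} \<in> sets N" by measurable
    ultimately show ?thesis by (simp only: AE_P)
  qed
  ultimately have good: "AE y in N. 0 < h y \<and> h y < \<infinity>"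
    by eventually_elim (auto simp: zero_less_iff_neq_zero less_top)
  then have good0: "AE x in M0. 0 < h (\<phi> x) \<and> h (\<phi> x) < \<infinity>"
    unfolding AE_M0_iff by (subst (asm) AE_N_iff) measurable
  (* The default value \<open>1\<close> makes \<open>r\<close> positive everywhere; it is taken on a null set only. *)
  define r where "r x = (if x \<in> X0 \<and> 0 < h (\<phi> x) \<and> h (\<phi> x) < \<infinity> then p x / enn2real (h (\<phi> x)) else 1)" for x
  show ?thesis
  proof
    show "0 < r x" for x
      unfolding r_def using pos[of x] by (auto simp: enn2real_positive_iff intro!: divide_pos_pos)
    have "(\<lambda>x. if 0 < h (\<phi> x) \<and> h (\<phi> x) < \<infinity> then p x / enn2real (h (\<phi> x)) else 1) \<in> borel_measurable M0"
      by measurable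
    then have "(\<lambda>x. if x \<in> X0 then (if 0 < h (\<phi> x) \<and> h (\<phi> x) < \<infinity> then p x / enn2real (h (\<phi> x)) else 1) else 1)
        \<in> borel_measurable M"
      using X0_subset by (subst measurable_restrict_space_iff[symmetric]) (auto simp: Int_absorb2)
    moreover have "r = (\<lambda>x. if x \<in> X0 then (if 0 < h (\<phi> x) \<and> h (\<phi> x) < \<infinity> then p x / enn2real (h (\<phi> x)) else 1) else 1)"
      by (auto simp: r_def)
    ultimately show "r \<in> borel_measurable M" by simp
    fix u :: "'w \<times> 'g \<Rightarrow> ennreal" assume u[measurable]: "u \<in> borel_measurable N"
    have "(\<integral>\<^sup>+x. u (\<phi> x) * ennreal (r x) \<partial>M0) = (\<integral>\<^sup>+x. ennreal (p x) * (u (\<phi> x) / h (\<phi> x)) \<partial>M0)"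
    proof (rule nn_integral_cong_AE)
      show "AE x in M0. u (\<phi> x) * ennreal (r x) = ennreal (p x) * (u (\<phi> x) / h (\<phi> x))"
        using good0
      proof (rule AE_mp, intro AE_I2 impI)
        fix x assume x: "x \<in> space M0" and hx: "0 < h (\<phi> x) \<and> h (\<phi> x) < \<infinity>"
        then obtain t where t: "h (\<phi> x) = ennreal t" "0 < t"
          by (cases "h (\<phi> x)") auto
        then have "ennreal (r x) = ennreal (p x) / h (\<phi> x)"
          using x hx pos[of x] by (simp add: r_def divide_ennreal)
        then show "u (\<phi> x) * ennreal (r x) = ennreal (p x) * (u (\<phi> x) / h (\<phi> x))"
          by (simp add: divide_ennreal_def ac_simps)
      qed
    qed
    also have "\<dots> = (\<integral>\<^sup>+y. u y / h y \<partial>P)" by (subst P_int) auto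
    also have "\<dots> = (\<integral>\<^sup>+y. h y * (u y / h y) \<partial>N)"
      unfolding dens[symmetric] by (subst nn_integral_density) auto
    also have "\<dots> = (\<integral>\<^sup>+y. u y \<partial>N)"
    proof (rule nn_integral_cong_AE)
      show "AE y in N. h y * (u y / h y) = u y"
        using good by eventually_elim (auto simp: ennreal_times_divide mult.commute[of "h _"] ennreal_mult_divide_eq)
    qed
    finally show "(\<integral>\<^sup>+x. u (\<phi> x) * ennreal (r x) \<partial>M0) = (\<integral>\<^sup>+y. u y \<partial>N)" .
  qed
qed

lemma nn_integral_M0: "(\<integral>\<^sup>+x. f x \<partial>M0) = (\<integral>\<^sup>+x. f x \<partial>M)"
proof -
  have "(\<integral>\<^sup>+x. f x \<partial>M0) = (\<integral>\<^sup>+x. f x * indicator X0 x \<partial>M)"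
    by (rule nn_integral_restrict_space) simp
  also have "\<dots> = (\<integral>\<^sup>+x. f x \<partial>M)"
    by (rule nn_integral_cong_AE) (use AE_in_X0 in eventually_elim, simp)
  finally show ?thesis .
qed

text \<open>The pulled back measure is determined by its values on preimages of subsets of \<open>N\<close>, and on these its
  invariance is the left invariance of Haar measure.\<close>

lemma invariant_density:
  obtains r :: "'x \<Rightarrow> real" where "r \<in> borel_measurable M" "\<And>x. 0 < r x"
    "\<And>g (u :: 'x \<Rightarrow> ennreal). u \<in> borel_measurable M \<Longrightarrow>
      (\<integral>\<^sup>+x. u (a g x) * ennreal (r x) \<partial>M) = (\<integral>\<^sup>+x. u x * ennreal (r x) \<partial>M)"
proof -
  obtain r :: "'x \<Rightarrow> real" where r[measurable]: "r \<in> borel_measurable M" and pos: "\<And>x. 0 < r x"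
    and transport: "\<And>u :: 'w \<times> 'g \<Rightarrow> ennreal. u \<in> borel_measurable N \<Longrightarrow>
      (\<integral>\<^sup>+x. u (\<phi> x) * ennreal (r x) \<partial>M0) = (\<integral>\<^sup>+y. u y \<partial>N)"
    by (rule pullback_density) blast
  define \<nu> where "\<nu> = density M r"
  have [simp, measurable_cong]: "sets \<nu> = sets M" and [simp]: "space \<nu> = space M" by (simp_all add: \<nu>_def)
  have inv: "distr \<nu> M (a g) = \<nu>" for g
  proof (rule measure_eqI)
    fix A assume "A \<in> sets (distr \<nu> M (a g))"
    then have A[measurable]: "A \<in> sets M" by simp
    obtain B where B[measurable]: "B \<in> sets N" and AB: "AE x in M. x \<in> X0 \<longrightarrow> (\<phi> x \<in> B \<longleftrightarrow> x \<in> A)"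
      by (rule preimage_exhausts[OF A])
    have [measurable]: "a g \<in> measurable M M" "a g \<in> measurable \<nu> M" by measurable
    have gA: "a g -` A \<inter> space M \<in> sets M" by measurable
    have "emeasure (distr \<nu> M (a g)) A = emeasure \<nu> (a g -` A \<inter> space M)"
      by (subst emeasure_distr) auto
    also have "\<dots> = (\<integral>\<^sup>+x. ennreal (r x) * indicator (a g -` A \<inter> space M) x \<partial>M)"
      unfolding \<nu>_def using gA by (subst emeasure_density) auto
    also have "\<dots> = (\<integral>\<^sup>+x. ennreal (r x) * indicator (a g -` A \<inter> space M) x \<partial>M0)"
      by (rule nn_integral_M0[symmetric])
    also have "\<dots> = (\<integral>\<^sup>+x. indicator B ((\<lambda>(w, h). (w, g + h)) (\<phi> x)) * ennreal (r x) \<partial>M0)"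
    proof (rule nn_integral_cong_AE)
      have "AE x in M0. \<phi> (a g x) \<in> B \<longleftrightarrow> a g x \<in> A"
        unfolding AE_M0_iff using AE_action_imp[OF AB, of g] 
        by eventually_elim (use invariant_setD[OF X0_invariant] in blast)
      then show "AE x in M0. ennreal (r x) * indicator (a g -` A \<inter> space M) x =
          indicator B ((\<lambda>(w, h). (w, g + h)) (\<phi> x)) * ennreal (r x)"
        using \<phi>_equivariant[of g] AE_space[of M0]
      proof eventually_elim
        case (elim x)
        then have "x \<in> space M" using X0_subset by auto
        with elim show ?case by (simp add: indicator_def)
      qed
    qed
    also have "\<dots> = (\<integral>\<^sup>+y. indicator B ((\<lambda>(w, h). (w, g + h)) y) \<partial>N)"
      by (rule transport) measurable
    also have "\<dots> = (\<integral>\<^sup>+y. indicator B y \<partial>N)"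
      by (rule nn_integral_translate_N) measurable
    also have "\<dots> = (\<integral>\<^sup>+x. indicator B (\<phi> x) * ennreal (r x) \<partial>M0)"
      by (rule transport[symmetric]) measurable
    also have "\<dots> = (\<integral>\<^sup>+x. ennreal (r x) * indicator A x \<partial>M0)"
    proof (rule nn_integral_cong_AE)
      show "AE x in M0. indicator B (\<phi> x) * ennreal (r x) = ennreal (r x) * indicator A x"
        unfolding AE_M0_iff using AB by eventually_elim (auto simp: indicator_def)
    qed
    also have "\<dots> = (\<integral>\<^sup>+x. ennreal (r x) * indicator A x \<partial>M)" by (rule nn_integral_M0)
    also have "\<dots> = emeasure \<nu> A" unfolding \<nu>_def by (subst emeasure_density) auto
    finally show "emeasure (distr \<nu> M (a g)) A = emeasure \<nu> A" .
  qed simp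
  show ?thesis
  proof (rule that[OF r pos])
    fix g and u :: "'x \<Rightarrow> ennreal" assume u[measurable]: "u \<in> borel_measurable M"
    have [measurable]: "a g \<in> measurable M M" "a g \<in> measurable \<nu> M" by measurable
    have int: "(\<integral>\<^sup>+x. v x * ennreal (r x) \<partial>M) = (\<integral>\<^sup>+x. v x \<partial>\<nu>)" if [measurable]: "v \<in> borel_measurable M" for v
      unfolding \<nu>_def by (subst nn_integral_density) (auto simp: mult.commute)
    have "(\<integral>\<^sup>+x. u (a g x) * ennreal (r x) \<partial>M) = (\<integral>\<^sup>+x. u (a g x) \<partial>\<nu>)"
      by (rule int) measurable
    also have "\<dots> = (\<integral>\<^sup>+x. u x \<partial>distr \<nu> M (a g))" by (subst nn_integral_distr) auto
    also have "\<dots> = (\<integral>\<^sup>+x. u x * ennreal (r x) \<partial>M)" unfolding inv by (rule int[symmetric]) measurable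
    finally show "(\<integral>\<^sup>+x. u (a g x) * ennreal (r x) \<partial>M) = (\<integral>\<^sup>+x. u x * ennreal (r x) \<partial>M)" .
  qed
qed

text \<open>Integrating over the points with group coordinate in \<open>K n\<close> and substituting \<open>- g\<close> for \<open>g\<close> by
  invariance turns the double integral into one of \<open>q(x)\<close> against the Haar measure of the set of all
  \<open>g\<close> for which the coordinate of \<open>(- g).x\<close> lies in \<open>K n\<close>; by equivariance this measure is a finite
  constant.\<close>

lemma orbit_integral_finite:
  fixes q :: "'x \<Rightarrow> ennreal"
  assumes r[measurable]: "r \<in> borel_measurable M" and pos: "\<And>x. 0 < r x"
    and inv: "\<And>g (u :: 'x \<Rightarrow> ennreal). u \<in> borel_measurable M \<Longrightarrow>
      (\<integral>\<^sup>+x. u (a g x) * ennreal (r x) \<partial>M) = (\<integral>\<^sup>+x. u x * ennreal (r x) \<partial>M)"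
    and q[measurable]: "q \<in> borel_measurable M" and q_int: "(\<integral>\<^sup>+x. q x * ennreal (r x) \<partial>M) \<noteq> \<infinity>"
  shows "AE x in M. (\<integral>\<^sup>+g. q (a g x) \<partial>lam) \<noteq> \<infinity>"
proof -
  define k where "k x = (if x \<in> X0 then snd (\<phi> x) else 0)" for x
  have "(\<lambda>x. snd (\<phi> x)) \<in> measurable M0 lam"
    by (rule measurable_compose[OF M0_to_N measurable_snd])
  then have "(\<lambda>x. snd (\<phi> x)) \<in> borel_measurable M0"
    by (simp only: measurable_cong_sets[OF refl sets_lam])
  then have k[measurable]: "k \<in> borel_measurable M"
    unfolding k_def using X0_subset by (subst measurable_restrict_space_iff[symmetric]) (auto simp: Int_absorb2)
  have "AE x in M. x \<in> X0 \<longrightarrow> k (a (- g) x) = - g + k x" for g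
    using \<phi>_equivariant[of "- g"] unfolding AE_M0_iff
    by eventually_elim (auto simp: k_def invariant_setD[OF X0_invariant] split: prod.split)
  then have "AE g in lam. AE x in M. x \<in> X0 \<longrightarrow> k (a (- g) x) = - g + k x" by simp
  then have "AE x in M. AE g in lam. x \<in> X0 \<longrightarrow> k (a (- g) x) = - g + k x"
    by (subst (asm) GM.AE_commute) measurable
  then have equi: "AE x in M. AE g in lam. k (a (- g) x) = - g + k x"
    using AE_in_X0 by eventually_elim simp
  obtain K :: "nat \<Rightarrow> 'g set" where K: "\<And>n. compact (K n)" "incseq K" "(\<Union>n. K n) = UNIV"
    using compact_exhaustion by blast
  have "AE x in M. k x \<in> K n \<longrightarrow> (\<integral>\<^sup>+g. q (a g x) \<partial>lam) \<noteq> \<infinity>" for n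
  proof -
    have [measurable]: "K n \<in> sets borel" using K(1) by (simp add: borel_closed compact_imp_closed)
    define c where "c = emeasure lam (uminus ` K n)"
    have "(\<integral>\<^sup>+x. (\<integral>\<^sup>+g. q (a g x) \<partial>lam) * indicator (K n) (k x) * ennreal (r x) \<partial>M)
        = (\<integral>\<^sup>+x. (\<integral>\<^sup>+g. q (a g x) * indicator (K n) (k x) * ennreal (r x) \<partial>lam) \<partial>M)"
      by (intro nn_integral_cong) (simp add: nn_integral_multc mult.assoc)
    also have "\<dots> = (\<integral>\<^sup>+g. (\<integral>\<^sup>+x. q (a g x) * indicator (K n) (k x) * ennreal (r x) \<partial>M) \<partial>lam)"
      by (rule GM.Fubini') measurable
    also have "\<dots> = (\<integral>\<^sup>+g. (\<integral>\<^sup>+x. q x * indicator (K n) (k (a (- g) x)) * ennreal (r x) \<partial>M) \<partial>lam)"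
    proof (rule nn_integral_cong)
      fix g
      have "(\<integral>\<^sup>+x. q (a g x) * indicator (K n) (k x) * ennreal (r x) \<partial>M)
          = (\<integral>\<^sup>+x. (q (a g x) * indicator (K n) (k (a (- g) (a g x)))) * ennreal (r x) \<partial>M)"
        by (intro nn_integral_cong) simp
      also have "\<dots> = (\<integral>\<^sup>+x. q x * indicator (K n) (k (a (- g) x)) * ennreal (r x) \<partial>M)"
        by (rule inv[of "\<lambda>x. q x * indicator (K n) (k (a (- g) x))"]) measurable
      finally show "(\<integral>\<^sup>+x. q (a g x) * indicator (K n) (k x) * ennreal (r x) \<partial>M) = \<dots>" .
    qed
    also have "\<dots> = (\<integral>\<^sup>+x. (\<integral>\<^sup>+g. q x * indicator (K n) (k (a (- g) x)) * ennreal (r x) \<partial>lam) \<partial>M)"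
      by (rule GM.Fubini'[symmetric]) measurable
    also have "\<dots> = (\<integral>\<^sup>+x. c * (q x * ennreal (r x)) \<partial>M)"
    proof (rule nn_integral_cong_AE)
      show "AE x in M. (\<integral>\<^sup>+g. q x * indicator (K n) (k (a (- g) x)) * ennreal (r x) \<partial>lam) = c * (q x * ennreal (r x))"
        using equi
      proof (rule AE_mp, intro AE_I2 impI)
        fix x assume x: "x \<in> space M" and eq: "AE g in lam. k (a (- g) x) = - g + k x"
        have "(\<integral>\<^sup>+g. q x * indicator (K n) (k (a (- g) x)) * ennreal (r x) \<partial>lam)
            = (\<integral>\<^sup>+g. (q x * ennreal (r x)) * indicator {g. - g + k x \<in> K n} g \<partial>lam)"
          by (rule nn_integral_cong_AE) (use eq in \<open>eventually_elim, simp add: indicator_def\<close>)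
        also have "\<dots> = (q x * ennreal (r x)) * emeasure lam {g. - g + k x \<in> K n}"
          by (rule nn_integral_cmult_indicator) measurable
        also have "\<dots> = c * (q x * ennreal (r x))"
          unfolding c_def compact_reflect_finite(1)[OF K(1)] by (rule mult.commute)
        finally show "(\<integral>\<^sup>+g. q x * indicator (K n) (k (a (- g) x)) * ennreal (r x) \<partial>lam) = c * (q x * ennreal (r x))" .
      qed
    qed
    also have "\<dots> = c * (\<integral>\<^sup>+x. q x * ennreal (r x) \<partial>M)" by (rule nn_integral_cmult) measurable
    finally have eq: "(\<integral>\<^sup>+x. (\<integral>\<^sup>+g. q (a g x) \<partial>lam) * indicator (K n) (k x) * ennreal (r x) \<partial>M)
        = c * (\<integral>\<^sup>+x. q x * ennreal (r x) \<partial>M)" .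
    have "c \<noteq> \<infinity>" using compact_reflect_finite(2)[OF K(1)[of n]] unfolding c_def by simp
    then have "c * (\<integral>\<^sup>+x. q x * ennreal (r x) \<partial>M) \<noteq> \<infinity>" using q_int by (simp add: ennreal_mult_eq_top_iff)
    then have "AE x in M. (\<integral>\<^sup>+g. q (a g x) \<partial>lam) * indicator (K n) (k x) * ennreal (r x) \<noteq> \<infinity>"
      unfolding eq[symmetric] by (intro nn_integral_noteq_infinite) measurable
    then show ?thesis
    proof eventually_elim
      case (elim x)
      show ?case
      proof (intro impI notI)
        assume "k x \<in> K n" "(\<integral>\<^sup>+g. q (a g x) \<partial>lam) = \<infinity>"
        then show False using elim pos[of x] by (simp add: ennreal_top_mult)
      qed
    qed
  qed
  then have "AE x in M. \<forall>n. k x \<in> K n \<longrightarrow> (\<integral>\<^sup>+g. q (a g x) \<partial>lam) \<noteq> \<infinity>"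
    by (subst AE_all_countable) blast
  then show ?thesis
  proof eventually_elim
    case (elim x)
    have "k x \<in> (\<Union>n. K n)" using K(3) by simp
    then show ?case using elim by blast
  qed
qed

lemma totally_dissipative: "totally_dissipative lam M a"
proof -
  obtain r :: "'x \<Rightarrow> real" where r[measurable]: "r \<in> borel_measurable M" and pos: "\<And>x. 0 < r x"
    and inv: "\<And>g (u :: 'x \<Rightarrow> ennreal). u \<in> borel_measurable M \<Longrightarrow>
      (\<integral>\<^sup>+x. u (a g x) * ennreal (r x) \<partial>M) = (\<integral>\<^sup>+x. u x * ennreal (r x) \<partial>M)"
    by (rule invariant_density) blast
  define \<Delta> where "\<Delta> = (\<lambda>g x. r x / r (a g x))"
  have coc: "radon_nikodym_cocycle M a \<Delta>"
    unfolding \<Delta>_def using r pos inv by (rule cocycle_of_invariant_density)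
  have fin: "AE x in M. S_fun lam a \<Delta> f x \<noteq> \<infinity>" if f: "f \<in> L1_plus M" for f
  proof -
    have fint: "integrable M f" and fpos: "\<And>x. x \<in> space M \<Longrightarrow> 0 < f x" using f by (auto simp: L1_plus_def)
    have [measurable]: "f \<in> borel_measurable M" using fint by (rule borel_measurable_integrable)
    define q where "q x = ennreal (f x / r x)" for x
    have [measurable]: "q \<in> borel_measurable M" unfolding q_def by measurable
    have "(\<integral>\<^sup>+x. q x * ennreal (r x) \<partial>M) = (\<integral>\<^sup>+x. ennreal (f x) \<partial>M)"
    proof (rule nn_integral_cong)
      fix x assume "x \<in> space M"
      then show "q x * ennreal (r x) = ennreal (f x)"
        unfolding q_def using fpos[of x] pos[of x] by (subst ennreal_mult[symmetric]) auto
    qed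
    also have "\<dots> \<noteq> \<infinity>" using integrableD(2)[OF fint] by simp
    finally have "AE x in M. (\<integral>\<^sup>+g. q (a g x) \<partial>lam) \<noteq> \<infinity>"
      by (intro orbit_integral_finite[OF r pos inv]) auto
    then show ?thesis
      using AE_space[of M]
    proof eventually_elim
      case (elim x)
      have "S_fun lam a \<Delta> f x = (\<integral>\<^sup>+g. ennreal (r x) * q (a g x) \<partial>lam)"
        unfolding S_fun_def
      proof (rule nn_integral_cong)
        fix g
        have "0 \<le> f (a g x)" using fpos[of "a g x"] elim by simp
        then show "ennreal (\<Delta> g x * f (a g x)) = ennreal (r x) * q (a g x)"
          unfolding q_def \<Delta>_def using pos[of x] pos[of "a g x"]
          by (subst ennreal_mult[symmetric]) auto
      qed
      also have "\<dots> = ennreal (r x) * (\<integral>\<^sup>+g. q (a g x) \<partial>lam)"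
        using elim by (intro nn_integral_cmult) measurable
      finally show ?case using elim by (simp add: ennreal_mult_eq_top_iff)
    qed
  qed
  have "hopf_decomposition lam M a \<Delta> {} (space M)"
    unfolding hopf_decomposition_def
  proof (intro conjI ballI)
    fix f assume f: "f \<in> L1_plus M"
    show "AE x in M. x \<in> {} \<longleftrightarrow> S_fun lam a \<Delta> f x = \<infinity>" using fin[OF f] by simp
    show "AE x in M. x \<in> space M \<longleftrightarrow> S_fun lam a \<Delta> f x < \<infinity>"
      using fin[OF f] AE_space by eventually_elim (simp add: top.not_eq_extremum)
  qed (auto intro!: invariant_setI)
  with coc show ?thesis unfolding totally_dissipative_def 
    by - (rule exI[of _ \<Delta>], rule exI[of _ "{}"], rule exI[of _ "space M"], simp)
qed

end

section \<open>A complete orbit invariant of a dissipative action\<close>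

text \<open>Rational half-lines suffice, so that countably many values determine a measure on the line.\<close>

lemma finite_measure_eqI_rational_atMost:
  fixes P Q :: "real measure"
  assumes "finite_measure P" and sets: "sets P = sets borel" "sets Q = sets borel"
    and eq: "\<And>r :: rat. emeasure P {..of_rat r} = emeasure Q {..of_rat r}"
  shows "P = Q"
proof -
  interpret P: finite_measure P by fact
  define E :: "real set set" where "E = range (\<lambda>r :: rat. {..of_rat r})"
  have gen: "sigma_sets UNIV E = sets borel"
  proof
    interpret E: sigma_algebra UNIV "sigma_sets UNIV E" by (rule sigma_algebra_sigma_sets) simp
    have "{..x} \<in> sigma_sets UNIV E" for x :: real
    proof -
      have "{..x} = (\<Inter>r\<in>{r :: rat. x < of_rat r}. {..of_rat r})"
      proof
        show "(\<Inter>r\<in>{r :: rat. x < of_rat r}. {..of_rat r}) \<subseteq> {..x}"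
        proof
          fix y assume y: "y \<in> (\<Inter>r\<in>{r :: rat. x < of_rat r}. {..real_of_rat r})"
          show "y \<in> {..x}"
          proof (rule ccontr)
            assume "y \<notin> {..x}"
            then obtain r where "x < of_rat r" "of_rat r < y" using of_rat_dense[of x y] by auto
            then show False using y by auto
          qed
        qed
      qed auto
      also have "\<dots> \<in> sigma_sets UNIV E"
        by (rule E.countable_INT'') (auto simp: E_def intro: sigma_sets_top)
      finally show ?thesis .
    qed
    then have "sigma_sets UNIV (range (\<lambda>a::real. {..a})) \<subseteq> sigma_sets UNIV E"
      by (intro E.sigma_sets_subset) auto
    then show "sets borel \<subseteq> sigma_sets UNIV E" by (simp add: borel_eq_atMost)
    show "sigma_sets UNIV E \<subseteq> sets borel"
    proof -
      have "E \<subseteq> sets borel" by (auto simp: E_def)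
      from sets.sigma_sets_subset[OF this] show ?thesis by simp
    qed
  qed
  show ?thesis
  proof (rule measure_eqI_generator_eq[where E = E and \<Omega> = UNIV and A = "\<lambda>n::nat. {..of_rat (of_nat n)}"])
    show "Int_stable E"
    proof (rule Int_stableI)
      fix A B assume "A \<in> E" "B \<in> E"
      then obtain r s where "A = {..real_of_rat r}" "B = {..real_of_rat s}" by (auto simp: E_def)
      then have "A \<inter> B = {..of_rat (min r s)}" by (auto simp: min_def of_rat_less_eq)
      then show "A \<inter> B \<in> E" by (auto simp: E_def)
    qed
    show "(\<Union>n. {..real_of_rat (of_nat n)}) = UNIV"
      using real_arch_simple by (auto simp: of_rat_of_nat_eq)
    show "range (\<lambda>n::nat. {..real_of_rat (of_nat n)}) \<subseteq> E" unfolding E_def by blast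
    show "emeasure P X = emeasure Q X" if "X \<in> E" for X using that eq by (auto simp: E_def)
  qed (simp_all add: gen sets)
qed

locale cocycle_action = nonsingular_action lam M a
  for lam :: "'g::{topological_group_add, t2_space, second_countable_topology} measure"
    and M :: "'x measure" and a :: "'g \<Rightarrow> 'x \<Rightarrow> 'x" +
  fixes \<Delta> :: "'g \<Rightarrow> 'x \<Rightarrow> real" and f :: "'x \<Rightarrow> real"
  assumes cocycle: "radon_nikodym_cocycle M a \<Delta>" and f_L1_plus: "f \<in> L1_plus M"
begin

lemma measurable_cocycle[measurable (raw)]:
  assumes "u \<in> borel_measurable N" "s \<in> measurable N M"
  shows "(\<lambda>x. \<Delta> (u x) (s x)) \<in> borel_measurable N"
proof -
  have "(\<lambda>(g, x). \<Delta> g x) \<in> borel_measurable (borel \<Otimes>\<^sub>M M)"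
    using cocycle by (simp add: radon_nikodym_cocycle_def)
  from measurable_compose[OF measurable_Pair[OF assms] this] show ?thesis by simp
qed

lemma cocycle_pos: "x \<in> space M \<Longrightarrow> 0 < \<Delta> g x"
  using cocycle by (simp add: radon_nikodym_cocycle_def)

lemma cocycle_add: "x \<in> space M \<Longrightarrow> \<Delta> (g + h) x = \<Delta> g (a h x) * \<Delta> h x"
  using cocycle by (simp add: radon_nikodym_cocycle_def)

lemma f_pos: "x \<in> space M \<Longrightarrow> 0 < f x"
  using f_L1_plus by (simp add: L1_plus_def)

lemma f_measurable[measurable]: "f \<in> borel_measurable M"
  using f_L1_plus by (simp add: L1_plus_def borel_measurable_integrable)

text \<open>The mass of \<open>A\<close> under the measure with density \<open>\<Delta> g x * f (a g x)\<close>, pushed to the orbit of \<open>x\<close>.\<close>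

definition orbit_weight :: "'x set \<Rightarrow> 'x \<Rightarrow> ennreal" where
  "orbit_weight A x = (\<integral>\<^sup>+g. ennreal (\<Delta> g x * f (a g x)) * indicator A (a g x) \<partial>lam)"

lemma orbit_weight_space: "x \<in> space M \<Longrightarrow> orbit_weight (space M) x = S_fun lam a \<Delta> f x"
  unfolding orbit_weight_def S_fun_def by (intro nn_integral_cong) simp

lemma orbit_weight_measurable[measurable]:
  assumes [measurable]: "A \<in> sets M" shows "orbit_weight A \<in> borel_measurable M"
  unfolding orbit_weight_def by measurable

lemma orbit_weight_mono: "A \<subseteq> B \<Longrightarrow> orbit_weight A x \<le> orbit_weight B x"
  unfolding orbit_weight_def by (intro nn_integral_mono mult_left_mono) (auto simp: indicator_def)

lemma orbit_weight_pos: "x \<in> space M \<Longrightarrow> orbit_weight (space M) x \<noteq> 0"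
proof
  assume x: "x \<in> space M" and "orbit_weight (space M) x = 0"
  moreover have "(\<lambda>g. ennreal (\<Delta> g x * f (a g x)) * indicator (space M) (a g x)) \<in> borel_measurable lam"
    using x by measurable
  ultimately have "AE g in lam. ennreal (\<Delta> g x * f (a g x)) * indicator (space M) (a g x) = 0"
    unfolding orbit_weight_def by (simp add: nn_integral_0_iff_AE)
  then obtain g where "ennreal (\<Delta> g x * f (a g x)) * indicator (space M) (a g x) = 0" using AE_lam_ex by blast
  then show False using x cocycle_pos[of x g] f_pos[of "a g x"] mult_pos_pos[of "\<Delta> g x" "f (a g x)"] by simp
qed

text \<open>Moving the base point along the orbit multiplies all weights by the same constant: the
  cocycle identity turns the integrand into a right translate, and the lemma \<open>right_scaling\<close> applies.\<close>

lemma orbit_weight_shift: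
  assumes x: "x \<in> space M"
  obtains t where "t \<noteq> 0" "t \<noteq> \<infinity>" "\<And>A. A \<in> sets M \<Longrightarrow> orbit_weight A (a h x) = t * orbit_weight A x"
proof -
  obtain c where c: "c \<noteq> 0" "c \<noteq> \<infinity>"
    "\<And>u :: 'g \<Rightarrow> ennreal. u \<in> borel_measurable borel \<Longrightarrow> (\<integral>\<^sup>+g. u (g + h) \<partial>lam) = c * (\<integral>\<^sup>+g. u g \<partial>lam)"
    by (rule right_scaling[of h]) blast
  have pos: "0 < \<Delta> h x" using x by (rule cocycle_pos)
  show ?thesis
  proof (rule that[of "ennreal (1 / \<Delta> h x) * c"])
    show "ennreal (1 / \<Delta> h x) * c \<noteq> 0" "ennreal (1 / \<Delta> h x) * c \<noteq> \<infinity>"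
      using pos c by (auto simp: ennreal_mult_eq_top_iff)
    fix A assume A[measurable]: "A \<in> sets M"
    define u where "u g = ennreal (\<Delta> g x * f (a g x)) * indicator A (a g x)" for g
    have u[measurable]: "u \<in> borel_measurable borel" unfolding u_def using x by measurable
    have "orbit_weight A (a h x) = (\<integral>\<^sup>+g. ennreal (1 / \<Delta> h x) * u (g + h) \<partial>lam)"
      unfolding orbit_weight_def
    proof (rule nn_integral_cong)
      fix g
      have "\<Delta> g (a h x) * f (a g (a h x)) = 1 / \<Delta> h x * (\<Delta> (g + h) x * f (a (g + h) x))"
        using x pos by (simp add: cocycle_add action_add)
      moreover have "0 \<le> \<Delta> (g + h) x * f (a (g + h) x)"
        using x cocycle_pos[of x "g + h"] f_pos[of "a (g + h) x"] by simp
      ultimately have "ennreal (\<Delta> g (a h x) * f (a g (a h x)))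
          = ennreal (1 / \<Delta> h x) * ennreal (\<Delta> (g + h) x * f (a (g + h) x))"
        using pos by (simp only: ennreal_mult zero_le_divide_1_iff less_imp_le)
      then show "ennreal (\<Delta> g (a h x) * f (a g (a h x))) * indicator A (a g (a h x)) = ennreal (1 / \<Delta> h x) * u (g + h)"
        unfolding u_def using x by (simp only: action_add mult.assoc)
    qed
    also have "\<dots> = ennreal (1 / \<Delta> h x) * (\<integral>\<^sup>+g. u (g + h) \<partial>lam)"
      by (rule nn_integral_cmult) measurable
    also have "(\<integral>\<^sup>+g. u (g + h) \<partial>lam) = c * orbit_weight A x"
      unfolding orbit_weight_def u_def[symmetric] by (rule c(3)[OF u])
    finally show "orbit_weight A (a h x) = ennreal (1 / \<Delta> h x) * c * orbit_weight A x" by (simp add: mult.assoc)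
  qed
qed

lemma orbit_weight_finite_invariant: "x \<in> space M \<Longrightarrow> orbit_weight (space M) x \<noteq> \<infinity> \<Longrightarrow> orbit_weight (space M) (a h x) \<noteq> \<infinity>"
proof -
  assume x: "x \<in> space M" and fin: "orbit_weight (space M) x \<noteq> \<infinity>"
  obtain t where "t \<noteq> \<infinity>" "\<And>A. A \<in> sets M \<Longrightarrow> orbit_weight A (a h x) = t * orbit_weight A x" using orbit_weight_shift[OF x, of h] by metis
  then show ?thesis using fin by (simp add: ennreal_mult_eq_top_iff)
qed

lemma radon_lam: "radon_space lam"
  by (rule locally_compact_imp_radon_space[OF locally_compact sets_lam])

text \<open>The orbit of \<open>x\<close> contains a Borel set that carries the whole orbit measure of \<open>x\<close>, by the lemma
  \<open>lusin_compact_images\<close> applied to the orbit map. If the orbit measures of \<open>x\<close> and \<open>y\<close> are proportional, this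
  set is not null for the orbit measure of \<open>y\<close> either, and the two orbits meet.\<close>

lemma orbit_separation:
  fixes \<iota> :: "'x \<Rightarrow> real"
  assumes \<iota>[measurable]: "\<iota> \<in> borel_measurable M" and inj: "inj_on \<iota> (space M)"
    and x: "x \<in> space M" "orbit_weight (space M) x \<noteq> \<infinity>" and y: "y \<in> space M" "orbit_weight (space M) y \<noteq> \<infinity>"
    and eq: "\<And>r :: rat. orbit_weight (space M) y * orbit_weight {z \<in> space M. \<iota> z \<le> of_rat r} x
                 = orbit_weight (space M) x * orbit_weight {z \<in> space M. \<iota> z \<le> of_rat r} y"
  shows "\<exists>h. y = a h x"
proof -
  define Q where "Q z = distr (density lam (\<lambda>g. ennreal (\<Delta> g z * f (a g z)))) borel (\<lambda>g. \<iota> (a g z))" for z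
  have sQ[simp]: "sets (Q z) = sets borel" "space (Q z) = UNIV" for z by (simp_all add: Q_def)
  have Q: "emeasure (Q z) B = orbit_weight {w \<in> space M. \<iota> w \<in> B} z" if z: "z \<in> space M" and B[measurable]: "B \<in> sets borel" for z B
  proof -
    have [measurable]: "(\<lambda>g. \<iota> (a g z)) \<in> borel_measurable borel" "(\<lambda>g. ennreal (\<Delta> g z * f (a g z))) \<in> borel_measurable borel"
      using z by measurable
    have "emeasure (Q z) B = emeasure (density lam (\<lambda>g. ennreal (\<Delta> g z * f (a g z)))) ((\<lambda>g. \<iota> (a g z)) -` B)"
      unfolding Q_def by (subst emeasure_distr) auto
    also have "\<dots> = (\<integral>\<^sup>+g. ennreal (\<Delta> g z * f (a g z)) * indicator ((\<lambda>g. \<iota> (a g z)) -` B) g \<partial>lam)"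
      using measurable_sets[of "\<lambda>g. \<iota> (a g z)" borel borel B] by (subst emeasure_density) auto
    also have "\<dots> = orbit_weight {w \<in> space M. \<iota> w \<in> B} z"
      unfolding orbit_weight_def using z by (intro nn_integral_cong) (simp add: indicator_def)
    finally show ?thesis .
  qed
  have same: "scale_measure (orbit_weight (space M) y) (Q x) = scale_measure (orbit_weight (space M) x) (Q y)"
  proof (rule finite_measure_eqI_rational_atMost)
    show "finite_measure (scale_measure (orbit_weight (space M) y) (Q x))"
      using Q[OF x(1), of UNIV] x y by (intro finite_measureI) (simp add: space_scale_measure ennreal_mult_eq_top_iff)
    show "emeasure (scale_measure (orbit_weight (space M) y) (Q x)) {..of_rat r} = emeasure (scale_measure (orbit_weight (space M) x) (Q y)) {..of_rat r}" for r
      using Q[OF x(1), of "{..of_rat r}"] Q[OF y(1), of "{..of_rat r}"] eq[of r] by simp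
  qed simp_all
  have ox: "(\<lambda>g. \<iota> (a g x)) \<in> borel_measurable lam" using x by measurable
  have UL: "UNIV \<in> sets lam" by simp
  obtain K :: "nat \<Rightarrow> 'g set" where "(\<forall>n. K n \<in> sets lam \<and> K n \<subseteq> UNIV \<and> compact ((\<lambda>g. \<iota> (a g x)) ` K n)) \<and>
      UNIV - (\<Union>n. K n) \<in> null_sets lam"
    using lusin_compact_images[OF radon_lam sigma_finite_lam ox UL] ..
  then have K: "\<And>n. compact ((\<lambda>g. \<iota> (a g x)) ` K n)" "UNIV - (\<Union>n. K n) \<in> null_sets lam" by simp_all
  define C where "C = (\<Union>n. (\<lambda>g. \<iota> (a g x)) ` K n)"
  have C[measurable]: "C \<in> sets borel"
    unfolding C_def using K(1) by (intro sets.countable_UN) (auto simp: borel_closed compact_imp_closed)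
  have "orbit_weight {w \<in> space M. \<iota> w \<in> - C} x = (\<integral>\<^sup>+g. 0 \<partial>lam)"
    unfolding orbit_weight_def
  proof (rule nn_integral_cong_AE)
    show "AE g in lam. ennreal (\<Delta> g x * f (a g x)) * indicator {w \<in> space M. \<iota> w \<in> - C} (a g x) = 0"
      using AE_not_in[OF K(2)]
    proof eventually_elim
      case (elim g)
      then have "\<iota> (a g x) \<in> C" unfolding C_def by blast
      then show ?case by simp
    qed
  qed
  then have "emeasure (Q x) (- C) = 0" using Q[OF x(1), of "- C"] by simp
  then have "emeasure (scale_measure (orbit_weight (space M) y) (Q x)) (- C) = 0" by simp
  then have "orbit_weight (space M) x * emeasure (Q y) (- C) = 0" unfolding same by simp
  then have "orbit_weight {w \<in> space M. \<iota> w \<in> - C} y = 0" using orbit_weight_pos[OF x(1)] Q[OF y(1), of "- C"] by simp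
  have "\<exists>g. \<iota> (a g y) \<in> C"
  proof (rule ccontr)
    assume "\<nexists>g. \<iota> (a g y) \<in> C"
    then have "orbit_weight {w \<in> space M. \<iota> w \<in> - C} y = orbit_weight (space M) y"
      unfolding orbit_weight_def using y by (intro nn_integral_cong) (simp add: indicator_def)
    with \<open>orbit_weight {w \<in> space M. \<iota> w \<in> - C} y = 0\<close> orbit_weight_pos[OF y(1)] show False by simp
  qed
  then obtain g k where "\<iota> (a g y) = \<iota> (a k x)" unfolding C_def by blast
  then have "a g y = a k x" using inj x(1) y(1) by (simp add: inj_on_def)
  then have "a (- g) (a g y) = a (- g) (a k x)" by simp
  then show ?thesis using x(1) y(1) by (intro exI[of _ "- g + k"]) (simp add: action_add)
qed

text \<open>For \<open>A\<close> among the countably many sets where a fixed real coordinate \<open>\<iota>\<close> of \<open>M\<close> is at most a given rational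
  number, \<open>q x\<close> records which rational numbers are below \<open>orbit_weight A x / orbit_weight (space M) x\<close>. These
  ratios are constant along orbits, and they determine the normalized orbit measure.\<close>

lemma orbit_invariant:
  obtains q :: "'x \<Rightarrow> real" where "q \<in> borel_measurable M" "\<And>x h. x \<in> space M \<Longrightarrow> q (a h x) = q x"
    "\<And>x y. x \<in> space M \<Longrightarrow> orbit_weight (space M) x \<noteq> \<infinity> \<Longrightarrow> y \<in> space M \<Longrightarrow> orbit_weight (space M) y \<noteq> \<infinity> \<Longrightarrow>
       q x = q y \<Longrightarrow> \<exists>h. y = a h x"
proof -
  obtain \<iota> :: "'x \<Rightarrow> real" where \<iota>[measurable]: "\<iota> \<in> borel_measurable M" and inj: "inj_on \<iota> (space M)"
    using standard_borel_code[OF standard_borel] by metis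
  define A where "A r = {z \<in> space M. \<iota> z \<le> of_rat r}" for r :: rat
  have A[measurable]: "A r \<in> sets M" for r unfolding A_def by measurable
  define B where "B k = (case from_nat k of (r, s) \<Rightarrow>
      {x \<in> space M. ennreal (of_rat s) * orbit_weight (space M) x < orbit_weight (A r) x})" for k :: nat
  have B: "B k \<in> sets M" for k unfolding B_def by (cases "from_nat k :: rat \<times> rat") simp
  show ?thesis
  proof (rule that[of "set_code B"])
    show "set_code B \<in> borel_measurable M" using B by (rule measurable_set_code)
    fix x h assume x: "x \<in> space M"
    obtain t where t: "t \<noteq> 0" "t \<noteq> \<infinity>" "\<And>A. A \<in> sets M \<Longrightarrow> orbit_weight A (a h x) = t * orbit_weight A x" using orbit_weight_shift[OF x, of h] by metis
    have "ennreal (of_rat s) * orbit_weight (space M) (a h x) < orbit_weight (A r) (a h x) \<longleftrightarrow> ennreal (of_rat s) * orbit_weight (space M) x < orbit_weight (A r) x" for r s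
    proof -
      have "ennreal (of_rat s) * orbit_weight (space M) (a h x) < orbit_weight (A r) (a h x) \<longleftrightarrow>
          t * (ennreal (of_rat s) * orbit_weight (space M) x) < t * orbit_weight (A r) x" by (simp add: t(3) mult.left_commute)
      also have "\<dots> \<longleftrightarrow> ennreal (of_rat s) * orbit_weight (space M) x < orbit_weight (A r) x"
        using t(1,2) by (simp add: not_le[symmetric] ennreal_mult_le_mult_iff)
      finally show ?thesis .
    qed
    then show "set_code B (a h x) = set_code B x"
      unfolding set_code_eq_iff B_def using x by (auto split: prod.split)
  next
    fix x y assume x: "x \<in> space M" "orbit_weight (space M) x \<noteq> \<infinity>" and y: "y \<in> space M" "orbit_weight (space M) y \<noteq> \<infinity>"
      and eq: "set_code B x = set_code B y"
    have iff: "ennreal (of_rat s) * orbit_weight (space M) x < orbit_weight (A r) x \<longleftrightarrow> ennreal (of_rat s) * orbit_weight (space M) y < orbit_weight (A r) y" for r s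
    proof -
      obtain k where "from_nat k = (r, s)" by (metis from_nat_to_nat)
      then show ?thesis using eq x(1) y(1) unfolding set_code_eq_iff by (auto simp: B_def dest!: spec[of _ k])
    qed
    show "\<exists>h. y = a h x"
    proof (rule orbit_separation[OF \<iota> inj x y])
      fix r :: rat
      have AS: "A r \<subseteq> space M" by (auto simp: A_def)
      obtain X where X: "orbit_weight (space M) x = ennreal X" "0 < X"
        using x(2) orbit_weight_pos[OF x(1)] by (cases "orbit_weight (space M) x") auto
      obtain Y where Y: "orbit_weight (space M) y = ennreal Y" "0 < Y"
        using y(2) orbit_weight_pos[OF y(1)] by (cases "orbit_weight (space M) y") auto
      obtain \<alpha> where \<alpha>: "orbit_weight (A r) x = ennreal \<alpha>" "0 \<le> \<alpha>"
        using orbit_weight_mono[OF AS, of x] x(2) by (cases "orbit_weight (A r) x") (auto simp: top_unique)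
      obtain \<beta> where \<beta>: "orbit_weight (A r) y = ennreal \<beta>" "0 \<le> \<beta>"
        using orbit_weight_mono[OF AS, of y] y(2) by (cases "orbit_weight (A r) y") (auto simp: top_unique)
      have iff': "of_rat s * X < \<alpha> \<longleftrightarrow> of_rat s * Y < \<beta>" if "0 \<le> s" for s :: rat
        using iff[of s r] X Y \<alpha> \<beta> that by (simp add: ennreal_mult[symmetric] ennreal_less_iff)
      have "\<alpha> / X = \<beta> / Y"
      proof (rule linorder_cases[of "\<alpha> / X" "\<beta> / Y"])
        (* A rational number strictly between the two ratios would be compared differently with them. *)
        assume "\<alpha> / X < \<beta> / Y"
        then obtain s where s: "\<alpha> / X < of_rat s" "of_rat s < \<beta> / Y" using of_rat_dense by blast
        have "0 \<le> \<alpha> / X" using \<alpha> X by simp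
        then have "0 \<le> s" using s(1) by (metis le_less_trans less_imp_le zero_le_of_rat_iff)
        then show ?thesis using iff'[of s] s X Y by (simp add: field_simps)
      next
        assume "\<beta> / Y < \<alpha> / X"
        then obtain s where s: "\<beta> / Y < of_rat s" "of_rat s < \<alpha> / X" using of_rat_dense by blast
        have "0 \<le> \<beta> / Y" using \<beta> Y by simp
        then have "0 \<le> s" using s(1) by (metis le_less_trans less_imp_le zero_le_of_rat_iff)
        then show ?thesis using iff'[of s] s X Y by (simp add: field_simps)
      qed
      then have "Y * \<alpha> = X * \<beta>" using X(2) Y(2) by (simp add: field_simps)
      then show "orbit_weight (space M) y * orbit_weight {z \<in> space M. \<iota> z \<le> of_rat r} x
          = orbit_weight (space M) x * orbit_weight {z \<in> space M. \<iota> z \<le> of_rat r} y"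
        unfolding A_def[symmetric] X Y \<alpha> \<beta> using X(2) Y(2) \<alpha>(2) \<beta>(2) by (simp add: ennreal_mult[symmetric])
    qed
  qed
qed

end

section \<open>Orbit coordinates\<close>

text \<open>The orbits in \<open>X1\<close> are the level sets of \<open>q\<close>, and \<open>s\<close> selects a point in those with \<open>q x \<in> Y\<close>. The
  measure \<open>W\<close> is any \<open>\<sigma>\<close>-finite measure in the class of the image of \<open>M\<close> under \<open>q\<close>.\<close>

locale sectioned_action = nonsingular_action lam M a
  for lam :: "'g::{topological_group_add, t2_space, second_countable_topology} measure"
    and M :: "'x measure" and a :: "'g \<Rightarrow> 'x \<Rightarrow> 'x" +
  fixes X1 :: "'x set" and q :: "'x \<Rightarrow> real" and Y :: "real set" and s :: "real \<Rightarrow> 'x" and W :: "real measure"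
  assumes X1[measurable]: "X1 \<in> sets M" and X1_conull: "AE x in M. x \<in> X1"
    and X1_invariant: "\<And>x h. x \<in> X1 \<Longrightarrow> a h x \<in> X1"
    and X1_free: "\<And>x h. x \<in> X1 \<Longrightarrow> a h x = x \<Longrightarrow> h = 0"
    and q[measurable]: "q \<in> borel_measurable M" and q_invariant: "\<And>x h. x \<in> X1 \<Longrightarrow> q (a h x) = q x"
    and q_separates: "\<And>x y. x \<in> X1 \<Longrightarrow> y \<in> X1 \<Longrightarrow> q x = q y \<Longrightarrow> \<exists>h. y = a h x"
    and Y[measurable]: "Y \<in> sets borel" and s[measurable]: "s \<in> measurable borel M"
    and s_X1: "\<And>y. s y \<in> X1" and q_s: "\<And>y. y \<in> Y \<Longrightarrow> q (s y) = y"
    and Y_conull: "AE x in M. x \<in> X1 \<longrightarrow> q x \<in> Y"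
    and sets_W[measurable_cong, simp]: "sets W = sets borel" and sigma_finite_W: "sigma_finite_measure W"
    and AE_W: "\<And>P. {y. P y} \<in> sets borel \<Longrightarrow> (AE y in W. P y) \<longleftrightarrow> (AE x in M. P (q x))"
begin

sublocale W: sigma_finite_measure W by (rule sigma_finite_W)

sublocale WG: pair_sigma_finite W lam by unfold_locales

lemma space_W[simp]: "space W = UNIV"
  using sets_eq_imp_space_eq[OF sets_W] by simp

definition X2 :: "'x set" where "X2 = {x \<in> X1. q x \<in> Y}"

lemma X1_space: "x \<in> X1 \<Longrightarrow> x \<in> space M"
  using sets.sets_into_space[OF X1] by blast

lemma X2_measurable[measurable]: "X2 \<in> sets M"
proof -
  have "X2 = X1 \<inter> (q -` Y \<inter> space M)" using X1_space by (auto simp: X2_def)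
  then show ?thesis by simp
qed

lemma X2_conull: "AE x in M. x \<in> X2"
  using X1_conull Y_conull by eventually_elim (simp add: X2_def)

lemma X2_space: "x \<in> X2 \<Longrightarrow> x \<in> space M"
  using X1_space by (simp add: X2_def)

lemma X2_invariant: "x \<in> X2 \<Longrightarrow> a g x \<in> X2" and q_X2: "x \<in> X2 \<Longrightarrow> q (a g x) = q x"
  by (simp_all add: X2_def X1_invariant q_invariant)

definition coordinate :: "'x \<Rightarrow> 'g" where
  "coordinate x = (THE g. a g (s (q x)) = x)"

lemma orbit_of_section:
  assumes "y \<in> Y"
  shows "a g (s y) \<in> X2" "q (a g (s y)) = y" "coordinate (a g (s y)) = g"
proof -
  show q: "q (a g (s y)) = y" using q_invariant[OF s_X1] q_s[OF assms] by simp
  show "a g (s y) \<in> X2" using X1_invariant[OF s_X1] assms by (simp add: X2_def q)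
  show "coordinate (a g (s y)) = g"
    unfolding coordinate_def q
  proof (rule the_equality)
    show "a g (s y) = a g (s y)" ..
    fix k assume "a k (s y) = a g (s y)"
    then have "a (- g) (a k (s y)) = a (- g) (a g (s y))" by simp
    then have "a (- g + k) (s y) = s y" using X1_space[OF s_X1] by (simp add: action_add)
    then have "- g + k = 0" by (rule X1_free[OF s_X1])
    then show "k = g" by (simp add: neg_eq_iff_add_eq_0[symmetric])
  qed
qed

lemma coordinate_eq: "x \<in> X2 \<Longrightarrow> a (coordinate x) (s (q x)) = x"
proof -
  assume x: "x \<in> X2"
  then have Y: "q x \<in> Y" and x1: "x \<in> X1" by (simp_all add: X2_def)
  obtain h where "x = a h (s (q x))" using q_separates[OF s_X1 x1] q_s[OF Y] by metis
  then show ?thesis using orbit_of_section(3)[OF Y, of h] by simp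
qed

lemma coordinate_action: "x \<in> X2 \<Longrightarrow> coordinate (a g x) = g + coordinate x"
proof -
  assume x: "x \<in> X2"
  then have "q x \<in> Y" by (simp add: X2_def)
  moreover have "a g x = a (g + coordinate x) (s (q x))"
    using coordinate_eq[OF x] X1_space[OF s_X1] by (simp add: action_add)
  ultimately show ?thesis by (simp add: orbit_of_section)
qed

definition param :: "real \<times> 'g \<Rightarrow> 'x" where
  "param z = a (snd z) (s (fst z))"

lemma param_measurable[measurable]: "param \<in> measurable (W \<Otimes>\<^sub>M lam) M"
  unfolding param_def by measurable

text \<open>The parametrization \<open>(y, g) \<mapsto> g.s(y)\<close> respects null sets in both directions. By Fubini's theorem
  the product side says that for almost every \<open>x\<close>, almost every point \<open>g.s(q(x))\<close> satisfies \<open>P\<close>. As \<open>s(q(x))\<close> lies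
  on the orbit of \<open>x\<close>, a right translation replaces it by \<open>x\<close>; now exchange the variables and use that each
  \<open>g\<close> preserves null sets.\<close>

lemma AE_param_iff:
  assumes P: "{x \<in> space M. P x} \<in> sets M"
  shows "(AE z in W \<Otimes>\<^sub>M lam. P (param z)) \<longleftrightarrow> (AE x in M. P x)"
proof -
  define A where "A = {x \<in> space M. P x}"
  have [measurable]: "A \<in> sets M" using P by (simp add: A_def)
  have PA: "P x \<longleftrightarrow> x \<in> A" if "x \<in> space M" for x using that by (simp add: A_def)
  have sp: "a g (s y) \<in> space M" for g y using X1_space[OF s_X1] by simp
  have "(AE z in W \<Otimes>\<^sub>M lam. P (param z)) \<longleftrightarrow> (AE z in W \<Otimes>\<^sub>M lam. a (snd z) (s (fst z)) \<in> A)"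
    by (simp add: param_def PA sp)
  also have "\<dots> \<longleftrightarrow> (AE y in W. AE g in lam. a g (s y) \<in> A)"
    by (rule WG.AE_pair_iff[symmetric]) measurable
  also have "\<dots> \<longleftrightarrow> (AE x in M. AE g in lam. a g (s (q x)) \<in> A)"
  proof (rule AE_W)
    have "{y \<in> space borel. AE g in lam. a g (s y) \<in> A} \<in> sets (borel :: real measure)"
      by (rule sets_Collect_AE) measurable
    then show "{y. AE g in lam. a g (s y) \<in> A} \<in> sets borel" by simp
  qed
  also have "\<dots> \<longleftrightarrow> (AE x in M. AE g in lam. a g x \<in> A)"
  proof (rule AE_cong_simp[OF refl, THEN trans, rotated])
    have "AE x in M. (AE g in lam. a g (s (q x)) \<in> A) \<longleftrightarrow> (AE g in lam. a g x \<in> A)"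
      using X2_conull
    proof eventually_elim
      case (elim x)
      have "a g x = a (g + coordinate x) (s (q x))" for g
        using coordinate_eq[OF elim] X1_space[OF s_X1] by (simp add: action_add)
      then show ?case using AE_right[of "\<lambda>g. a g (s (q x)) \<in> A" "coordinate x"] by simp
    qed
    then show "(AE x in M. AE g in lam. a g (s (q x)) \<in> A) \<longleftrightarrow> (AE x in M. AE g in lam. a g x \<in> A)"
      by (intro iffI) (erule (1) eventually_elim2, blast)+
  qed simp
  also have "\<dots> \<longleftrightarrow> (AE g in lam. AE x in M. a g x \<in> A)"
    by (rule GM.AE_commute[symmetric]) measurable
  also have "\<dots> \<longleftrightarrow> (AE x in M. x \<in> A)"
  proof
    assume "AE g in lam. AE x in M. a g x \<in> A"
    then obtain g where "AE x in M. a g x \<in> A" using AE_lam_ex by blast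
    from AE_action_imp[OF this, of "- g"] have "AE x in M. a g (a (- g) x) \<in> A" .
    then show "AE x in M. x \<in> A" using AE_space[of M] by eventually_elim simp
  next
    assume "AE x in M. x \<in> A"
    then show "AE g in lam. AE x in M. a g x \<in> A" using AE_action_imp[of "\<lambda>x. x \<in> A"] by simp
  qed
  also have "\<dots> \<longleftrightarrow> (AE x in M. P x)" by (rule AE_cong) (simp add: PA)
  finally show ?thesis .
qed

lemma radon_WG: "radon_space (W \<Otimes>\<^sub>M lam)"
proof (rule locally_compact_imp_radon_space)
  show "locally compact (UNIV :: (real \<times> 'g) set)"
    by (rule locally_compact_Times_UNIV[OF locally_compact_UNIV locally_compact])
  have "sets (W \<Otimes>\<^sub>M lam) = sets ((borel :: real measure) \<Otimes>\<^sub>M (borel :: 'g measure))" by (rule sets_pair_measure_cong) simp_all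
  then show "sets (W \<Otimes>\<^sub>M lam) = sets borel" unfolding borel_prod .
qed

text \<open>The set of all \<open>x \<in> X2\<close> with \<open>coordinate x \<in> U\<close> is the image of \<open>Y \<times> U\<close> under the injective map \<open>param\<close>.
  The lemma \<open>lusin_compact_images\<close> provides a measurable subset of it; that the remainder is null can only be
  expressed on the side of the product, as the image is not yet known to be measurable.\<close>

lemma coordinate_preimage_exhausted:
  assumes U[measurable]: "U \<in> sets borel"
  shows "\<exists>C. C \<in> sets M \<and> (\<forall>x\<in>C. x \<in> X2 \<and> coordinate x \<in> U) \<and>
    (AE z in W \<Otimes>\<^sub>M lam. z \<in> Y \<times> U \<longrightarrow> param z \<in> C)"
proof -
  obtain \<iota> :: "'x \<Rightarrow> real" where \<iota>[measurable]: "\<iota> \<in> borel_measurable M" and inj: "inj_on \<iota> (space M)"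
    using standard_borel_code[OF standard_borel] by metis
  have f: "(\<lambda>z. \<iota> (param z)) \<in> borel_measurable (W \<Otimes>\<^sub>M lam)" by measurable
  have YU: "Y \<times> U \<in> sets (W \<Otimes>\<^sub>M lam)" by measurable
  obtain K :: "nat \<Rightarrow> (real \<times> 'g) set" where "(\<forall>n. K n \<in> sets (W \<Otimes>\<^sub>M lam) \<and> K n \<subseteq> Y \<times> U \<and>
      compact ((\<lambda>z. \<iota> (param z)) ` K n)) \<and> Y \<times> U - (\<Union>n. K n) \<in> null_sets (W \<Otimes>\<^sub>M lam)"
    using lusin_compact_images[OF radon_WG WG.sigma_finite_measure_axioms f YU] ..
  then have K: "\<And>n. K n \<subseteq> Y \<times> U" "\<And>n. compact ((\<lambda>z. \<iota> (param z)) ` K n)"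
      "Y \<times> U - (\<Union>n. K n) \<in> null_sets (W \<Otimes>\<^sub>M lam)" by simp_all
  have param_space: "param z \<in> space M" for z using X1_space[OF s_X1] by (simp add: param_def)
  define D where "D = (\<Union>n. (\<lambda>z. \<iota> (param z)) ` K n)"
  have D: "D \<in> sets borel"
    unfolding D_def using K(2) by (intro sets.countable_UN) (auto simp: borel_closed compact_imp_closed)
  define C where "C = \<iota> -` D \<inter> space M"
  have "C \<in> sets M" unfolding C_def by (rule measurable_sets[OF \<iota> D])
  moreover have "x \<in> X2 \<and> coordinate x \<in> U" if x: "x \<in> C" for x
  proof -
    obtain n z where z: "z \<in> K n" "\<iota> x = \<iota> (param z)" using x by (auto simp: C_def D_def)
    then have "x = param z" using inj x param_space by (simp add: inj_on_def C_def)
    moreover have "fst z \<in> Y" "snd z \<in> U" using K(1)[of n] z(1) by auto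
    ultimately show ?thesis by (simp add: param_def orbit_of_section)
  qed
  moreover have "AE z in W \<Otimes>\<^sub>M lam. z \<in> Y \<times> U \<longrightarrow> param z \<in> C"
    using AE_not_in[OF K(3)]
  proof eventually_elim
    case (elim z)
    show ?case
    proof
      assume "z \<in> Y \<times> U"
      then obtain n where "z \<in> K n" using elim by blast
      then show "param z \<in> C" unfolding C_def D_def using param_space by blast
    qed
  qed
  ultimately show ?thesis by blast
qed

text \<open>Approximating both the preimage of a basic open set and that of its complement from inside pins down
  the preimage on a conull set.\<close>

lemma coordinate_measurable_conull:
  obtains X3 where "X3 \<in> sets M" "X3 \<subseteq> X2" "AE x in M. x \<in> X3"
    "(\<lambda>x. if x \<in> X3 then coordinate x else 0) \<in> borel_measurable M"
proof -
  obtain B :: "'g set set" where B: "countable B" "topological_basis B" using ex_countable_basis by blast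
  have "B \<noteq> {}" using topological_basisE[OF B(2) open_UNIV UNIV_I] by blast
  define b where "b = from_nat_into B"
  have b: "range b = B" unfolding b_def using \<open>B \<noteq> {}\<close> B(1) by (rule range_from_nat_into)
  have bo: "open (b i)" for i using b B(2) by (metis rangeI topological_basis_open)
  have "\<forall>i. \<exists>C. C \<in> sets M \<and> (\<forall>x\<in>C. x \<in> X2 \<and> coordinate x \<in> b i) \<and>
      (AE z in W \<Otimes>\<^sub>M lam. z \<in> Y \<times> b i \<longrightarrow> param z \<in> C)"
    using coordinate_preimage_exhausted[OF borel_open[OF bo]] by blast
  then obtain C where C: "\<forall>i. C i \<in> sets M \<and> (\<forall>x\<in>C i. x \<in> X2 \<and> coordinate x \<in> b i) \<and>
      (AE z in W \<Otimes>\<^sub>M lam. z \<in> Y \<times> b i \<longrightarrow> param z \<in> C i)"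
    unfolding choice_iff by (elim exE)
  have "- b i \<in> sets borel" for i using bo[of i] by simp
  then have "\<forall>i. \<exists>C. C \<in> sets M \<and> (\<forall>x\<in>C. x \<in> X2 \<and> coordinate x \<in> - b i) \<and>
      (AE z in W \<Otimes>\<^sub>M lam. z \<in> Y \<times> - b i \<longrightarrow> param z \<in> C)"
    using coordinate_preimage_exhausted by blast
  then obtain C' where C': "\<forall>i. C' i \<in> sets M \<and> (\<forall>x\<in>C' i. x \<in> X2 \<and> coordinate x \<in> - b i) \<and>
      (AE z in W \<Otimes>\<^sub>M lam. z \<in> Y \<times> - b i \<longrightarrow> param z \<in> C' i)"
    unfolding choice_iff by (elim exE)
  have Cm[measurable]: "C i \<in> sets M" "C' i \<in> sets M" for i using C C' by simp_all
  have C_U: "x \<in> C i \<Longrightarrow> coordinate x \<in> b i" and C'_U: "x \<in> C' i \<Longrightarrow> coordinate x \<notin> b i" for x i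
    using C C' by auto
  define X3 where "X3 = X2 \<inter> (\<Inter>i. C i \<union> C' i)"
  have X3[measurable]: "X3 \<in> sets M" unfolding X3_def by measurable
  have Y_AE: "AE z in W \<Otimes>\<^sub>M lam. fst z \<in> Y"
  proof -
    have "AE y in W. y \<in> Y"
      using X2_conull by (subst AE_W) (simp_all add: X2_def eventually_mono)
    then have "AE y in W. AE g in lam. y \<in> Y" by eventually_elim simp
    then show ?thesis by (subst (asm) WG.AE_pair_iff) measurable
  qed
  have "AE x in M. x \<in> C i \<union> C' i" for i
  proof -
    have "AE z in W \<Otimes>\<^sub>M lam. z \<in> Y \<times> b i \<longrightarrow> param z \<in> C i" "AE z in W \<Otimes>\<^sub>M lam. z \<in> Y \<times> - b i \<longrightarrow> param z \<in> C' i"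
      using C C' by simp_all
    then have "AE z in W \<Otimes>\<^sub>M lam. param z \<in> C i \<union> C' i"
      using Y_AE by eventually_elim (auto simp: mem_Times_iff)
    then show ?thesis by (subst (asm) AE_param_iff) measurable
  qed
  then have "AE x in M. \<forall>i. x \<in> C i \<union> C' i" by (subst AE_all_countable) blast
  then have conull: "AE x in M. x \<in> X3" using X2_conull by eventually_elim (auto simp: X3_def)
  have "coordinate \<in> borel_measurable (restrict_space M X3)"
  proof (rule borel_measurableI)
    fix U :: "'g set" assume "open U"
    then obtain B' where "B' \<subseteq> range b" "\<Union>B' = U"
      using B(2) b unfolding topological_basis_def by blast
    then obtain J where J: "U = (\<Union>i\<in>J. b i)" by (metis subset_imageE)
    have sp: "space (restrict_space M X3) = X3"
      using X2_space by (auto simp: space_restrict_space X3_def)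
    have "x \<in> C i \<longleftrightarrow> coordinate x \<in> b i" if "x \<in> X3" for x i
      using that C_U[of x i] C'_U[of x i] by (auto simp: X3_def)
    then have "coordinate -` U \<inter> space (restrict_space M X3) = (\<Union>i\<in>J. C i) \<inter> X3"
      unfolding sp J by auto
    moreover have "(\<Union>i\<in>J. C i) \<inter> X3 \<in> sets M" by measurable
    ultimately show "coordinate -` U \<inter> space (restrict_space M X3) \<in> sets (restrict_space M X3)"
      by (simp add: sets_restrict_space_iff)
  qed
  then have "(\<lambda>x. if x \<in> X3 then coordinate x else 0) \<in> borel_measurable M"
    using X2_space by (subst measurable_restrict_space_iff[symmetric]) (auto simp: X3_def)
  then show ?thesis by (intro that[OF X3 _ conull]) (simp_all add: X3_def)
qed

text \<open>On the orbit core of a set on which the coordinate is measurable, \<open>coordinate x\<close> can be read off from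
  almost every translate: it equals \<open>- g + coordinate (a g x)\<close>. Fubini's theorem turns this into measurability.\<close>

lemma coordinate_measurable_invariant:
  obtains X4 where "X4 \<in> sets M" "X4 \<subseteq> X2" "AE x in M. x \<in> X4" "\<And>x g. x \<in> X4 \<Longrightarrow> a g x \<in> X4"
    "coordinate \<in> borel_measurable (restrict_space M X4)"
proof -
  obtain X3 where X3[measurable]: "X3 \<in> sets M" and sub: "X3 \<subseteq> X2" and conull: "AE x in M. x \<in> X3"
    and c: "(\<lambda>x. if x \<in> X3 then coordinate x else 0) \<in> borel_measurable M"
    by (rule coordinate_measurable_conull)
  define c where "c x = (if x \<in> X3 then coordinate x else 0)" for x
  have c[measurable]: "c \<in> borel_measurable M" using c unfolding c_def .
  define X4 where "X4 = X2 \<inter> orbit_core X3"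
  have X4[measurable]: "X4 \<in> sets M" unfolding X4_def by measurable
  show ?thesis
  proof (rule that[OF X4])
    show "X4 \<subseteq> X2" by (simp add: X4_def)
    show "AE x in M. x \<in> X4"
      using X2_conull AE_orbit_core[OF conull] by eventually_elim (simp add: X4_def)
    show "a g x \<in> X4" if "x \<in> X4" for x g
      using that X2_invariant orbit_core_invariant by (simp add: X4_def)
    show "coordinate \<in> borel_measurable (restrict_space M X4)"
    proof (rule measurableI)
      fix B :: "'g set" assume B[measurable]: "B \<in> sets borel"
      have sp: "space (restrict_space M X4) = X4"
        using X2_space by (auto simp: space_restrict_space X4_def)
      have "coordinate x \<in> B \<longleftrightarrow> (AE g in lam. - g + c (a g x) \<in> B)" if x: "x \<in> X4" for x
      proof -
        have "AE g in lam. a g x \<in> X3" using x by (simp add: X4_def orbit_core_def)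
        then have "AE g in lam. - g + c (a g x) = coordinate x"
          by eventually_elim (use x in \<open>simp add: c_def X4_def coordinate_action\<close>)
        then have "(AE g in lam. - g + c (a g x) \<in> B) \<longleftrightarrow> (AE g in lam. coordinate x \<in> B)"
          by (intro iffI) (erule (1) eventually_elim2, simp)+
        also have "\<dots> \<longleftrightarrow> coordinate x \<in> B" using AE_lam_ex[of "\<lambda>_. coordinate x \<in> B"] by auto
        finally show ?thesis by simp
      qed
      then have "coordinate -` B \<inter> space (restrict_space M X4) = X4 \<inter> {x \<in> space M. AE g in lam. - g + c (a g x) \<in> B}"
        unfolding sp using X2_space by (auto simp: X4_def)
      moreover have "{x \<in> space M. AE g in lam. - g + c (a g x) \<in> B} \<in> sets M"
        by (rule sets_Collect_AE) measurable
      ultimately show "coordinate -` B \<inter> space (restrict_space M X4) \<in> sets (restrict_space M X4)"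
        by (simp add: sets_restrict_space_iff)
    qed simp
  qed
qed

text \<open>On the invariant conull set \<open>X4\<close> the map \<open>x \<mapsto> (q x, coordinate x)\<close> is inverse to \<open>param\<close>, so that the
  lemma \<open>AE_param_iff\<close> identifies the null sets.\<close>

lemma isomorphic_to_translation:
  "isomorphic_G_spaces M a (W \<Otimes>\<^sub>M lam) (\<lambda>g (w, h). (w, g + h))"
proof -
  let ?N = "W \<Otimes>\<^sub>M lam"
  obtain X4 where X4[measurable]: "X4 \<in> sets M" and sub: "X4 \<subseteq> X2" and conull: "AE x in M. x \<in> X4"
    and inv: "\<And>x g. x \<in> X4 \<Longrightarrow> a g x \<in> X4" and c[measurable]: "coordinate \<in> borel_measurable (restrict_space M X4)"
    by (rule coordinate_measurable_invariant) blast
  define W4 where "W4 = Y \<inter> s -` X4"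
  have W4[measurable]: "W4 \<in> sets borel"
    unfolding W4_def using measurable_sets[OF s X4] by (intro sets.Int) simp_all
  define \<phi> where "\<phi> x = (q x, coordinate x)" for x
  have spX: "space (restrict_space M X4) = X4"
    using sub X2_space by (auto simp: space_restrict_space)
  have [measurable]: "q \<in> borel_measurable (restrict_space M X4)" by (intro measurable_restrict_space1 q)
  have \<phi>N[measurable]: "\<phi> \<in> measurable (restrict_space M X4) ?N" unfolding \<phi>_def by measurable
  have param_\<phi>: "param (\<phi> x) = x" if "x \<in> X4" for x
    using that sub coordinate_eq[of x] by (auto simp: param_def \<phi>_def)
  have \<phi>_param: "\<phi> (param z) = z" if "fst z \<in> Y" for z
    using that by (simp add: param_def \<phi>_def orbit_of_section)
  have \<phi>_in: "\<phi> x \<in> W4 \<times> UNIV" if "x \<in> X4" for x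
  proof -
    have "x \<in> X2" using that sub by blast
    then have "s (q x) = a (- coordinate x) x"
      using coordinate_eq[of x] X1_space[OF s_X1] by (metis action_cancel(2))
    then have "s (q x) \<in> X4" using inv[OF that] by simp
    then show ?thesis using \<open>x \<in> X2\<close> by (simp add: \<phi>_def W4_def X2_def)
  qed
  have param_in: "param z \<in> X4" if "z \<in> W4 \<times> UNIV" for z
    using that inv by (auto simp: param_def W4_def)
  have in_iff: "AE z in ?N. z \<in> W4 \<times> UNIV"
  proof -
    have X2N: "AE z in ?N. fst z \<in> Y"
    proof -
      have "AE y in W. y \<in> Y"
        using X2_conull by (subst AE_W) (simp_all add: X2_def eventually_mono)
      then have "AE y in W. AE g in lam. y \<in> Y" by eventually_elim simp
      then show ?thesis by (subst (asm) WG.AE_pair_iff) measurable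
    qed
    have "AE z in ?N. param z \<in> X4" using conull by (subst AE_param_iff) measurable
    with X2N show ?thesis
    proof eventually_elim
      case (elim z)
      then have "z = \<phi> (param z)" using \<phi>_param by simp
      then show ?case using \<phi>_in[OF elim(2)] by simp
    qed
  qed
  have Y0[measurable]: "W4 \<times> UNIV \<in> sets ?N" by measurable
  have null: "B \<in> null_sets (distr (restrict_space M X4) ?N \<phi>) \<longleftrightarrow> B \<in> null_sets ?N" for B
  proof (cases "B \<in> sets ?N")
    case True
    have m: "{x \<in> space M. x \<in> X4 \<longrightarrow> \<phi> x \<notin> B} \<in> sets M"
    proof -
      have "\<phi> -` B \<inter> X4 \<in> sets M"
        using measurable_sets[OF \<phi>N True] spX by (simp add: sets_restrict_space_iff)
      moreover have "{x \<in> space M. x \<in> X4 \<longrightarrow> \<phi> x \<notin> B} = space M - (\<phi> -` B \<inter> X4)" by auto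
      ultimately show ?thesis by simp
    qed
    have "B \<in> null_sets (distr (restrict_space M X4) ?N \<phi>) \<longleftrightarrow> (AE z in distr (restrict_space M X4) ?N \<phi>. z \<notin> B)"
      using True by (intro AE_iff_null_sets) simp
    also have "\<dots> \<longleftrightarrow> (AE x in restrict_space M X4. \<phi> x \<notin> B)"
      using sets.compl_sets[OF True] by (intro AE_distr_iff \<phi>N) (simp add: set_diff_eq)
    also have "\<dots> \<longleftrightarrow> (AE x in M. x \<in> X4 \<longrightarrow> \<phi> x \<notin> B)" by (rule AE_restrict_space_iff) simp
    also have "\<dots> \<longleftrightarrow> (AE z in ?N. param z \<in> X4 \<longrightarrow> \<phi> (param z) \<notin> B)"
      by (rule AE_param_iff[OF m, symmetric])
    also have "\<dots> \<longleftrightarrow> (AE z in ?N. z \<notin> B)"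
    proof -
      have "AE z in ?N. (param z \<in> X4 \<longrightarrow> \<phi> (param z) \<notin> B) \<longleftrightarrow> z \<notin> B"
        using in_iff by eventually_elim (use param_in \<phi>_param W4_def in auto)
      then show ?thesis by (intro iffI) (erule (1) eventually_elim2, blast)+
    qed
    also have "\<dots> \<longleftrightarrow> B \<in> null_sets ?N" using True by (intro AE_iff_null_sets[symmetric])
    finally show ?thesis .
  qed auto
  show ?thesis
    unfolding isomorphic_G_spaces_def
  proof (rule bexI[OF _ X4], rule bexI[OF _ Y0], rule exI[of _ \<phi>], intro conjI allI)
    show "invariant_set a X4" using sub X2_space inv by (intro invariant_setI) blast+
    show "space M - X4 \<in> null_sets M"
      using conull by (subst AE_iff_null_sets) (auto elim: eventually_mono)
    show "invariant_set (\<lambda>g (w, h). (w, g + h)) (W4 \<times> (UNIV :: 'g set))"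
      unfolding invariant_set_def
    proof (intro allI set_eqI iffI)
      fix g and z :: "real \<times> 'g" assume "z \<in> W4 \<times> UNIV"
      then have "(\<lambda>(w, h). (w, g + h)) (fst z, - g + snd z) \<in> (\<lambda>(w, h). (w, g + h)) ` (W4 \<times> UNIV)"
        by (intro imageI) (simp add: mem_Times_iff)
      then show "z \<in> (\<lambda>(w, h). (w, g + h)) ` (W4 \<times> UNIV)" by simp
    qed auto
    show "space ?N - W4 \<times> UNIV \<in> null_sets ?N"
    proof -
      have "space ?N - W4 \<times> UNIV \<in> sets ?N" by (rule sets.compl_sets[OF Y0])
      moreover have "AE z in ?N. z \<notin> space ?N - W4 \<times> UNIV" using in_iff by eventually_elim simp
      ultimately show ?thesis by (simp only: AE_iff_null_sets)
    qed
    show "bij_betw \<phi> X4 (W4 \<times> UNIV)"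
    proof (rule bij_betw_byWitness[where f' = param])
      show "\<forall>x\<in>X4. param (\<phi> x) = x" using param_\<phi> by blast
      show "\<forall>z\<in>W4 \<times> UNIV. \<phi> (param z) = z" using \<phi>_param by (simp add: W4_def mem_Times_iff)
      show "\<phi> ` X4 \<subseteq> W4 \<times> UNIV" using \<phi>_in by (rule image_subsetI)
      show "param ` (W4 \<times> UNIV) \<subseteq> X4" using param_in by (rule image_subsetI)
    qed
    show "\<phi> \<in> measurable (restrict_space M X4) (restrict_space ?N (W4 \<times> UNIV))"
      using \<phi>_in spX by (intro measurable_restrict_space2 \<phi>N) auto
    show "equivalent_measures (distr (restrict_space M X4) ?N \<phi>) ?N"
      unfolding equivalent_measures_def absolutely_continuous_def using null by blast
    show "AE x in restrict_space M X4. \<phi> (a g x) = (\<lambda>(w, h). (w, g + h)) (\<phi> x)" for g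
      by (rule AE_I2) (use sub in \<open>auto simp: spX \<phi>_def q_X2 coordinate_action\<close>)
  qed
qed

end

section \<open>The equivalence\<close>

context nonsingular_action
begin

text \<open>A section needs a point to start from, so the zero measure is treated separately; it is
  isomorphic to the translation space over a null base.\<close>

lemma null_space_isomorphic_to_translation:
  assumes "emeasure M (space M) = 0"
  shows "\<exists>(N :: (real \<times> 'g) measure) b. translation_G_space lam N b \<and> isomorphic_G_spaces M a N b"
proof -
  define W :: "real measure" where "W = null_measure borel"
  define N where "N = W \<Otimes>\<^sub>M lam"
  define b :: "'g \<Rightarrow> real \<times> 'g \<Rightarrow> real \<times> 'g" where "b = (\<lambda>g (w, h). (w, g + h))"
  have "finite_measure W" by (intro finite_measureI) (simp add: W_def)
  then have "sigma_finite_measure W" by (rule finite_measure.axioms)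
  then have "standard_measure_space W"
    unfolding standard_measure_space_def by (intro conjI standard_borel_real) (simp_all add: W_def)
  then have "translation_G_space lam N b" unfolding translation_G_space_def N_def b_def by blast
  moreover have "isomorphic_G_spaces M a N b"
  proof -
    interpret W: sigma_finite_measure W by fact
    have "emeasure N (space N) = emeasure N (UNIV \<times> UNIV)" by (simp add: N_def space_pair_measure W_def)
    also have "\<dots> = 0" unfolding N_def by (subst emeasure_pair_measure_Times) (simp_all add: W_def)
    finally have N0: "emeasure N (space N) = 0" .
    then have nullN: "null_sets N = sets N"
      by (auto simp: null_sets_def) (metis emeasure_space le_zero_eq)
    have "(\<lambda>_. undefined) \<in> measurable (restrict_space M {}) N"
      by (simp add: measurable_def space_restrict_space)
    then have "null_sets (distr (restrict_space M {}) N (\<lambda>_. undefined)) = sets N"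
      by (auto simp: null_sets_def emeasure_distr space_restrict_space)
    then show ?thesis
      unfolding isomorphic_G_spaces_def
      using assms N0 nullN
      by (intro bexI[of _ "{}"] exI[of _ "\<lambda>_. undefined"])
         (auto simp: bij_betw_def invariant_set_def equivalent_measures_def absolutely_continuous_def null_sets_def measurable_def
           space_restrict_space sets_restrict_space AE_restrict_space_iff)
  qed
  ultimately show ?thesis by blast
qed

lemma separated_imp_isomorphic_to_translation:
  fixes q :: "'x \<Rightarrow> real"
  assumes X1: "X1 \<in> sets M" "X1 \<noteq> {}" and conull: "AE x in M. x \<in> X1"
    and inv: "\<And>x h. x \<in> X1 \<Longrightarrow> a h x \<in> X1" and free: "\<And>x h. x \<in> X1 \<Longrightarrow> a h x = x \<Longrightarrow> h = 0"
    and q[measurable]: "q \<in> borel_measurable M" and q_inv: "\<And>x h. x \<in> X1 \<Longrightarrow> q (a h x) = q x"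
    and sep: "\<And>x y. x \<in> X1 \<Longrightarrow> y \<in> X1 \<Longrightarrow> q x = q y \<Longrightarrow> \<exists>h. y = a h x"
  shows "\<exists>(N :: (real \<times> 'g) measure) b. translation_G_space lam N b \<and> isomorphic_G_spaces M a N b"
proof -
  obtain Y s where "Y \<in> sets borel \<and> s \<in> measurable borel M \<and> (\<forall>y. s y \<in> X1) \<and> (\<forall>y\<in>Y. q (s y) = y) \<and>
      (AE x in M. x \<in> X1 \<longrightarrow> q x \<in> Y)"
    using measurable_section[OF standard_borel sigma_finite_M q X1] by (elim exE)
  then have Y: "Y \<in> sets borel" and s: "s \<in> measurable borel M" "\<And>y. s y \<in> X1" "\<And>y. y \<in> Y \<Longrightarrow> q (s y) = y"
    and Yc: "AE x in M. x \<in> X1 \<longrightarrow> q x \<in> Y" by simp_all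
  obtain p :: "'x \<Rightarrow> real" where p[measurable]: "p \<in> borel_measurable M" and pos: "\<And>x. 0 < p x"
    and fin: "finite_measure (density M p)"
    by (rule sigma_finite_equivalent_finite_density[OF sigma_finite_M]) blast
  define W where "W = distr (density M p) borel q"
  interpret p: finite_measure "density M p" by fact
  have "finite_measure W" unfolding W_def by (rule p.finite_measure_distr) measurable
  then have sf: "sigma_finite_measure W" by (rule finite_measure.axioms)
  have sW: "sets W = sets borel" by (simp add: W_def)
  have AE_W: "(AE y in W. P y) \<longleftrightarrow> (AE x in M. P (q x))" if "{y. P y} \<in> sets borel" for P
  proof -
    have "(AE y in W. P y) \<longleftrightarrow> (AE x in density M p. P (q x))"
      unfolding W_def using that by (intro AE_distr_iff) auto
    also have "\<dots> \<longleftrightarrow> (AE x in M. P (q x))" using pos by (subst AE_density) auto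
    finally show ?thesis .
  qed
  interpret sectioned_action lam M a X1 q Y s W
    by (intro sectioned_action.intro sectioned_action_axioms.intro nonsingular_action_axioms)
       (fact X1(1) conull inv free q q_inv sep Y s Yc sW sf | rule AE_W)+
  have "translation_G_space lam (W \<Otimes>\<^sub>M lam) (\<lambda>g (w, h). (w, g + h))"
    unfolding translation_G_space_def standard_measure_space_def
    using sf standard_borel_real[OF sW] by blast
  with isomorphic_to_translation show ?thesis by blast
qed

text \<open>The set \<open>X1\<close> on which the construction takes place must be invariant and Borel, and all its points must be free.
  The points that are not free are contained in a Borel null set \<open>N0\<close>; on an orbit that is not almost entirely
  contained in \<open>N0\<close> some point is free, and then all points are, as stabilizers are conjugate.\<close>

lemma dissipative_imp_isomorphic_to_translation:
  assumes "essentially_free M a" and "totally_dissipative lam M a"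
  shows "\<exists>(N :: (real \<times> 'g) measure) b. translation_G_space lam N b \<and> isomorphic_G_spaces M a N b"
proof -
  obtain \<Delta> C D where coc: "radon_nikodym_cocycle M a \<Delta>" and hopf: "hopf_decomposition lam M a \<Delta> C D"
    and C0: "emeasure M C = 0"
    using assms(2) unfolding totally_dissipative_def by blast
  obtain f :: "'x \<Rightarrow> real" where f: "f \<in> borel_measurable M" "\<And>x. 0 < f x" "integrable M f"
    by (rule M.obtain_positive_integrable_function) blast
  then have fL: "f \<in> L1_plus M" by (simp add: L1_plus_def)
  interpret cocycle_action lam M a \<Delta> f by unfold_locales (fact coc fL)+
  have notC: "AE x in M. x \<notin> C" using C0 hopf by (intro AE_not_in null_setsI) (simp_all add: hopf_decomposition_def)
  have CD: "C \<union> D = space M" using hopf by (simp add: hopf_decomposition_def)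
  have "AE x in M. x \<in> D \<longleftrightarrow> S_fun lam a \<Delta> f x < \<infinity>"
    using hopf fL by (simp add: hopf_decomposition_def)
  then have fin: "AE x in M. orbit_weight (space M) x \<noteq> \<infinity>"
    using notC AE_space[of M] by eventually_elim (use CD in \<open>auto simp: orbit_weight_space\<close>)
  obtain N0 where N0: "N0 \<in> null_sets M" "{x \<in> space M. {g. a g x = x} \<noteq> {0}} \<subseteq> N0"
    using assms(1) unfolding essentially_free_def eventually_ae_filter by (elim bexE) (rule that)
  have N0m[measurable]: "N0 \<in> sets M" using N0(1) by auto
  define X1 where "X1 = {x \<in> orbit_core (space M - N0). orbit_weight (space M) x \<noteq> \<infinity>}"
  have X1_space: "x \<in> space M" if "x \<in> X1" for x using that by (simp add: X1_def orbit_core_def)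
  have X1: "X1 \<in> sets M"
  proof -
    have "X1 = orbit_core (space M - N0) \<inter> {x \<in> space M. orbit_weight (space M) x \<noteq> \<infinity>}"
      by (auto simp: X1_def orbit_core_def)
    also have "\<dots> \<in> sets M" by measurable
    finally show ?thesis .
  qed
  have conull: "AE x in M. x \<in> X1"
  proof -
    have "AE x in M. x \<in> space M - N0" using AE_not_in[OF N0(1)] AE_space by eventually_elim simp
    from AE_orbit_core[OF this] fin show ?thesis by eventually_elim (simp add: X1_def)
  qed
  have inv: "a h x \<in> X1" if "x \<in> X1" for x h
    using that orbit_core_invariant orbit_weight_finite_invariant[OF X1_space[OF that]] by (simp add: X1_def)
  have free: "h = 0" if x: "x \<in> X1" and fixed: "a h x = x" for x h
  proof -
    note sp = X1_space[OF x]
    have "\<exists>g. a g x \<in> space M - N0" using x by (intro orbit_coreD) (simp add: X1_def)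
    then obtain g where g: "a g x \<notin> N0" by blast
    have "a g x \<in> space M" using sp by simp
    then have triv: "{k. a k (a g x) = a g x} = {0}" using g N0(2) by blast
    have "a (g + h + - g) (a g x) = a (g + h) (a (- g) (a g x))" by (rule action_add) (use sp in simp)
    also have "\<dots> = a (g + h) x" using sp by simp
    also have "\<dots> = a g x" using sp fixed by (simp add: action_add)
    finally have "g + h + - g = 0" using triv by blast
    then show "h = 0" by (metis add.right_neutral add_left_cancel diff_conv_add_uminus eq_iff_diff_eq_0)
  qed
  show ?thesis
  proof (cases "X1 = {}")
    case True
    with conull have "AE x in M. x \<notin> space M" by simp
    then have "space M \<in> null_sets M" by (simp only: AE_iff_null_sets[OF sets.top])
    then have "emeasure M (space M) = 0" by (rule null_setsD1)
    then show ?thesis by (rule null_space_isomorphic_to_translation)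
  next
    case False
    obtain q :: "'x \<Rightarrow> real" where q: "q \<in> borel_measurable M" "\<And>x h. x \<in> space M \<Longrightarrow> q (a h x) = q x"
      "\<And>x y. x \<in> space M \<Longrightarrow> orbit_weight (space M) x \<noteq> \<infinity> \<Longrightarrow> y \<in> space M \<Longrightarrow> orbit_weight (space M) y \<noteq> \<infinity> \<Longrightarrow>
         q x = q y \<Longrightarrow> \<exists>h. y = a h x"
      by (rule orbit_invariant) blast
    have "\<exists>h. y = a h x" if "x \<in> X1" "y \<in> X1" "q x = q y" for x y
      using that X1_space by (intro q(3)) (simp_all add: X1_def)
    with X1 False conull inv free q(1) q(2)[OF X1_space] show ?thesis
      by (rule separated_imp_isomorphic_to_translation)
  qed
qed

end

lemma isomorphic_to_translation_imp_dissipative: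
  fixes N :: "('w \<times> 'g::{topological_group_add, t2_space, second_countable_topology}) measure"
  assumes "nonsingular_action lam M a" and "translation_G_space lam N b" and "isomorphic_G_spaces M a N b"
  shows "totally_dissipative lam M a"
proof -
  interpret nonsingular_action lam M a by fact
  obtain W where W: "standard_measure_space W" "N = W \<Otimes>\<^sub>M lam" "b = (\<lambda>g (w, h). (w, g + h))"
    using assms(2) unfolding translation_G_space_def by blast
  obtain X0 Y0 \<phi> where iso: "X0 \<in> sets M" "Y0 \<in> sets N" "invariant_set a X0" "space M - X0 \<in> null_sets M"
    "bij_betw \<phi> X0 Y0" "\<phi> \<in> measurable (restrict_space M X0) (restrict_space N Y0)"
    "equivalent_measures (distr (restrict_space M X0) N \<phi>) N"
    "\<And>g. AE x in restrict_space M X0. \<phi> (a g x) = b g (\<phi> x)"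
    using assms(3) unfolding isomorphic_G_spaces_def by blast
  interpret translation_isomorphism lam M a W X0 Y0 \<phi>
    by unfold_locales (fact W(1) iso[unfolded W(2,3)])+
  show ?thesis by (rule totally_dissipative)
qed

(* HOL cannot quantify existentially over the type carrying W_o. Every standard Borel space is
   isomorphic to a Borel subset of the reals, so the existential ranges over base spaces carried
   by sets of reals; the second conjunct covers base spaces carried by an arbitrary type 'w. *)
theorem theoremE:
  fixes lam :: "'g::{topological_group_add, t2_space, second_countable_topology} measure"
    and M :: "'x measure"
    and a :: "'g \<Rightarrow> 'x \<Rightarrow> 'x"
  assumes "locally compact (UNIV :: 'g set)"
    and "left_haar_measure lam"
    and "nonsingular_G_space M a"
    and "essentially_free M a"
  shows "(totally_dissipative lam M a \<longleftrightarrow>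
            (\<exists>(N :: (real \<times> 'g) measure) b.
               translation_G_space lam N b \<and> isomorphic_G_spaces M a N b)) \<and>
         (\<forall>(N :: ('w \<times> 'g) measure) b.
            translation_G_space lam N b \<and> isomorphic_G_spaces M a N b
              \<longrightarrow> totally_dissipative lam M a)"
proof -
  interpret nonsingular_action lam M a by unfold_locales (fact assms)+
  have action: "nonsingular_action lam M a" by (rule nonsingular_action_axioms)
  show ?thesis
  proof (intro conjI iffI allI impI)
    assume "totally_dissipative lam M a"
    with assms(4) show "\<exists>(N :: (real \<times> 'g) measure) b.
        translation_G_space lam N b \<and> isomorphic_G_spaces M a N b"
      by (rule dissipative_imp_isomorphic_to_translation)
  qed (use isomorphic_to_translation_imp_dissipative[OF action] in blast)+
qed

end
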